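(* Let $\mathfrak{g}_0$ be a semisimple real Lie algebra, $\mathfrak{g}$ its complexification, and $\mathfrak{f}$ a parabolic subalgebra of $\mathfrak{g}$, so that $(\mathfrak{g}_0,\mathfrak{f})$ is a $CR$ algebra. Let $(\theta,\mathfrak{h}_0)$ be a pair adapted to $(\mathfrak{g}_0,\mathfrak{f})$, let $\kappa_0=\{X\in\mathfrak{g}_0\mid\theta(X)=X\}$ be the corresponding maximal compact subalgebra of $\mathfrak{g}_0$, $\kappa$ its complexification, and $\mathfrak{v}=\mathfrak{f}\cap\kappa$. Then $\mathfrak{v}\cap\bar{\mathfrak{v}}$ is a reductive complement of $\mathfrak{n}_\kappa(\mathfrak{v})$ in $\mathfrak{v}$. Hence the $\mathbf{K}_0$-orbit $M$ through the base point $\mathfrak{f}$ of the complex flag manifold $F=\mathbf{G}/\mathbf{F}$ is an $\mathfrak{n}$-reductive $CR$ manifold.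
   Context: A pair $(\theta,\mathfrak{h}_0)$ is adapted to $(\mathfrak{g}_0,\mathfrak{f})$ if $\theta$ is a Cartan involution of $\mathfrak{g}_0$ and $\mathfrak{h}_0$ is a $\theta$-invariant Cartan subalgebra of $\mathfrak{g}_0$ contained in $\mathfrak{f}$. Bar denotes conjugation of $\mathfrak{g}$ with respect to $\mathfrak{g}_0$ (it restricts on $\kappa$ to the conjugation with respect to $\kappa_0$). An element $X$ of the reductive Lie algebra $\kappa$ is nilpotent if $X\in[\kappa,\kappa]$ and $\mathrm{ad}_\kappa(X)$ is nilpotent; $\mathfrak{n}_\kappa(\mathfrak{v})$ is the ideal of $\mathfrak v$ formed by the nilpotent elements of the radical of $\mathfrak{v}$. $\mathbf{G}$ is a connected complex algebraic Lie group with Lie algebra $\mathfrak{g}$, $\mathbf{F}=\{g\in\mathbf{G}\mid\mathrm{Ad}_{\mathfrak{g}}(g)(\mathfrak{f})=\mathfrak{f}\}$ the parabolic subgroup with Lie algebra $\mathfrak{f}$ (so points of $F=\mathbf{G}/\mathbf{F}$ correspond to the $\mathrm{Ad}(\mathbf G)$-conjugates of $\mathfrak{f}$), $\mathbf{G}_0$ a real form of $\mathbf{G}$ with Lie algebra $\mathfrak{g}_0$, and $\mathbf{K}_0$ the maximal compact subgroup of $\mathbf{G}_0$ with Lie algebra $\kappa_0$. The orbit $M=\mathbf{K}_0\cdot\mathfrak{f}\subset F$ is a $\mathbf{K}_0$-homogeneous $CR$ submanifold of $F$, whose $CR$ algebra at the base point is $(\kappa_0,\mathfrak{v})$, i.e.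 $\mathfrak{v}$ is the inverse image of $T^{0,1}M$ at the base point under the complexified differential $\kappa\to\mathbb{C}TM$ of the orbit map. A $\mathbf{K}_0$-homogeneous $CR$ manifold with $CR$ algebra $(\kappa_0,\mathfrak{v})$ is called $\mathfrak{n}$-reductive if $\mathfrak{v}\cap\bar{\mathfrak{v}}$ is a reductive complement of $\mathfrak{n}_\kappa(\mathfrak{v})$ in $\mathfrak{v}$, i.e. $\mathfrak v=\mathfrak n_\kappa(\mathfrak v)\oplus(\mathfrak v\cap\bar{\mathfrak v})$. *)

theory Defs
  imports "HOL-Analysis.Analysis" "HOL-Library.Function_Algebras"
begin

section \<open>Lie algebras\<close>

text \<open>
  The Lie algebras of interest (real forms, subalgebras, ideals) are subsets of one ambient
  space, so all notions below are relative to a subset \<open>L\<close>.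
\<close>

locale lie_algebra = vector_space scale
  for scale :: "'k::field \<Rightarrow> 'g::ab_group_add \<Rightarrow> 'g" +
  fixes br :: "'g \<Rightarrow> 'g \<Rightarrow> 'g"
  assumes br_add_left: "br (x + y) z = br x z + br y z"
    and br_add_right: "br x (y + z) = br x y + br x z"
    and br_scale_left: "br (scale c x) y = scale c (br x y)"
    and br_scale_right: "br x (scale c y) = scale c (br x y)"
    and br_self: "br x x = 0"
    and jacobi: "br x (br y z) + br y (br z x) + br z (br x y) = 0"
begin

definition lie_subalgebra :: "'g set \<Rightarrow> bool" where
  "lie_subalgebra L \<longleftrightarrow> subspace L \<and> (\<forall>x\<in>L. \<forall>y\<in>L. br x y \<in> L)"

definition lie_ideal :: "'g set \<Rightarrow> 'g set \<Rightarrow> bool" where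
  "lie_ideal I L \<longleftrightarrow> subspace I \<and> I \<subseteq> L \<and> (\<forall>x\<in>L. \<forall>y\<in>I. br x y \<in> I)"

definition commutator :: "'g set \<Rightarrow> 'g set \<Rightarrow> 'g set" where
  "commutator A B = span {br x y | x y. x \<in> A \<and> y \<in> B}"

definition solvable :: "'g set \<Rightarrow> bool" where
  "solvable L \<longleftrightarrow> (\<exists>k. ((\<lambda>D. commutator D D) ^^ k) L = {0})"

definition nilpotent :: "'g set \<Rightarrow> bool" where
  "nilpotent L \<longleftrightarrow> (\<exists>k. ((\<lambda>C. commutator L C) ^^ k) L = {0})"

text \<open>The sum of all solvable ideals, which is the largest solvable ideal in finite dimension.\<close>

definition radical :: "'g set \<Rightarrow> 'g set" where
  "radical L = span (\<Union>{I. lie_ideal I L \<and> solvable I})"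

definition center :: "'g set \<Rightarrow> 'g set" where
  "center L = {x \<in> L. \<forall>y\<in>L. br x y = 0}"

definition semisimple :: "'g set \<Rightarrow> bool" where
  "semisimple L \<longleftrightarrow> lie_subalgebra L \<and> radical L = {0}"

definition reductive :: "'g set \<Rightarrow> bool" where
  "reductive L \<longleftrightarrow> lie_subalgebra L \<and> radical L = center L"

definition cartan_subalgebra :: "'g set \<Rightarrow> 'g set \<Rightarrow> bool" where
  "cartan_subalgebra H L \<longleftrightarrow> lie_subalgebra H \<and> H \<subseteq> L \<and> nilpotent H \<and>
     {x \<in> L. \<forall>y\<in>H. br x y \<in> H} = H"

definition borel_subalgebra :: "'g set \<Rightarrow> 'g set \<Rightarrow> bool" where
  "borel_subalgebra B L \<longleftrightarrow> lie_subalgebra B \<and> B \<subseteq> L \<and> solvable B \<and>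
     (\<forall>S. lie_subalgebra S \<and> S \<subseteq> L \<and> solvable S \<and> B \<subseteq> S \<longrightarrow> S = B)"

definition parabolic_subalgebra :: "'g set \<Rightarrow> 'g set \<Rightarrow> bool" where
  "parabolic_subalgebra P L \<longleftrightarrow> lie_subalgebra P \<and> P \<subseteq> L \<and>
     (\<exists>B. borel_subalgebra B L \<and> B \<subseteq> P)"

text \<open>The choice of basis is immaterial if \<open>L\<close> is finite-dimensional and \<open>T\<close> maps \<open>L\<close> linearly to \<open>L\<close>.\<close>

definition trace_on :: "'g set \<Rightarrow> ('g \<Rightarrow> 'g) \<Rightarrow> 'k" where
  "trace_on L T = (let B = (SOME B. independent B \<and> span B = L)
                   in \<Sum>b\<in>B. representation B (T b) b)"

definition killing_form :: "'g set \<Rightarrow> 'g \<Rightarrow> 'g \<Rightarrow> 'k" where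
  "killing_form L x y = trace_on L (\<lambda>z. br x (br y z))"

text \<open>
  Nilpotency of elements of a reductive Lie algebra \<open>L\<close>: without membership in \<open>[L,L]\<close> every
  central element would qualify.
\<close>

definition nilpotent_element :: "'g set \<Rightarrow> 'g \<Rightarrow> bool" where
  "nilpotent_element L x \<longleftrightarrow> x \<in> commutator L L \<and> (\<exists>m. \<forall>y\<in>L. (br x ^^ m) y = 0)"

definition nil_ideal :: "'g set \<Rightarrow> 'g set \<Rightarrow> 'g set" where
  "nil_ideal L V = {x \<in> radical V. nilpotent_element L x}"

definition direct_sum :: "'g set \<Rightarrow> 'g set \<Rightarrow> 'g set \<Rightarrow> bool" where
  "direct_sum V A B \<longleftrightarrow> subspace A \<and> subspace B \<and> V = {a + b | a b. a \<in> A \<and> b \<in> B} \<and> A \<inter> B = {0}"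

definition reductive_complement :: "'g set \<Rightarrow> 'g set \<Rightarrow> 'g set \<Rightarrow> bool" where
  "reductive_complement R N V \<longleftrightarrow> reductive R \<and> direct_sum V N R"

end


locale complex_lie_algebra = lie_algebra scale br
  for scale :: "complex \<Rightarrow> 'g::ab_group_add \<Rightarrow> 'g" and br :: "'g \<Rightarrow> 'g \<Rightarrow> 'g" +
  assumes finite_dimensional: "\<exists>B. finite B \<and> span B = UNIV"
begin

sublocale re: lie_algebra "\<lambda>r. scale (complex_of_real r)" br
  by unfold_locales
    (simp_all add: scale_left_distrib scale_right_distrib br_add_left br_add_right
      br_scale_left br_scale_right br_self jacobi)

definition complexify :: "'g set \<Rightarrow> 'g set" where
  "complexify L0 = {x + scale \<i> y | x y. x \<in> L0 \<and> y \<in> L0}"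

text \<open>The ambient complex Lie algebra is the complexification of \<open>L0\<close>.\<close>

definition real_form :: "'g set \<Rightarrow> bool" where
  "real_form L0 \<longleftrightarrow> re.lie_subalgebra L0 \<and> complexify L0 = UNIV \<and> L0 \<inter> scale \<i> ` L0 = {0}"

text \<open>Only meaningful on \<^term>\<open>complexify L0\<close>, for \<open>L0\<close> contained in a real form.\<close>

definition conjugation :: "'g set \<Rightarrow> 'g \<Rightarrow> 'g" where
  "conjugation L0 z = (THE w. \<exists>x\<in>L0. \<exists>y\<in>L0. z = x + scale \<i> y \<and> w = x - scale \<i> y)"

definition cartan_involution :: "'g set \<Rightarrow> ('g \<Rightarrow> 'g) \<Rightarrow> bool" where
  "cartan_involution L0 \<theta> \<longleftrightarrow>
     (\<forall>x\<in>L0. \<theta> x \<in> L0 \<and> \<theta> (\<theta> x) = x) \<and>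
     (\<forall>x\<in>L0. \<forall>y\<in>L0. \<theta> (x + y) = \<theta> x + \<theta> y) \<and>
     (\<forall>r. \<forall>x\<in>L0. \<theta> (scale (complex_of_real r) x) = scale (complex_of_real r) (\<theta> x)) \<and>
     (\<forall>x\<in>L0. \<forall>y\<in>L0. \<theta> (br x y) = br (\<theta> x) (\<theta> y)) \<and>
     (\<forall>x\<in>L0. x \<noteq> 0 \<longrightarrow> - re.killing_form L0 x (\<theta> x) > 0)"

definition adapted :: "'g set \<Rightarrow> 'g set \<Rightarrow> ('g \<Rightarrow> 'g) \<Rightarrow> 'g set \<Rightarrow> bool" where
  "adapted g0 f \<theta> h0 \<longleftrightarrow> cartan_involution g0 \<theta> \<and> re.cartan_subalgebra h0 g0 \<and>
     \<theta> ` h0 = h0 \<and> h0 \<subseteq> f"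

end


section \<open>Linear groups\<close>

definition mexp :: "complex^'n^'n \<Rightarrow> complex^'n^'n" where
  "mexp A = (\<Sum>k. (1 / fact k) *\<^sub>R ((\<lambda>B. A ** B) ^^ k) (mat 1))"

definition linear_group :: "(complex^'n^'n) set \<Rightarrow> bool" where
  "linear_group G \<longleftrightarrow> (\<forall>a\<in>G. invertible a \<and> matrix_inv a \<in> G) \<and> mat 1 \<in> G \<and>
     (\<forall>a\<in>G. \<forall>b\<in>G. a ** b \<in> G)"

definition group_lie_algebra :: "(complex^'n^'n) set \<Rightarrow> (complex^'n^'n) set" where
  "group_lie_algebra G = {X. \<forall>t::real. mexp (t *\<^sub>R X) \<in> G}"

inductive matrix_polynomial :: "(complex^'n^'n \<Rightarrow> complex) \<Rightarrow> bool" where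
  "matrix_polynomial (\<lambda>A. c)"
| "matrix_polynomial (\<lambda>A. A $ i $ j)"
| "matrix_polynomial p \<Longrightarrow> matrix_polynomial q \<Longrightarrow> matrix_polynomial (\<lambda>A. p A + q A)"
| "matrix_polynomial p \<Longrightarrow> matrix_polynomial q \<Longrightarrow> matrix_polynomial (\<lambda>A. p A * q A)"

text \<open>
  Zariski-closed subgroups of the general linear group; powers of the inverse determinant can be
  cleared from the defining equations.
\<close>

definition algebraic_group :: "(complex^'n^'n) set \<Rightarrow> bool" where
  "algebraic_group G \<longleftrightarrow> linear_group G \<and>
     (\<exists>P. (\<forall>p\<in>P. matrix_polynomial p) \<and> G = {A. invertible A \<and> (\<forall>p\<in>P. p A = 0)})"

definition maximal_compact_subgroup :: "(complex^'n^'n) set \<Rightarrow> (complex^'n^'n) set \<Rightarrow> bool" where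
  "maximal_compact_subgroup K G \<longleftrightarrow> linear_group K \<and> K \<subseteq> G \<and> compact K \<and>
     (\<forall>K'. linear_group K' \<and> K' \<subseteq> G \<and> compact K' \<and> K \<subseteq> K' \<longrightarrow> K' = K)"

text \<open>\<open>\<iota>\<close> identifies the abstract Lie algebra with the Lie algebra of \<open>G\<close>.\<close>

definition (in complex_lie_algebra) lie_identification ::
    "('g \<Rightarrow> complex^'n^'n) \<Rightarrow> (complex^'n^'n) set \<Rightarrow> bool" where
  "lie_identification \<iota> G \<longleftrightarrow>
     inj \<iota> \<and> range \<iota> = group_lie_algebra G \<and>
     (\<forall>x y. \<iota> (x + y) = \<iota> x + \<iota> y) \<and>
     (\<forall>c x. \<iota> (scale c x) = mat c ** \<iota> x) \<and>
     (\<forall>x y. \<iota> (br x y) = \<iota> x ** \<iota> y - \<iota> y ** \<iota> x)"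

definition Ad :: "('g \<Rightarrow> complex^'n^'n) \<Rightarrow> complex^'n^'n \<Rightarrow> 'g \<Rightarrow> 'g" where
  "Ad \<iota> a x = inv \<iota> (a ** \<iota> x ** matrix_inv a)"

definition Ad_orbit :: "('g \<Rightarrow> complex^'n^'n) \<Rightarrow> (complex^'n^'n) set \<Rightarrow> 'g set \<Rightarrow> 'g set set" where
  "Ad_orbit \<iota> H x = {Ad \<iota> a ` x | a. a \<in> H}"


section \<open>The flag manifold and its CR submanifolds\<close>

text \<open>
  Points of the flag manifold are the conjugates of the parabolic subalgebra \<open>f\<close>, that is, the
  elements of \<open>Ad_orbit \<iota> G f\<close>.  The fibres of \<open>a \<mapsto> Ad \<iota> a ` f\<close> are the left cosets of the
  stabiliser of \<open>f\<close>, so this set is the coset space.  Topology, smooth functions and holomorphic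
  functions are the quotient ones: a function on the flag manifold is smooth (holomorphic) iff
  its pull-back to \<open>G\<close> is, and a function on the closed complex submanifold \<open>G\<close> of the general
  linear group is smooth (holomorphic) iff it locally extends to a smooth (holomorphic)
  function of matrices.
\<close>

text \<open>
  For open \<open>S\<close> this is \<open>C\<^sup>\<infinity>\<close>: every iterated directional derivative exists and is again
  differentiable on \<open>S\<close>.  Coinduction supplies derivatives of all orders.
\<close>

coinductive smooth_on :: "'a::real_normed_vector set \<Rightarrow> ('a \<Rightarrow> 'b::real_normed_vector) \<Rightarrow> bool"
  for S where
  "(\<And>x. x \<in> S \<Longrightarrow> (f has_derivative D x) (at x)) \<Longrightarrow> (\<And>u. smooth_on S (\<lambda>x. D x u)) \<Longrightarrow>
   smooth_on S f"

definition holomorphic_on_matrices :: "(complex^'n^'n) set \<Rightarrow> (complex^'n^'n \<Rightarrow> complex) \<Rightarrow> bool" where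
  "holomorphic_on_matrices S \<Psi> \<longleftrightarrow> smooth_on S \<Psi> \<and>
     (\<forall>a\<in>S. \<forall>X. frechet_derivative \<Psi> (at a) (mat \<i> ** X) = \<i> * frechet_derivative \<Psi> (at a) X)"

text \<open>
  In the following locale \<open>smooth_near x \<phi>\<close> and \<open>holomorphic_near x \<phi>\<close> say that the total
  function \<open>\<phi>\<close> represents a smooth or holomorphic germ at the point \<open>x\<close>.  Tangent vectors are
  derivations of smooth germs, extended by \<open>0\<close> to functions that are not smooth near the point.
\<close>

locale flag_manifold =
  fixes \<iota> :: "'g \<Rightarrow> complex^'n^'n" and G :: "(complex^'n^'n) set" and f :: "'g set"
begin

abbreviation Flag :: "'g set set" where
  "Flag \<equiv> Ad_orbit \<iota> G f"

definition flag_topology :: "'g set topology" where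
  "flag_topology =
     topology (\<lambda>U. U \<subseteq> Flag \<and> openin (top_of_set G) {a \<in> G. Ad \<iota> a ` f \<in> U})"

definition smooth_near :: "'g set \<Rightarrow> ('g set \<Rightarrow> complex) \<Rightarrow> bool" where
  "smooth_near x \<phi> \<longleftrightarrow> (\<exists>a W \<Psi>. a \<in> G \<and> x = Ad \<iota> a ` f \<and> open W \<and> a \<in> W \<and>
     smooth_on W \<Psi> \<and> (\<forall>b \<in> W \<inter> G. \<phi> (Ad \<iota> b ` f) = \<Psi> b))"

definition holomorphic_near :: "'g set \<Rightarrow> ('g set \<Rightarrow> complex) \<Rightarrow> bool" where
  "holomorphic_near x \<phi> \<longleftrightarrow> (\<exists>a W \<Psi>. a \<in> G \<and> x = Ad \<iota> a ` f \<and> open W \<and> a \<in> W \<and>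
     holomorphic_on_matrices W \<Psi> \<and> (\<forall>b \<in> W \<inter> G. \<phi> (Ad \<iota> b ` f) = \<Psi> b))"

definition smooth_map :: "'a::real_normed_vector set \<Rightarrow> ('a \<Rightarrow> 'g set) \<Rightarrow> bool" where
  "smooth_map S p \<longleftrightarrow> (\<forall>w\<in>S. p w \<in> Flag \<and> (\<forall>\<phi>. smooth_near (p w) \<phi> \<longrightarrow>
     (\<exists>W \<Psi>. open W \<and> w \<in> W \<and> smooth_on W \<Psi> \<and> (\<forall>w' \<in> W \<inter> S. \<phi> (p w') = \<Psi> w'))))"

definition velocity :: "(real \<Rightarrow> 'g set) \<Rightarrow> ('g set \<Rightarrow> complex) \<Rightarrow> complex" where
  "velocity c = (\<lambda>\<phi>. if smooth_near (c 0) \<phi> then vector_derivative (\<lambda>t. \<phi> (c t)) (at 0) else 0)"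

text \<open>
  Local parametrisations are defined on open subsets \<open>W \<inter> V\<close> of a \<open>d\<close>-dimensional real subspace
  \<open>V\<close> of the matrix space, which plays the role of \<open>\<real>\<^sup>d\<close> (its real dimension is at least that of
  the flag manifold).
\<close>

definition embedded_submanifold :: "nat \<Rightarrow> 'g set set \<Rightarrow> bool" where
  "embedded_submanifold d M \<longleftrightarrow> M \<subseteq> Flag \<and>
     (\<forall>x\<in>M. \<exists>U (V :: (complex^'n^'n) set) W p.
        openin flag_topology U \<and> x \<in> U \<and> subspace V \<and> dim V = d \<and> open W \<and>
        smooth_map (W \<inter> V) p \<and>
        homeomorphic_map (top_of_set (W \<inter> V)) (subtopology flag_topology (M \<inter> U)) p \<and>
        (\<forall>w \<in> W \<inter> V. \<forall>u\<in>V. velocity (\<lambda>t. p (w + t *\<^sub>R u)) = 0 \<longrightarrow> u = 0))"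

definition tangent_space :: "'g set set \<Rightarrow> 'g set \<Rightarrow> (('g set \<Rightarrow> complex) \<Rightarrow> complex) set" where
  "tangent_space M x = {velocity c | c. c 0 = x \<and>
     (\<exists>e>0. smooth_map {-e<..<e} c \<and> c ` {-e<..<e} \<subseteq> M)}"

definition complex_tangent_space :: "'g set set \<Rightarrow> 'g set \<Rightarrow> (('g set \<Rightarrow> complex) \<Rightarrow> complex) set" where
  "complex_tangent_space M x =
     {\<lambda>\<phi>. D \<phi> + \<i> * E \<phi> | D E. D \<in> tangent_space M x \<and> E \<in> tangent_space M x}"

text \<open>
  The intersection of the complexified tangent space of \<open>M\<close> with the vectors of type \<open>(0,1)\<close> of the
  flag manifold: those that satisfy \<open>D z\<^sub>j = 0\<close> for holomorphic coordinates \<open>z\<^sub>j\<close>, equivalently that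
  annihilate all holomorphic germs.
\<close>

definition T01 :: "'g set set \<Rightarrow> 'g set \<Rightarrow> (('g set \<Rightarrow> complex) \<Rightarrow> complex) set" where
  "T01 M x = {D \<in> complex_tangent_space M x. \<forall>\<phi>. holomorphic_near x \<phi> \<longrightarrow> D \<phi> = 0}"

definition CR_submanifold :: "'g set set \<Rightarrow> bool" where
  "CR_submanifold M \<longleftrightarrow> (\<exists>d. embedded_submanifold d M) \<and>
     (\<exists>k. \<forall>x\<in>M. vector_space.dim (\<lambda>(c::complex) D \<phi>. c * D \<phi>) (T01 M x) = k)"

text \<open>
  The group acts on the flag manifold by biholomorphisms, so a transitive action on \<open>M\<close> is
  automatically by CR automorphisms.
\<close>

definition homogeneous_CR_submanifold :: "(complex^'n^'n) set \<Rightarrow> 'g set set \<Rightarrow> bool" where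
  "homogeneous_CR_submanifold K M \<longleftrightarrow> CR_submanifold M \<and> M \<noteq> {} \<and> (\<forall>x\<in>M. Ad_orbit \<iota> K x = M)"

definition orbit_differential :: "'g set \<Rightarrow> 'g \<Rightarrow> ('g set \<Rightarrow> complex) \<Rightarrow> complex" where
  "orbit_differential x X = velocity (\<lambda>t. Ad \<iota> (mexp (t *\<^sub>R \<iota> X)) ` x)"

end

context complex_lie_algebra
begin

text \<open>
  The CR algebra of a \<open>K\<close>-homogeneous \<open>M\<close> at \<open>x\<close> is the pair formed by the Lie algebra of \<open>K\<close> and
  the following complex subalgebra of its complexification: the inverse image of \<open>T01 M x\<close> under
  the complexified differential of the orbit map.
\<close>

definition CR_algebra_at ::
  "('g \<Rightarrow> complex^'n^'n) \<Rightarrow> (complex^'n^'n) set \<Rightarrow> 'g set \<Rightarrow> (complex^'n^'n) set \<Rightarrow> 'g set set \<Rightarrow> 'g set \<Rightarrow> 'g set"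
where
  "CR_algebra_at \<iota> G f K M x =
     {X + scale \<i> Y | X Y. \<iota> X \<in> group_lie_algebra K \<and> \<iota> Y \<in> group_lie_algebra K \<and>
        (\<lambda>\<phi>. flag_manifold.orbit_differential \<iota> G f x X \<phi> +
               \<i> * flag_manifold.orbit_differential \<iota> G f x Y \<phi>)
          \<in> flag_manifold.T01 \<iota> G f M x}"

definition n_reductive_CR_manifold ::
  "('g \<Rightarrow> complex^'n^'n) \<Rightarrow> (complex^'n^'n) set \<Rightarrow> 'g set \<Rightarrow> (complex^'n^'n) set \<Rightarrow> 'g set set \<Rightarrow> 'g set \<Rightarrow> bool"
where
  "n_reductive_CR_manifold \<iota> G f K M x \<longleftrightarrow>
     flag_manifold.homogeneous_CR_submanifold \<iota> G f K M \<and> x \<in> M \<and>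
     (let k0 = {X. \<iota> X \<in> group_lie_algebra K};
          v = CR_algebra_at \<iota> G f K M x
      in reductive_complement (v \<inter> conjugation k0 ` v) (nil_ideal (complexify k0) v) v)"

end

end

(*
  On the complexification g let tau be the conjugation with respect to the compact real form.  The
  Killing form B gives the Hermitian inner product H(x, y) = - B(x, tau y), for which the adjoint
  of ad x is - ad (tau x).  Since the complexified Cartan subalgebra h is tau-stable, it acts
  diagonalisably, the root spaces are one-dimensional, tau interchanges opposite roots, and norm
  identities replace sl2-theory.  Every subalgebra q that contains h is therefore the direct sum
  of the tau-stable algebra of all x in q with tau x in q and of the ideal n, orthogonal to tau q,
  whose roots admit no vanishing sum; hence n acts nilpotently.  For q = f \<inter> theta f both
  summands are theta-stable, and intersecting with kappa, where tau is the conjugation, gives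
  v = (n \<inter> kappa) + (v \<inter> bar v).  A nilpotent element of the radical of v is
  N + Z with N in n and Z central in v \<inter> bar v; modulo a filtration it acts like the normal
  operator ad Z, which forces Z = 0.

  For the orbit, the projections onto b f b^(-1) along a fixed complement of f are holomorphic
  functions on the flag manifold near f.  Because f is its own normaliser, they detect exactly the
  directions outside f, so that the CR algebra is f \<inter> kappa, and they make the products of
  exponentials of an orthonormal basis transversal to the stabiliser an immersed chart of the
  orbit.  By von Neumann's theorem on closed matrix groups these products reach all elements of K
  near the identity modulo the stabiliser, and compactness of K makes the chart open onto its
  image.
*)
theory Submission
  imports Defs "HOL-Computational_Algebra.Fundamental_Theorem_Algebra"
begin

section \<open>Smooth functions\<close>

text \<open>Elements of \<open>v\<close> are not split inside \<open>f\<close> directly: the two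
  summands of \<open>f\<close> need not be invariant under the Cartan involution, so a fixed element
  could have components that are not fixed. A fixed element of \<open>f\<close> also lies in the
  image of \<open>f\<close>, so the smaller, invariant algebra has the same intersection with
  \<kappa>, and uniqueness of the splitting makes both components fixed. A nilpotent element must
  moreover belong to [\<kappa>, \<kappa>]; this comes from the trace form, since a nilpotent
  \<open>ad x\<close> is trace-orthogonal to everything that commutes with \<open>x\<close>. On the
  geometric side, smoothness on the flag manifold is defined by pulling back to \<open>G\<close>,
  for which no charts are constructed. Tangent vectors are therefore tested against explicit
  functions, the entries of the projections, and the full tangent spaces of the orbit are never
  computed: the CR algebra involves only velocities of one-parameter groups, and the constant
  dimension of \<open>T01\<close> follows from equivariance.\<close>

text \<open>Closure properties are proved by induction on the order, which the coinductive
  \<open>smooth_on\<close> does not permit. Order 0 imposes nothing, not even continuity; only the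
  conjunction over all orders is compared with smoothness.\<close>

primrec Ck :: "'a::real_normed_vector set \<Rightarrow> nat \<Rightarrow> ('a \<Rightarrow> 'b::real_normed_vector) \<Rightarrow> bool" where
  "Ck S 0 f \<longleftrightarrow> True"
| "Ck S (Suc k) f \<longleftrightarrow> (\<exists>D. (\<forall>x\<in>S. (f has_derivative D x) (at x)) \<and> (\<forall>u. Ck S k (\<lambda>x. D x u)))"

lemma Ck_SucE:
  assumes "Ck S (Suc k) f"
  obtains D where "\<And>x. x \<in> S \<Longrightarrow> (f has_derivative D x) (at x)" "\<And>u. Ck S k (\<lambda>x. D x u)"
proof -
  obtain D where "\<forall>x\<in>S. (f has_derivative D x) (at x)" "\<forall>u. Ck S k (\<lambda>x. D x u)"
    using assms by (auto simp only: Ck.simps)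
  then show thesis using that[of D] by blast
qed

lemma Ck_SucI:
  assumes "\<And>x. x \<in> S \<Longrightarrow> (f has_derivative D x) (at x)" "\<And>u. Ck S k (\<lambda>x. D x u)"
  shows "Ck S (Suc k) f"
  using assms by auto

lemma Ck_cong:
  assumes "open S" and "\<And>x. x \<in> S \<Longrightarrow> f x = g x" and "Ck S k f"
  shows "Ck S k g"
  using assms(2,3)
proof (cases k)
  case (Suc j)
  then obtain D where D: "\<And>x. x \<in> S \<Longrightarrow> (f has_derivative D x) (at x)" "\<And>u. Ck S j (\<lambda>x. D x u)"
    using assms(3) by auto
  have "(g has_derivative D x) (at x)" if "x \<in> S" for x
    by (rule has_derivative_transform_within_open[OF D(1)[OF that] assms(1) that]) (rule assms(2))
  then show ?thesis using D(2) Suc by auto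
qed simp

lemma Ck_mono: "Ck S (Suc k) f \<Longrightarrow> Ck S k f"
proof (induction k arbitrary: f)
  case (Suc k)
  obtain D where D: "\<And>x. x \<in> S \<Longrightarrow> (f has_derivative D x) (at x)" "\<And>u. Ck S (Suc k) (\<lambda>x. D x u)"
    by (rule Ck_SucE[OF Suc.prems]) blast
  show ?case by (rule Ck_SucI[OF D(1) Suc.IH[OF D(2)]])
qed simp

text \<open>Each order comes with its own family of derivatives. Uniqueness of derivatives
  identifies these families on \<open>S\<close>, so that the one chosen at order 1 can serve as the
  coinductive witness.\<close>

lemma smooth_on_iff_Ck:
  assumes "open S"
  shows "smooth_on S f \<longleftrightarrow> (\<forall>k. Ck S k f)"
proof
  have "Ck S k f" if "smooth_on S f" for k
    using that
  proof (induction k arbitrary: f)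
    case (Suc k)
    from Suc.prems obtain D where "\<And>x. x \<in> S \<Longrightarrow> (f has_derivative D x) (at x)" "\<And>u. smooth_on S (\<lambda>x. D x u)"
      by (cases rule: smooth_on.cases) blast
    then show ?case using Suc.IH by auto
  qed simp
  then show "smooth_on S f \<Longrightarrow> \<forall>k. Ck S k f" by blast
next
  assume "\<forall>k. Ck S k f"
  then show "smooth_on S f"
  proof (coinduction arbitrary: f)
    case smooth_on
    then have "Ck S 1 f" by blast
    then obtain D where D: "\<And>x. x \<in> S \<Longrightarrow> (f has_derivative D x) (at x)" by auto
    have "Ck S k (\<lambda>x. D x u)" for k u
    proof -
      obtain D' where D': "\<And>x. x \<in> S \<Longrightarrow> (f has_derivative D' x) (at x)" "\<And>u. Ck S k (\<lambda>x. D' x u)"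
        using smooth_on[rule_format, of "Suc k"] by auto
      have "D' x = D x" if "x \<in> S" for x using has_derivative_unique D D'(1) that by blast
      then show ?thesis using Ck_cong[OF assms _ D'(2)[of u], of "\<lambda>x. D x u"] by simp
    qed
    then show ?case using D by blast
  qed
qed

lemma smooth_on_derivative:
  assumes "smooth_on S f"
  obtains D where "\<And>x. x \<in> S \<Longrightarrow> (f has_derivative D x) (at x)" "\<And>u. smooth_on S (\<lambda>x. D x u)"
  using assms by (cases rule: smooth_on.cases) blast

lemma smooth_on_continuous: "smooth_on S f \<Longrightarrow> continuous_on S f"
  by (erule smooth_on_derivative)
    (auto intro!: continuous_at_imp_continuous_on has_derivative_continuous)

lemma Ck_subset: "T \<subseteq> S \<Longrightarrow> Ck S k f \<Longrightarrow> Ck T k f"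
proof (induction k arbitrary: f)
  case (Suc k)
  then show ?case by (auto 0 4 simp: subset_iff)
qed simp

lemma Ck_const: "Ck S k (\<lambda>x. c)"
proof (induction k arbitrary: c)
  case (Suc k)
  then show ?case by (auto intro!: exI[of _ "\<lambda>x u. 0"])
qed simp

lemma Ck_linear: "bounded_linear L \<Longrightarrow> Ck S k L"
  by (cases k) (auto intro!: exI[of _ "\<lambda>x. L"] Ck_const bounded_linear_imp_has_derivative)

lemma Ck_linear_compose: "bounded_linear L \<Longrightarrow> Ck S k f \<Longrightarrow> Ck S k (\<lambda>x. L (f x))"
proof (induction k arbitrary: f)
  case (Suc k)
  then obtain D where D: "\<And>x. x \<in> S \<Longrightarrow> (f has_derivative D x) (at x)" "\<And>u. Ck S k (\<lambda>x. D x u)"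
    by auto
  have "((\<lambda>x. L (f x)) has_derivative (\<lambda>u. L (D x u))) (at x)" if "x \<in> S" for x
    by (rule bounded_linear.has_derivative[OF Suc.prems(1) D(1)[OF that]])
  then show ?case using Suc.IH[OF Suc.prems(1) D(2)] by (auto intro!: exI[of _ "\<lambda>x u. L (D x u)"])
qed simp

lemma Ck_add: "Ck S k f \<Longrightarrow> Ck S k g \<Longrightarrow> Ck S k (\<lambda>x. f x + g x)"
proof (induction k arbitrary: f g)
  case (Suc k)
  obtain D where D: "\<And>x. x \<in> S \<Longrightarrow> (f has_derivative D x) (at x)" "\<And>u. Ck S k (\<lambda>x. D x u)"
    by (rule Ck_SucE[OF Suc.prems(1)]) blast
  obtain E where E: "\<And>x. x \<in> S \<Longrightarrow> (g has_derivative E x) (at x)" "\<And>u. Ck S k (\<lambda>x. E x u)"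
    by (rule Ck_SucE[OF Suc.prems(2)]) blast
  show ?case using D E Suc.IH[OF D(2) E(2)]
    by (auto intro!: exI[of _ "\<lambda>x u. D x u + E x u"] has_derivative_add)
qed simp

lemma Ck_bilinear:
  assumes "bounded_bilinear mul"
  shows "Ck S k f \<Longrightarrow> Ck S k g \<Longrightarrow> Ck S k (\<lambda>x. mul (f x) (g x))"
proof (induction k arbitrary: f g)
  case (Suc k)
  obtain D where D: "\<And>x. x \<in> S \<Longrightarrow> (f has_derivative D x) (at x)" "\<And>u. Ck S k (\<lambda>x. D x u)"
    by (rule Ck_SucE[OF Suc.prems(1)]) blast
  obtain E where E: "\<And>x. x \<in> S \<Longrightarrow> (g has_derivative E x) (at x)" "\<And>u. Ck S k (\<lambda>x. E x u)"
    by (rule Ck_SucE[OF Suc.prems(2)]) blast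
  have "((\<lambda>x. mul (f x) (g x)) has_derivative (\<lambda>u. mul (f x) (E x u) + mul (D x u) (g x))) (at x)"
    if "x \<in> S" for x
    by (rule bounded_bilinear.FDERIV[OF assms D(1)[OF that] E(1)[OF that]])
  moreover have "Ck S k (\<lambda>x. mul (f x) (E x u) + mul (D x u) (g x))" for u
    by (intro Ck_add Suc.IH D(2) E(2) Ck_mono[OF Suc.prems(1)] Ck_mono[OF Suc.prems(2)])
  ultimately show ?case by (auto intro!: exI[of _ "\<lambda>x u. mul (f x) (E x u) + mul (D x u) (g x)"])
qed simp

lemma Ck_sum: "(\<And>i. i \<in> I \<Longrightarrow> Ck S k (f i)) \<Longrightarrow> Ck S k (\<lambda>x. \<Sum>i\<in>I. f i x)"
  by (induction I rule: infinite_finite_induct) (auto intro: Ck_add Ck_const)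

text \<open>In \<open>D (g x) (E x u)\<close> the point \<open>x\<close> enters through both
  arguments. Expanding \<open>E x u\<close> in a basis of the Euclidean middle space leaves a finite
  sum of products to which the induction hypothesis applies.\<close>

lemma Ck_compose:
  fixes f :: "'b::euclidean_space \<Rightarrow> 'c::real_normed_vector" and g :: "'a::real_normed_vector \<Rightarrow> 'b"
  shows "Ck T k f \<Longrightarrow> Ck S k g \<Longrightarrow> g ` S \<subseteq> T \<Longrightarrow> open S \<Longrightarrow> Ck S k (\<lambda>x. f (g x))"
proof (induction k arbitrary: f)
  case (Suc k)
  obtain D where D: "\<And>x. x \<in> T \<Longrightarrow> (f has_derivative D x) (at x)" "\<And>u. Ck T k (\<lambda>x. D x u)"
    by (rule Ck_SucE[OF Suc.prems(1)]) blast
  obtain E where E: "\<And>x. x \<in> S \<Longrightarrow> (g has_derivative E x) (at x)" "\<And>u. Ck S k (\<lambda>x. E x u)"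
    by (rule Ck_SucE[OF Suc.prems(2)]) blast
  have g: "Ck S k g" by (rule Ck_mono[OF Suc.prems(2)])
  have "((\<lambda>x. f (g x)) has_derivative (\<lambda>u. D (g x) (E x u))) (at x)" if "x \<in> S" for x
    using has_derivative_compose[OF E(1)[OF that] D(1)[of "g x"]] that Suc.prems(3) by auto
  moreover have "Ck S k (\<lambda>x. D (g x) (E x u))" for u
  proof (rule Ck_cong[OF Suc.prems(4)])
    show "Ck S k (\<lambda>x. \<Sum>b\<in>Basis. (E x u \<bullet> b) *\<^sub>R D (g x) b)"
      by (intro Ck_sum Ck_bilinear[OF bounded_bilinear_scaleR] Suc.IH[OF D(2) g Suc.prems(3,4)]
          Ck_linear_compose[OF bounded_linear_inner_left E(2)])
    show "(\<Sum>b\<in>Basis. (E x u \<bullet> b) *\<^sub>R D (g x) b) = D (g x) (E x u)" if "x \<in> S" for x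
    proof -
      interpret linear "D (g x)"
        using has_derivative_linear[OF D(1)[of "g x"]] that Suc.prems(3) by blast
      have "D (g x) (E x u) = D (g x) (\<Sum>b\<in>Basis. (E x u \<bullet> b) *\<^sub>R b)"
        by (simp only: euclidean_representation)
      then show ?thesis by (simp add: sum scale)
    qed
  qed
  ultimately show ?case by (auto intro!: exI[of _ "\<lambda>x u. D (g x) (E x u)"])
qed simp

lemma Ck_inverse: "Ck (- {0}) k (inverse :: complex \<Rightarrow> complex)"
proof (induction k)
  case (Suc k)
  have "(inverse has_derivative (\<lambda>u. - (inverse x * u * inverse x))) (at x)"
    if "x \<in> - {0}" for x :: complex
    using has_derivative_inverse'[of x UNIV] that by simp
  moreover have "Ck (- {0}) k (\<lambda>x :: complex. - (inverse x * u * inverse x))" for u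
    by (intro Ck_linear_compose[OF bounded_linear_minus[OF bounded_linear_ident]]
        Ck_bilinear[OF bounded_bilinear_mult] Suc.IH Ck_const)
  ultimately show ?case by (auto intro!: exI[of _ "\<lambda>x u. - (inverse x * u * inverse x)"])
qed simp

lemma smooth_on_cong: "open S \<Longrightarrow> (\<And>x. x \<in> S \<Longrightarrow> f x = g x) \<Longrightarrow> smooth_on S f \<Longrightarrow> smooth_on S g"
  using Ck_cong by (metis smooth_on_iff_Ck)

lemma smooth_on_subset: "open S \<Longrightarrow> open T \<Longrightarrow> T \<subseteq> S \<Longrightarrow> smooth_on S f \<Longrightarrow> smooth_on T f"
  by (simp add: smooth_on_iff_Ck) (blast intro: Ck_subset)

lemma smooth_on_const: "open S \<Longrightarrow> smooth_on S (\<lambda>x. c)"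
  by (simp add: smooth_on_iff_Ck Ck_const)

lemma smooth_on_linear: "open S \<Longrightarrow> bounded_linear L \<Longrightarrow> smooth_on S L"
  by (simp add: smooth_on_iff_Ck Ck_linear)

lemma smooth_on_linear_compose:
  "open S \<Longrightarrow> bounded_linear L \<Longrightarrow> smooth_on S f \<Longrightarrow> smooth_on S (\<lambda>x. L (f x))"
  by (simp add: smooth_on_iff_Ck Ck_linear_compose)

lemma smooth_on_add: "open S \<Longrightarrow> smooth_on S f \<Longrightarrow> smooth_on S g \<Longrightarrow> smooth_on S (\<lambda>x. f x + g x)"
  by (simp add: smooth_on_iff_Ck Ck_add)

lemma smooth_on_bilinear:
  "open S \<Longrightarrow> bounded_bilinear mul \<Longrightarrow> smooth_on S f \<Longrightarrow> smooth_on S g \<Longrightarrow>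
   smooth_on S (\<lambda>x. mul (f x) (g x))"
  by (simp add: smooth_on_iff_Ck Ck_bilinear)

lemma smooth_on_compose:
  fixes f :: "'b::euclidean_space \<Rightarrow> 'c::real_normed_vector"
  shows "open T \<Longrightarrow> open S \<Longrightarrow> smooth_on T f \<Longrightarrow> smooth_on S g \<Longrightarrow> g ` S \<subseteq> T \<Longrightarrow>
    smooth_on S (\<lambda>x. f (g x))"
  by (simp add: smooth_on_iff_Ck) (blast intro: Ck_compose)

lemma smooth_on_inverse:
  fixes f :: "'a::real_normed_vector \<Rightarrow> complex"
  assumes "open S" "smooth_on S f" "\<And>x. x \<in> S \<Longrightarrow> f x \<noteq> 0"
  shows "smooth_on S (\<lambda>x. inverse (f x))"
proof (rule smooth_on_compose[of "- {0}" S inverse f])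
  show "smooth_on (- {0}) (inverse :: complex \<Rightarrow> complex)"
    by (subst smooth_on_iff_Ck) (auto simp: Ck_inverse open_Compl)
qed (use assms in auto)

lemma smooth_on_euclidean_componentwise:
  fixes f :: "'a::real_normed_vector \<Rightarrow> 'b::euclidean_space"
  assumes "open S" "\<And>b. b \<in> Basis \<Longrightarrow> smooth_on S (\<lambda>x. f x \<bullet> b)"
  shows "smooth_on S f"
proof -
  have "smooth_on S (\<lambda>x. \<Sum>b\<in>Basis. (f x \<bullet> b) *\<^sub>R b)"
    using assms
    by (auto simp: smooth_on_iff_Ck intro!: Ck_sum Ck_bilinear[OF bounded_bilinear_scaleR] Ck_const)
  then show ?thesis by (simp add: euclidean_representation)
qed

section \<open>Continuity of derivatives and local immersions\<close>

text \<open>Smoothness makes \<open>D x u\<close> continuous for each fixed \<open>u\<close>. In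
  finite dimension, continuity on every basis vector is continuity in operator norm, the form that
  the local injectivity theorem asks for.\<close>

lemma smooth_derivative_continuous:
  fixes f :: "'a::euclidean_space \<Rightarrow> 'b::real_normed_vector"
  assumes S: "open S" "a \<in> S" and smooth: "smooth_on S f"
    and D: "\<And>x. x \<in> S \<Longrightarrow> (f has_derivative D x) (at x)" and e: "e > 0"
  shows "\<exists>d>0. ball a d \<subseteq> S \<and> (\<forall>x. dist a x < d \<longrightarrow> onorm (\<lambda>v. D x v - D a v) < e)"
proof -
  obtain D' where D': "\<And>x. x \<in> S \<Longrightarrow> (f has_derivative D' x) (at x)" "\<And>u. smooth_on S (\<lambda>x. D' x u)"
    by (rule smooth_on_derivative[OF smooth]) blast
  have DD: "D' x = D x" if "x \<in> S" for x using has_derivative_unique D D'(1) that by blast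
  have bl: "bounded_linear (D x)" if "x \<in> S" for x using D[OF that] by (rule has_derivative_bounded_linear)
  define F where "F x = Blinfun (D x)" for x
  have F: "blinfun_apply (F x) = D x" if "x \<in> S" for x
    using bl[OF that] by (simp add: F_def bounded_linear_Blinfun_apply)
  have "continuous_on S F"
  proof (rule continuous_on_blinfun_componentwise)
    fix i :: 'a
    have "continuous_on S (\<lambda>x. D' x i)" by (rule smooth_on_continuous[OF D'(2)])
    then show "continuous_on S (\<lambda>x. blinfun_apply (F x) i)"
      by (rule continuous_on_cong[THEN iffD1, rotated -1]) (auto simp: F DD)
  qed
  then obtain d where d: "d > 0" "\<And>x. x \<in> S \<Longrightarrow> dist x a < d \<Longrightarrow> dist (F x) (F a) < e"
    using S(2) e unfolding continuous_on_iff by metis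
  obtain d' where d': "d' > 0" "ball a d' \<subseteq> S" using S open_contains_ball by blast
  have "onorm (\<lambda>v. D x v - D a v) < e" if "dist a x < min d d'" for x
  proof -
    have x: "x \<in> S" using that d'(2) by (auto simp: mem_ball subset_iff)
    have "dist (F x) (F a) < e" using d(2)[OF x] that by (simp add: dist_commute)
    then show ?thesis
      by (simp add: dist_norm norm_blinfun.rep_eq minus_blinfun.rep_eq F[OF x] F[OF S(2)])
  qed
  then show ?thesis using d(1) d' by (intro exI[of _ "min d d'"]) auto
qed

text \<open>An injective linear \<open>D0\<close> has a left inverse \<open>g\<close>, and the
  derivative at a nearby point differs from \<open>D0\<close> by too little to acquire a kernel.
  Injectivity of the map and of its derivatives is obtained on one common ball.\<close>

lemma locally_immersive:
  fixes \<psi> :: "'a::euclidean_space \<Rightarrow> 'b::euclidean_space"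
  assumes S: "open S" "a \<in> S" and smooth: "smooth_on S \<psi>"
    and D0: "(\<psi> has_derivative D0) (at a)" and inj: "\<And>v. D0 v = 0 \<Longrightarrow> v = 0"
  obtains r where "r > 0" "ball a r \<subseteq> S" "inj_on \<psi> (ball a r)"
    "\<forall>x D v. x \<in> ball a r \<longrightarrow> (\<psi> has_derivative D) (at x) \<longrightarrow> D v = 0 \<longrightarrow> v = 0"
proof -
  obtain D where D: "\<And>x. x \<in> S \<Longrightarrow> (\<psi> has_derivative D x) (at x)"
    by (rule smooth_on_derivative[OF smooth]) blast
  have Da: "D a = D0" by (rule has_derivative_unique[OF D[OF S(2)] D0])
  have lin: "linear D0" by (rule has_derivative_linear[OF D0])
  have "inj D0"
  proof (rule injI)
    fix x y assume "D0 x = D0 y"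
    then have "D0 (x - y) = 0" by (simp add: linear_diff[OF lin])
    then show "x = y" using inj by fastforce
  qed
  from linear_injective_left_inverse[OF lin this] obtain g where g: "linear g" "g \<circ> D0 = id" by blast
  have bg: "bounded_linear g" using g(1) by (rule linear_conv_bounded_linear[THEN iffD1])
  have close: "\<exists>d>0. ball a d \<subseteq> S \<and> (\<forall>x. dist a x < d \<longrightarrow> onorm (\<lambda>v. D x v - D a v) < e)" if "e > 0" for e
    by (rule smooth_derivative_continuous[OF S smooth D that])
  obtain r1 where r1: "r1 > 0" "ball a r1 \<subseteq> S" "inj_on \<psi> (ball a r1)"
  proof (rule has_derivative_locally_injective[OF S(2,1) bg _ D])
    show "g \<circ> D a = id" unfolding Da by (rule g(2))
    show "\<exists>d>0. \<forall>x. dist a x < d \<longrightarrow> onorm (\<lambda>v. D x v - D a v) < e" if "e > 0" for e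
      using close[OF that] by blast
  qed auto
  \<comment> \<open>Any positive bound with \<open>onorm g * e < 1\<close> works; the added 1 keeps
    the quotient defined without first showing that \<open>g\<close> is nonzero.\<close>
  define e where "e = 1 / (onorm g + 1)"
  have og: "onorm g \<ge> 0" by (rule onorm_pos_le[OF bg])
  then have "e > 0" by (simp add: e_def)
  from close[OF this] obtain r2 where
    r2: "r2 > 0" "ball a r2 \<subseteq> S" "\<And>x. dist a x < r2 \<Longrightarrow> onorm (\<lambda>v. D x v - D a v) < e" by blast
  have imm: "v = 0" if x: "x \<in> ball a r2" and Dx: "(\<psi> has_derivative D') (at x)" and v: "D' v = 0" for x D' v
  proof (rule ccontr)
    assume "v \<noteq> 0"
    have xS: "x \<in> S" using x r2(2) by blast
    have D'x: "D' = D x" by (rule has_derivative_unique[OF Dx D[OF xS]])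
    have bl: "bounded_linear (\<lambda>v. D x v - D a v)"
      by (intro bounded_linear_sub has_derivative_bounded_linear[OF D] xS S(2))
    have "v = g (D0 v)" using g(2) by (metis comp_apply id_apply)
    also have "\<dots> = - g (D x v - D a v)"
      using v by (simp add: D'x Da linear_neg[OF g(1)])
    finally have "norm v = norm (g (D x v - D a v))" by (metis norm_minus_cancel)
    also have "\<dots> \<le> onorm g * norm (D x v - D a v)" by (rule onorm[OF bg])
    also have "\<dots> \<le> onorm g * (onorm (\<lambda>v. D x v - D a v) * norm v)"
      by (rule mult_left_mono[OF onorm[OF bl] og])
    also have "\<dots> \<le> onorm g * (e * norm v)"
      using r2(3)[of x] x og by (intro mult_left_mono mult_right_mono) auto
    also have "\<dots> < 1 * norm v"
    proof -
      have "onorm g * e < 1" using og by (simp add: e_def)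
      then show ?thesis using \<open>v \<noteq> 0\<close> by (simp flip: mult.assoc)
    qed
    finally show False by simp
  qed
  show thesis
  proof (rule that[of "min r1 r2"])
    show "inj_on \<psi> (ball a (min r1 r2))" by (rule inj_on_subset[OF r1(3)]) auto
    show "ball a (min r1 r2) \<subseteq> S" using r1(2) by auto
    show "\<forall>x D v. x \<in> ball a (min r1 r2) \<longrightarrow> (\<psi> has_derivative D) (at x) \<longrightarrow> D v = 0 \<longrightarrow> v = 0"
    proof (intro allI impI)
      fix x D' v assume "x \<in> ball a (min r1 r2)" "(\<psi> has_derivative D') (at x)" "D' v = 0"
      then show "v = 0" using imm[of x D' v] by simp
    qed
  qed (use r1(1) r2(1) in auto)
qed

section \<open>Smoothness of matrix-valued functions\<close>

lemma bounded_bilinear_matrix_mult: "bounded_bilinear ((**) :: complex^'n^'n \<Rightarrow> complex^'n^'n \<Rightarrow> complex^'n^'n)"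
  unfolding bilinear_conv_bounded_bilinear[symmetric] bilinear_def
  by (auto intro!: linearI simp: vec_eq_iff matrix_matrix_mult_def algebra_simps sum.distrib
      scaleR_sum_right)

interpretation matrix_mult: bounded_bilinear "(**) :: complex^'n^'n \<Rightarrow> complex^'n^'n \<Rightarrow> complex^'n^'n"
  by (rule bounded_bilinear_matrix_mult)

lemma smooth_on_matrix_mult:
  fixes f g :: "'a::real_normed_vector \<Rightarrow> complex^'n^'n"
  shows "open S \<Longrightarrow> smooth_on S f \<Longrightarrow> smooth_on S g \<Longrightarrow> smooth_on S (\<lambda>x. f x ** g x)"
  by (rule smooth_on_bilinear[OF _ bounded_bilinear_matrix_mult])

lemma bounded_linear_matrix_entry: "bounded_linear (\<lambda>A :: complex^'n^'m. A $ i $ j)"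
  by (rule bounded_linear_compose[OF bounded_linear_vec_nth bounded_linear_vec_nth])

lemma smooth_on_matrix_entrywise:
  fixes f :: "'a::real_normed_vector \<Rightarrow> complex^'n^'m"
  assumes "open S" "\<And>i j. smooth_on S (\<lambda>x. f x $ i $ j)"
  shows "smooth_on S f"
proof (rule smooth_on_euclidean_componentwise[OF assms(1)])
  fix b :: "complex^'n^'m" assume "b \<in> Basis"
  then obtain i j c where "b = axis i (axis j c)" by (auto simp: Basis_vec_def)
  then have "(\<lambda>x. f x \<bullet> b) = (\<lambda>x. f x $ i $ j \<bullet> c)" by (simp add: inner_axis)
  then show "smooth_on S (\<lambda>x. f x \<bullet> b)"
    using smooth_on_linear_compose[OF assms(1) bounded_linear_inner_left assms(2)] by simp
qed

section \<open>The matrix exponential\<close>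

definition mpow :: "complex^'n^'n \<Rightarrow> nat \<Rightarrow> complex^'n^'n" where
  "mpow A k = ((\<lambda>B. A ** B) ^^ k) (mat 1)"

lemma mpow_0 [simp]: "mpow A 0 = mat 1" and mpow_Suc: "mpow A (Suc k) = A ** mpow A k"
  by (simp_all add: mpow_def)

lemma mpow_commute: "A ** mpow A k = mpow A k ** A"
proof (induction k)
  case (Suc k)
  have "A ** mpow A (Suc k) = A ** (mpow A k ** A)" by (simp only: mpow_Suc Suc)
  then show ?case by (simp only: mpow_Suc matrix_mul_assoc)
qed simp

lemma mpow_scaleR: "mpow (t *\<^sub>R A) k = t ^ k *\<^sub>R mpow A k"
  by (induction k) (simp_all add: mpow_Suc matrix_mult.scaleR_left matrix_mult.scaleR_right)

text \<open>The norm of matrices is submultiplicative up to a constant \<open>K\<close>, so the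
  series is compared with the exponential series at
  \<open>\<bar>t\<bar> * (K * norm A)\<close>.\<close>

lemma summable_mexp: "summable (\<lambda>k. (t ^ k / fact k) *\<^sub>R mpow (A :: complex^'n^'n) k)"
proof -
  from matrix_mult.pos_bounded[where 'n = 'n]
  obtain K where "K > 0 \<and> (\<forall>(A :: complex^'n^'n) (B :: complex^'n^'n). norm (A ** B) \<le> norm A * norm B * K)"
    by (rule exE)
  then have K: "K > 0" "\<And>(A :: complex^'n^'n) (B :: complex^'n^'n). norm (A ** B) \<le> norm A * norm B * K" by auto
  have pow: "norm (mpow A k) \<le> (K * norm A) ^ k * norm (mat 1 :: complex^'n^'n)" for k
  proof (induction k)
    case (Suc k)
    have "norm (mpow A (Suc k)) \<le> norm A * norm (mpow A k) * K" unfolding mpow_Suc by (rule K(2))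
    also have "\<dots> \<le> norm A * ((K * norm A) ^ k * norm (mat 1 :: complex^'n^'n)) * K"
      using K(1) Suc by (intro mult_right_mono mult_left_mono) auto
    finally show ?case by (simp add: algebra_simps)
  qed simp
  have "summable (\<lambda>k. (inverse (fact k) * (\<bar>t\<bar> * (K * norm A)) ^ k) * norm (mat 1 :: complex^'n^'n))"
    by (intro summable_mult2 summable_exp)
  then show ?thesis
  proof (rule summable_comparison_test'[where N = 0])
    fix k :: nat
    have "norm ((t ^ k / fact k) *\<^sub>R mpow A k) = (\<bar>t\<bar> ^ k / fact k) * norm (mpow A k)"
      by (simp add: power_abs)
    also have "\<dots> \<le> (\<bar>t\<bar> ^ k / fact k) * ((K * norm A) ^ k * norm (mat 1 :: complex^'n^'n))"
      by (intro mult_left_mono pow) simp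
    finally show "norm ((t ^ k / fact k) *\<^sub>R mpow A k)
        \<le> (inverse (fact k) * (\<bar>t\<bar> * (K * norm A)) ^ k) * norm (mat 1 :: complex^'n^'n)"
      by (simp only: power_mult_distrib divide_inverse mult_ac)
  qed
qed

lemma mexp_series: "mexp (t *\<^sub>R A) = (\<Sum>k. (t ^ k / fact k) *\<^sub>R mpow A k)"
  unfolding mexp_def mpow_def[symmetric] mpow_scaleR by simp

lemma mexp_commute: "A ** mexp (t *\<^sub>R A) = mexp (t *\<^sub>R A) ** A"
  unfolding mexp_series
  by (subst bounded_linear.suminf[OF matrix_mult.bounded_linear_right summable_mexp],
      subst bounded_linear.suminf[OF matrix_mult.bounded_linear_left summable_mexp])
    (simp add: matrix_mult.scaleR_left matrix_mult.scaleR_right mpow_commute)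

lemma mexp_0 [simp]: "mexp 0 = mat 1"
proof -
  have "mexp (0 *\<^sub>R (0 :: complex^'n^'n)) = (\<Sum>k\<in>{0}. (0 ^ k / fact k) *\<^sub>R mpow 0 k)"
    unfolding mexp_series by (rule suminf_finite) auto
  then show ?thesis by simp
qed

text \<open>Tested against a basis vector, the exponential is a scalar power series in
  \<open>t\<close> that converges everywhere and may be differentiated termwise. The shift of
  coefficients by \<open>diffs\<close> amounts to multiplication by \<open>A\<close>.\<close>

lemma mexp_derivative:
  fixes A :: "complex^'n^'n"
  shows "((\<lambda>t. mexp (t *\<^sub>R A)) has_vector_derivative (A ** mexp (t *\<^sub>R A))) (at t)"
  unfolding has_vector_derivative_def
proof (subst has_derivative_componentwise_within, rule ballI)
  fix b :: "complex^'n^'n"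
  define c where "c k = (mpow A k \<bullet> b) / fact k" for k
  have term_eq: "(s ^ k / fact k) *\<^sub>R mpow A k \<bullet> b = c k * s ^ k" for s k by (simp add: c_def)
  have inner: "mexp (s *\<^sub>R A) \<bullet> b = (\<Sum>k. c k * s ^ k)" for s
    unfolding mexp_series
    by (subst bounded_linear.suminf[OF bounded_linear_inner_left summable_mexp]) (simp add: term_eq del: inner_scaleR_left)
  have "summable (\<lambda>k. c k * s ^ k)" for s
    using bounded_linear.summable[OF bounded_linear_inner_left[of b] summable_mexp[of s A]]
    by (simp add: term_eq del: inner_scaleR_left)
  then have "((\<lambda>s. \<Sum>k. c k * s ^ k) has_field_derivative (\<Sum>k. diffs c k * t ^ k)) (at t)"
    by (rule termdiffs_strong_converges_everywhere)
  moreover have "(\<Sum>k. diffs c k * t ^ k) = (A ** mexp (t *\<^sub>R A)) \<bullet> b"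
  proof -
    have "diffs c k * t ^ k = (A ** ((t ^ k / fact k) *\<^sub>R mpow A k)) \<bullet> b" for k
      by (simp add: diffs_def c_def mpow_Suc matrix_mult.scaleR_right field_simps del: of_nat_Suc)
    then show ?thesis unfolding mexp_series
      by (simp add: bounded_linear.suminf[OF bounded_linear_compose[OF bounded_linear_inner_left
              matrix_mult.bounded_linear_right] summable_mexp])
  qed
  ultimately have "((\<lambda>s. mexp (s *\<^sub>R A) \<bullet> b) has_field_derivative (A ** mexp (t *\<^sub>R A)) \<bullet> b) (at t)"
    by (simp add: inner)
  moreover have "(\<lambda>x. (x *\<^sub>R (A ** mexp (t *\<^sub>R A))) \<bullet> b) = (*) ((A ** mexp (t *\<^sub>R A)) \<bullet> b)"
    by (simp add: fun_eq_iff)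
  ultimately show "((\<lambda>x. mexp (x *\<^sub>R A) \<bullet> b) has_derivative (\<lambda>x. (x *\<^sub>R (A ** mexp (t *\<^sub>R A))) \<bullet> b)) (at t)"
    by (simp only: has_field_derivative_def)
qed

lemma mexp_derivative_minus:
  "((\<lambda>t. mexp ((- t) *\<^sub>R A)) has_vector_derivative - (mexp ((- t) *\<^sub>R A) ** A)) (at t)"
  using mexp_derivative[of "- A" t]
  by (simp add: matrix_mult.minus_left mexp_commute[of A "- t", simplified])

text \<open>\<open>mexp ((- t) *\<^sub>R A)\<close> is an integrating factor: its product with a
  solution has derivative 0. The inverse, the addition law and conjugation of the exponential are
  read off from this uniqueness instead of from products of series.\<close>

lemma mexp_ode_unique:
  fixes A :: "complex^'n^'n" and Y :: "real \<Rightarrow> complex^'n^'n"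
  assumes Y: "\<And>t. (Y has_vector_derivative (A ** Y t)) (at t)"
  shows "mexp ((- t) *\<^sub>R A) ** Y t = Y 0"
proof -
  have "((\<lambda>t. mexp ((- t) *\<^sub>R A) ** Y t) has_vector_derivative
      (mexp ((- t) *\<^sub>R A) ** (A ** Y t) + - (mexp ((- t) *\<^sub>R A) ** A) ** Y t)) (at t)" for t
    by (rule matrix_mult.has_vector_derivative[OF mexp_derivative_minus Y])
  then have "((\<lambda>t. mexp ((- t) *\<^sub>R A) ** Y t) has_vector_derivative 0) (at t)" for t
    by (simp add: matrix_mult.minus_left matrix_mul_assoc)
  then obtain c where "\<And>t. mexp ((- t) *\<^sub>R A) ** Y t = c"
    using has_vector_derivative_zero_constant[of UNIV "\<lambda>t. mexp ((- t) *\<^sub>R A) ** Y t"] by auto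
  from this[of t] this[of 0] show ?thesis by simp
qed

lemma mexp_minus_left: "mexp ((- t) *\<^sub>R A) ** mexp (t *\<^sub>R A) = mat 1"
  using mexp_ode_unique[OF mexp_derivative, of t A] by simp

lemma mexp_minus_right: "mexp (t *\<^sub>R A) ** mexp ((- t) *\<^sub>R A) = mat 1"
  using mexp_minus_left[of "- t" A] by simp

lemma mexp_ode:
  fixes A :: "complex^'n^'n" and Y :: "real \<Rightarrow> complex^'n^'n"
  assumes Y: "\<And>t. (Y has_vector_derivative (A ** Y t)) (at t)"
  shows "Y t = mexp (t *\<^sub>R A) ** Y 0"
  using mexp_ode_unique[OF Y, of t] mexp_minus_right[of t A] by (metis matrix_mul_assoc matrix_mul_lid)

lemma mexp_add: "mexp ((s + t) *\<^sub>R A) = mexp (s *\<^sub>R A) ** mexp (t *\<^sub>R A)"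
proof -
  have "((\<lambda>s. mexp ((s + t) *\<^sub>R A)) has_vector_derivative A ** mexp ((s + t) *\<^sub>R A)) (at s)" for s
  proof -
    have "((\<lambda>s. s + t) has_vector_derivative 1) (at s)"
      by (auto simp flip: has_real_derivative_iff_has_vector_derivative intro!: derivative_eq_intros)
    from vector_diff_chain_at[OF this mexp_derivative[of A "s + t"]] show ?thesis by (simp add: o_def)
  qed
  from mexp_ode[OF this, of s] show ?thesis by simp
qed

lemma mexp_conjugate:
  fixes A a a' :: "complex^'n^'n"
  assumes "a' ** a = mat 1" "a ** a' = mat 1"
  shows "mexp (t *\<^sub>R (a ** A ** a')) = a ** mexp (t *\<^sub>R A) ** a'"
proof -
  have "((\<lambda>t. a ** mexp (t *\<^sub>R A) ** a') has_vector_derivative a ** (A ** mexp (t *\<^sub>R A)) ** a') (at t)" for t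
    by (rule bounded_linear.has_vector_derivative[OF matrix_mult.bounded_linear_left[of a']
          bounded_linear.has_vector_derivative[OF matrix_mult.bounded_linear_right[of a] mexp_derivative]])
  moreover have "a ** (A ** mexp (t *\<^sub>R A)) ** a' = (a ** A ** a') ** (a ** mexp (t *\<^sub>R A) ** a')" for t
  proof -
    have "(a ** A ** a') ** (a ** mexp (t *\<^sub>R A) ** a') = a ** A ** (a' ** a) ** mexp (t *\<^sub>R A) ** a'"
      by (simp only: matrix_mul_assoc)
    then show ?thesis by (simp add: assms matrix_mul_assoc)
  qed
  ultimately have "((\<lambda>t. a ** mexp (t *\<^sub>R A) ** a') has_vector_derivative
      (a ** A ** a') ** (a ** mexp (t *\<^sub>R A) ** a')) (at t)" for t by simp
  from mexp_ode[OF this, of t] show ?thesis using assms by simp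
qed

lemma smooth_on_mexp: "smooth_on UNIV (\<lambda>t. mexp (t *\<^sub>R A))"
proof -
  have "Ck UNIV k (\<lambda>t. mexp (t *\<^sub>R A))" for k
  proof (induction k)
    case (Suc k)
    show ?case
    proof (rule Ck_SucI)
      show "((\<lambda>t. mexp (t *\<^sub>R A)) has_derivative (\<lambda>u. u *\<^sub>R (A ** mexp (t *\<^sub>R A)))) (at t)" for t
        using mexp_derivative[of A t] by (simp add: has_vector_derivative_def)
      show "Ck UNIV k (\<lambda>t. u *\<^sub>R (A ** mexp (t *\<^sub>R A)))" for u
        by (rule Ck_linear_compose[OF bounded_linear_scaleR_right
              Ck_linear_compose[OF matrix_mult.bounded_linear_right Suc]])
    qed
  qed simp
  then show ?thesis by (simp add: smooth_on_iff_Ck)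
qed

section \<open>Holomorphic functions of matrices\<close>

lemma holomorphic_on_matricesI:
  assumes "smooth_on S f"
    and "\<And>a. a \<in> S \<Longrightarrow> \<exists>D. (f has_derivative D) (at a) \<and> (\<forall>X. D (mat \<i> ** X) = \<i> * D X)"
  shows "holomorphic_on_matrices S f"
  unfolding holomorphic_on_matrices_def using assms frechet_derivative_at by metis

lemma holomorphic_on_matrices_derivative:
  assumes "holomorphic_on_matrices S f" "a \<in> S"
  obtains D where "(f has_derivative D) (at a)" "\<And>X. D (mat \<i> ** X) = \<i> * D X"
proof -
  have "smooth_on S f" using assms(1) by (simp add: holomorphic_on_matrices_def)
  then obtain D where D: "\<And>x. x \<in> S \<Longrightarrow> (f has_derivative D x) (at x)"
    by (rule smooth_on_derivative) blast
  have "frechet_derivative f (at a) = D a" using frechet_derivative_at[OF D[OF assms(2)]] by simp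
  then have "D a (mat \<i> ** X) = \<i> * D a X" for X
    using assms unfolding holomorphic_on_matrices_def by metis
  then show thesis by (rule that[OF D[OF assms(2)]])
qed

lemma holomorphic_on_matrices_smooth: "holomorphic_on_matrices S f \<Longrightarrow> smooth_on S f"
  by (simp add: holomorphic_on_matrices_def)

lemma holomorphic_const: "open S \<Longrightarrow> holomorphic_on_matrices S (\<lambda>A. c)"
  by (rule holomorphic_on_matricesI) (auto intro!: smooth_on_const exI[of _ "\<lambda>X. 0"])

lemma mat_mult_entry: "(mat c ** X) $ i $ j = c * (X $ i $ j)"
  by (simp add: matrix_matrix_mult_def mat_def if_distrib[of "\<lambda>x. x * _"] cong: if_cong)

lemma holomorphic_entry: "open S \<Longrightarrow> holomorphic_on_matrices S (\<lambda>A. A $ i $ j)"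
proof (rule holomorphic_on_matricesI)
  show "open S \<Longrightarrow> smooth_on S (\<lambda>A. A $ i $ j)"
    by (rule smooth_on_linear[OF _ bounded_linear_matrix_entry])
  show "\<exists>D. ((\<lambda>A. A $ i $ j) has_derivative D) (at a) \<and> (\<forall>X. D (mat \<i> ** X) = \<i> * D X)" for a
    using bounded_linear_imp_has_derivative[OF bounded_linear_matrix_entry, of i j "at a"]
    by (intro exI[of _ "\<lambda>X. X $ i $ j"]) (simp add: mat_mult_entry)
qed

lemma holomorphic_add:
  assumes S: "open S" and f: "holomorphic_on_matrices S f" and g: "holomorphic_on_matrices S g"
  shows "holomorphic_on_matrices S (\<lambda>A. f A + g A)"
proof (rule holomorphic_on_matricesI)
  show "smooth_on S (\<lambda>A. f A + g A)"
    by (intro smooth_on_add S holomorphic_on_matrices_smooth f g)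
  fix a assume a: "a \<in> S"
  obtain D where D: "(f has_derivative D) (at a)" "\<And>X. D (mat \<i> ** X) = \<i> * D X"
    by (rule holomorphic_on_matrices_derivative[OF f a]) blast
  obtain E where E: "(g has_derivative E) (at a)" "\<And>X. E (mat \<i> ** X) = \<i> * E X"
    by (rule holomorphic_on_matrices_derivative[OF g a]) blast
  show "\<exists>D. ((\<lambda>A. f A + g A) has_derivative D) (at a) \<and> (\<forall>X. D (mat \<i> ** X) = \<i> * D X)"
    using has_derivative_add[OF D(1) E(1)] D(2) E(2)
    by (intro exI[of _ "\<lambda>X. D X + E X"]) (simp add: distrib_left)
qed

lemma holomorphic_mult:
  assumes S: "open S" and f: "holomorphic_on_matrices S f" and g: "holomorphic_on_matrices S g"
  shows "holomorphic_on_matrices S (\<lambda>A. f A * g A)"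
proof (rule holomorphic_on_matricesI)
  show "smooth_on S (\<lambda>A. f A * g A)"
    by (rule smooth_on_bilinear[OF S bounded_bilinear_mult
          holomorphic_on_matrices_smooth[OF f] holomorphic_on_matrices_smooth[OF g]])
  fix a assume a: "a \<in> S"
  obtain D where D: "(f has_derivative D) (at a)" "\<And>X. D (mat \<i> ** X) = \<i> * D X"
    by (rule holomorphic_on_matrices_derivative[OF f a]) blast
  obtain E where E: "(g has_derivative E) (at a)" "\<And>X. E (mat \<i> ** X) = \<i> * E X"
    by (rule holomorphic_on_matrices_derivative[OF g a]) blast
  show "\<exists>D. ((\<lambda>A. f A * g A) has_derivative D) (at a) \<and> (\<forall>X. D (mat \<i> ** X) = \<i> * D X)"
    using has_derivative_mult[OF D(1) E(1)] D(2) E(2)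
    by (intro exI[of _ "\<lambda>X. f a * E X + D X * g a"]) (simp add: algebra_simps)
qed

lemma holomorphic_inverse:
  assumes S: "open S" and f: "holomorphic_on_matrices S f" and nz: "\<And>A. A \<in> S \<Longrightarrow> f A \<noteq> 0"
  shows "holomorphic_on_matrices S (\<lambda>A. inverse (f A))"
proof (rule holomorphic_on_matricesI)
  show "smooth_on S (\<lambda>A. inverse (f A))"
    by (intro smooth_on_inverse S holomorphic_on_matrices_smooth f nz)
  fix a assume a: "a \<in> S"
  obtain D where D: "(f has_derivative D) (at a)" "\<And>X. D (mat \<i> ** X) = \<i> * D X"
    by (rule holomorphic_on_matrices_derivative[OF f a]) blast
  show "\<exists>D. ((\<lambda>A. inverse (f A)) has_derivative D) (at a) \<and> (\<forall>X. D (mat \<i> ** X) = \<i> * D X)"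
    using Deriv.has_derivative_inverse[OF nz[OF a] D(1)] D(2)
    by (intro exI[of _ "\<lambda>X. - (inverse (f a) * D X * inverse (f a))"]) (simp add: algebra_simps)
qed

lemma holomorphic_sum:
  "open S \<Longrightarrow> (\<And>i. i \<in> I \<Longrightarrow> holomorphic_on_matrices S (f i)) \<Longrightarrow>
   holomorphic_on_matrices S (\<lambda>A. \<Sum>i\<in>I. f i A)"
  by (induction I rule: infinite_finite_induct) (auto intro: holomorphic_add holomorphic_const)

lemma holomorphic_prod:
  "open S \<Longrightarrow> (\<And>i. i \<in> I \<Longrightarrow> holomorphic_on_matrices S (f i)) \<Longrightarrow>
   holomorphic_on_matrices S (\<lambda>A. \<Prod>i\<in>I. f i A)"
  by (induction I rule: infinite_finite_induct) (auto intro: holomorphic_mult holomorphic_const)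

definition holomorphic_matrix :: "(complex^'n^'n) set \<Rightarrow> (complex^'n^'n \<Rightarrow> complex^'m^'m) \<Rightarrow> bool" where
  "holomorphic_matrix S F \<longleftrightarrow> (\<forall>i j. holomorphic_on_matrices S (\<lambda>A. F A $ i $ j))"

lemma holomorphic_matrix_const: "open S \<Longrightarrow> holomorphic_matrix S (\<lambda>A. C)"
  by (simp add: holomorphic_matrix_def holomorphic_const)

lemma holomorphic_matrix_add:
  "open S \<Longrightarrow> holomorphic_matrix S F \<Longrightarrow> holomorphic_matrix S G \<Longrightarrow> holomorphic_matrix S (\<lambda>A. F A + G A)"
  by (simp add: holomorphic_matrix_def holomorphic_add)

lemma holomorphic_matrix_mult:
  "open S \<Longrightarrow> holomorphic_matrix S F \<Longrightarrow> holomorphic_matrix S G \<Longrightarrow> holomorphic_matrix S (\<lambda>A. F A ** G A)"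
  by (simp add: holomorphic_matrix_def matrix_matrix_mult_def holomorphic_sum holomorphic_mult)

lemma holomorphic_det:
  "open S \<Longrightarrow> holomorphic_matrix S F \<Longrightarrow> holomorphic_on_matrices S (\<lambda>A. det (F A))"
  unfolding det_def holomorphic_matrix_def
  by (intro holomorphic_sum holomorphic_mult holomorphic_prod holomorphic_const) auto

lemma matrix_inv_mult:
  assumes "invertible (A :: 'a::field^'n^'n)"
  shows "A ** matrix_inv A = mat 1" "matrix_inv A ** A = mat 1"
proof -
  have "A ** matrix_inv A = mat 1 \<and> matrix_inv A ** A = mat 1"
    unfolding matrix_inv_def using assms unfolding invertible_def by (rule someI_ex)
  then show "A ** matrix_inv A = mat 1" "matrix_inv A ** A = mat 1" by auto
qed

text \<open>Cramer's rule. It exhibits every entry as a quotient of determinants, which is how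
  holomorphy of inversion is obtained.\<close>

lemma matrix_inv_entry:
  fixes A :: "complex^'n^'n"
  assumes "det A \<noteq> 0"
  shows "matrix_inv A $ i $ j = det (\<chi> k l. if l = i then mat 1 $ k $ j else A $ k $ l) * inverse (det A)"
proof -
  have inv: "invertible A" using assms by (simp add: invertible_det_nz)
  have "A *v column j (matrix_inv A) = column j (mat 1)"
    unfolding matrix_inv_mult(1)[OF inv, symmetric]
    by (simp add: vec_eq_iff column_def matrix_vector_mult_def matrix_matrix_mult_def)
  then have "column j (matrix_inv A)
      = (\<chi> i. det (\<chi> k l. if l = i then column j (mat 1) $ k else A $ k $ l) / det A)"
    using cramer[OF assms] by blast
  then have "column j (matrix_inv A) $ i
      = det (\<chi> k l. if l = i then column j (mat 1) $ k else A $ k $ l) / det A" by simp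
  then show ?thesis by (simp add: column_def divide_inverse cong: if_cong)
qed

lemma holomorphic_matrix_inv:
  assumes S: "open S" and F: "holomorphic_matrix S F" and nz: "\<And>A. A \<in> S \<Longrightarrow> det (F A) \<noteq> 0"
  shows "holomorphic_matrix S (\<lambda>A. matrix_inv (F A))"
  unfolding holomorphic_matrix_def
proof (intro allI)
  fix i j
  let ?G = "\<lambda>A. det (\<chi> k l. if l = i then mat 1 $ k $ j else F A $ k $ l) * inverse (det (F A))"
  have "holomorphic_matrix S (\<lambda>A. \<chi> k l. if l = i then mat 1 $ k $ j else F A $ k $ l)"
    unfolding holomorphic_matrix_def
  proof (intro allI)
    fix k l
    show "holomorphic_on_matrices S (\<lambda>A. (\<chi> k l. if l = i then mat 1 $ k $ j else F A $ k $ l) $ k $ l)"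
      using F holomorphic_const[OF S] by (cases "l = i") (simp_all add: holomorphic_matrix_def)
  qed
  then have G: "holomorphic_on_matrices S ?G"
    by (intro holomorphic_mult holomorphic_det holomorphic_inverse S F nz)
  have eq: "?G A = matrix_inv (F A) $ i $ j" if "A \<in> S" for A
    using matrix_inv_entry[OF nz[OF that]] by simp
  show "holomorphic_on_matrices S (\<lambda>A. matrix_inv (F A) $ i $ j)"
  proof (rule holomorphic_on_matricesI)
    show "smooth_on S (\<lambda>A. matrix_inv (F A) $ i $ j)"
      by (rule smooth_on_cong[OF S eq holomorphic_on_matrices_smooth[OF G]])
    fix a assume a: "a \<in> S"
    obtain D where D: "(?G has_derivative D) (at a)" "\<And>X. D (mat \<i> ** X) = \<i> * D X"
      by (rule holomorphic_on_matrices_derivative[OF G a]) blast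
    have "((\<lambda>A. matrix_inv (F A) $ i $ j) has_derivative D) (at a)"
      by (rule has_derivative_transform_within_open[OF D(1) S a eq])
    then show "\<exists>D. ((\<lambda>A. matrix_inv (F A) $ i $ j) has_derivative D) (at a) \<and> (\<forall>X. D (mat \<i> ** X) = \<i> * D X)"
      using D(2) by blast
  qed
qed

lemma holomorphic_matrix_smooth: "open S \<Longrightarrow> holomorphic_matrix S F \<Longrightarrow> smooth_on S F"
  by (intro smooth_on_matrix_entrywise) (auto simp: holomorphic_matrix_def holomorphic_on_matrices_smooth)

section \<open>Closed matrix groups\<close>

lemma matrix_inv_unique:
  fixes A :: "complex^'n^'n"
  assumes "A ** A' = mat 1" "A' ** A = mat 1"
  shows "matrix_inv A = A'"
proof -
  have "invertible A" using assms unfolding invertible_def by blast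
  then have "matrix_inv A ** (A ** A') = A'"
    unfolding matrix_mul_assoc by (simp add: matrix_inv_mult)
  then show ?thesis by (simp add: assms)
qed

lemma matrix_inv_mexp: "matrix_inv (mexp (t *\<^sub>R A)) = mexp ((- t) *\<^sub>R A)"
  by (rule matrix_inv_unique[OF mexp_minus_right mexp_minus_left])

lemma linear_group_mult: "linear_group G \<Longrightarrow> a \<in> G \<Longrightarrow> b \<in> G \<Longrightarrow> a ** b \<in> G"
  and linear_group_inv: "linear_group G \<Longrightarrow> a \<in> G \<Longrightarrow> matrix_inv a \<in> G"
  and linear_group_one: "linear_group G \<Longrightarrow> mat 1 \<in> G"
  and linear_group_invertible: "linear_group G \<Longrightarrow> a \<in> G \<Longrightarrow> invertible a"
  by (auto simp: linear_group_def)

lemma linear_group_mpow: "linear_group G \<Longrightarrow> a \<in> G \<Longrightarrow> mpow a k \<in> G"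
  by (induction k) (auto simp: mpow_Suc linear_group_mult linear_group_one)

lemma mpow_mexp: "mpow (mexp (s *\<^sub>R A)) k = mexp ((real k * s) *\<^sub>R A)"
proof (induction k)
  case (Suc k)
  have "mpow (mexp (s *\<^sub>R A)) (Suc k) = mexp ((s + real k * s) *\<^sub>R A)"
    unfolding mpow_Suc Suc mexp_add ..
  then show ?case by (simp add: distrib_right)
qed simp

lemma continuous_mexp: "continuous_on UNIV (\<lambda>t. mexp (t *\<^sub>R A))"
  by (rule smooth_on_continuous[OF smooth_on_mexp])

text \<open>Telescoping of a difference of two powers. The factor \<open>mat 1 + m\<close> is
  bounded by \<open>1 + K * norm m\<close> and not by \<open>K * norm (mat 1 + m)\<close>: only the
  former has bounded \<open>k\<close>-th powers when \<open>k\<close> is of the order of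
  \<open>1 / norm m\<close>.\<close>

lemma norm_mpow_diff:
  fixes m b :: "complex^'n^'n"
  assumes K: "K > 0" "\<And>(A :: complex^'n^'n) (B :: complex^'n^'n). norm (A ** B) \<le> norm A * norm B * K"
    and b: "\<And>j. j < k \<Longrightarrow> norm (mpow b j) \<le> c" and c: "c \<ge> 0"
  shows "norm (mpow (mat 1 + m) k - mpow b k)
    \<le> real k * (1 + K * norm m) ^ k * (K * c * norm (mat 1 + m - b))"
  using b
proof (induction k)
  case (Suc k)
  let ?a = "mat 1 + m"
  let ?q = "1 + K * norm m"
  let ?r = "K * c * norm (?a - b)"
  have q: "?q \<ge> 1" using K(1) by simp
  have r: "?r \<ge> 0" using K(1) c by simp
  have split: "mpow ?a (Suc k) - mpow b (Suc k) = ?a ** (mpow ?a k - mpow b k) + (?a - b) ** mpow b k"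
    unfolding mpow_Suc by (simp only: matrix_mult.diff_left matrix_mult.diff_right) simp
  have "norm (?a ** X) \<le> ?q * norm X" for X :: "complex^'n^'n"
  proof -
    have "norm (?a ** X) \<le> norm X + norm (m ** X)"
      unfolding matrix_mult.add_left using norm_triangle_ineq[of X "m ** X"] by simp
    then show ?thesis using K(2)[of m X] by (simp add: algebra_simps)
  qed
  then have "norm (?a ** (mpow ?a k - mpow b k)) \<le> ?q * (real k * ?q ^ k * ?r)"
    using Suc q by (smt (verit) less_Suc_eq mult_left_mono)
  moreover have "norm ((?a - b) ** mpow b k) \<le> ?r"
  proof -
    have "norm ((?a - b) ** mpow b k) \<le> norm (?a - b) * norm (mpow b k) * K" by (rule K(2))
    also have "\<dots> \<le> norm (?a - b) * c * K"
      using Suc.prems[of k] K(1) by (intro mult_right_mono mult_left_mono) auto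
    finally show ?thesis by (simp add: mult_ac)
  qed
  moreover have "?r \<le> ?q ^ Suc k * ?r"
    using one_le_power[OF q, of "Suc k"] r mult_right_mono[of 1 "?q ^ Suc k" ?r] by simp
  ultimately have "norm (mpow ?a (Suc k) - mpow b (Suc k)) \<le> ?q * (real k * ?q ^ k * ?r) + ?q ^ Suc k * ?r"
    unfolding split by (intro norm_triangle_le) linarith
  then show ?case by (simp add: algebra_simps)
qed simp

text \<open>
  The powers \<open>(1 + m\<^sub>j)\<^bsup>k\<^esup>\<close> with \<open>k \<approx> t / \<bar>m\<^sub>j\<bar>\<close> follow the one-parameter group in the limiting
  direction of the \<open>m\<^sub>j\<close>.
\<close>

lemma mexp_limit_direction:
  fixes K :: "(complex^'n^'n) set"
  assumes grp: "linear_group K" and cl: "closed K"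
    and m: "\<And>j. mat 1 + m j \<in> K" "\<And>j. m j \<noteq> 0" "m \<longlonglongrightarrow> 0"
    and d: "(\<lambda>j. (1 / norm (m j)) *\<^sub>R m j) \<longlonglongrightarrow> d" and t: "t \<ge> 0"
  shows "mexp (t *\<^sub>R d) \<in> K"
proof -
  from matrix_mult.pos_bounded[where 'n = 'n]
  obtain C where "C > 0 \<and> (\<forall>(A :: complex^'n^'n) (B :: complex^'n^'n). norm (A ** B) \<le> norm A * norm B * C)"
    by (rule exE)
  then have C: "C > 0" "\<And>(A :: complex^'n^'n) (B :: complex^'n^'n). norm (A ** B) \<le> norm A * norm B * C" by auto
  have "bounded ((\<lambda>s. mexp (s *\<^sub>R d)) ` {0..t})"
    by (intro compact_imp_bounded compact_continuous_image continuous_on_subset[OF continuous_mexp]) auto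
  then obtain c where "\<forall>x\<in>(\<lambda>s. mexp (s *\<^sub>R d)) ` {0..t}. norm x \<le> c"
    unfolding bounded_iff by blast
  then have c: "\<And>s. 0 \<le> s \<Longrightarrow> s \<le> t \<Longrightarrow> norm (mexp (s *\<^sub>R d)) \<le> c" by auto
  have c0: "c \<ge> 0" using c[of 0] t norm_ge_zero order_trans by blast
  define s where "s j = norm (m j)" for j
  have s: "s j > 0" for j using m(2) by (simp add: s_def)
  have s_nz: "s j \<noteq> 0" for j using s[of j] by simp
  have s0: "s \<longlonglongrightarrow> 0" unfolding s_def using tendsto_norm_zero[OF m(3)] .
  define k where "k j = nat \<lfloor>t / s j\<rfloor>" for j
  have k_le: "real (k j) * s j \<le> t" and k_ge: "t - s j \<le> real (k j) * s j" for j
  proof -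
    have fl: "real (k j) = of_int \<lfloor>t / s j\<rfloor>" unfolding k_def using t s[of j] by simp
    have "real (k j) \<le> t / s j" unfolding fl by simp
    then show "real (k j) * s j \<le> t" using s[of j] by (simp add: field_simps)
    have "t / s j - 1 \<le> real (k j)" unfolding fl by linarith
    then show "t - s j \<le> real (k j) * s j" using s[of j] by (simp add: field_simps)
  qed
  define a where "a j = mat 1 + m j" for j
  define b where "b j = mexp (s j *\<^sub>R d)" for j
  have bk: "mpow (b j) i = mexp ((real i * s j) *\<^sub>R d)" for i j unfolding b_def by (rule mpow_mexp)
  \<comment> \<open>\<open>c\<close> bounds the one-parameter group on [0, t], hence all powers of
    \<open>b j\<close> that occur, and \<open>(1 + C * s j) ^ k j\<close> is at most
    \<open>exp (C * t)\<close>. What remains is to compare \<open>norm (a j - b j)\<close> with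
    \<open>s j\<close>.\<close>
  have diff: "norm (mpow (a j) (k j) - mpow (b j) (k j)) \<le> (t * exp (C * t) * C * c) * (norm (a j - b j) / s j)"
    for j
  proof -
    have "norm (mpow (a j) (k j) - mpow (b j) (k j))
        \<le> real (k j) * (1 + C * norm (m j)) ^ k j * (C * c * norm (a j - b j))"
      unfolding a_def
    proof (rule norm_mpow_diff[OF C _ c0])
      fix i assume "i < k j"
      then have "real i * s j \<le> real (k j) * s j" using s[of j] by (intro mult_right_mono) auto
      then have "real i * s j \<le> t" using k_le[of j] by (rule order_trans)
      then show "norm (mpow (b j) i) \<le> c" unfolding bk using s[of j] by (intro c) auto
    qed
    also have "\<dots> \<le> (t / s j) * exp (C * t) * (C * c * norm (a j - b j))"
    proof (intro mult_right_mono mult_mono)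
      show "real (k j) \<le> t / s j" using k_le[of j] s[of j] by (simp add: field_simps)
      have "(1 + C * s j) ^ k j \<le> exp (C * s j) ^ k j"
        using C(1) s[of j] by (intro power_mono exp_ge_add_one_self) auto
      also have "\<dots> = exp (C * (real (k j) * s j))" by (simp add: exp_of_nat_mult[symmetric] mult_ac)
      also have "\<dots> \<le> exp (C * t)" using C(1) k_le by simp
      finally show "(1 + C * norm (m j)) ^ k j \<le> exp (C * t)" by (simp add: s_def)
      show "0 \<le> (1 + C * norm (m j)) ^ k j" using C(1) by simp
      show "0 \<le> C * c * norm (a j - b j)" using C(1) c0 by simp
      show "0 \<le> t / s j" using t s[of j] by simp
    qed
    finally show ?thesis by (simp add: mult_ac)
  qed
  \<comment> \<open>Both \<open>a j\<close> and \<open>b j\<close> are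
    \<open>mat 1 + s j *\<^sub>R d\<close> up to an error of smaller order than \<open>s j\<close>:
    the first by convergence of the directions, the second by differentiability of the exponential
    at 0.\<close>
  have lim0: "(\<lambda>j. norm (a j - b j) / s j) \<longlonglongrightarrow> 0"
  proof -
    have "((\<lambda>s. mexp (s *\<^sub>R d)) has_derivative (\<lambda>u. u *\<^sub>R d)) (at 0)"
      using mexp_derivative[of d 0] by (simp add: has_vector_derivative_def)
    then have "((\<lambda>h. norm (mexp (h *\<^sub>R d) - mat 1 - h *\<^sub>R d) / norm h) \<longlongrightarrow> 0) (at 0)"
      by (simp add: has_derivative_at)
    then have "(\<lambda>j. norm (mexp (s j *\<^sub>R d) - mat 1 - s j *\<^sub>R d) / norm (s j)) \<longlonglongrightarrow> 0"
      by (rule filterlim_compose) (use s0 s_nz in \<open>simp add: filterlim_at\<close>)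
    moreover have "(\<lambda>j. norm ((1 / norm (m j)) *\<^sub>R m j - d)) \<longlonglongrightarrow> 0"
      using tendsto_norm_zero[OF LIM_zero[OF d]] .
    ultimately have sum0: "(\<lambda>j. norm ((1 / norm (m j)) *\<^sub>R m j - d)
        + norm (mexp (s j *\<^sub>R d) - mat 1 - s j *\<^sub>R d) / norm (s j)) \<longlonglongrightarrow> 0"
      using tendsto_add[of "\<lambda>j. norm ((1 / norm (m j)) *\<^sub>R m j - d)" 0] by fastforce
    show ?thesis
    proof (rule tendsto_sandwich[OF _ _ tendsto_const sum0])
      show "\<forall>\<^sub>F j in sequentially. 0 \<le> norm (a j - b j) / s j"
        using s by (intro always_eventually allI) (simp add: less_imp_le)
      have "norm (a j - b j) / s j \<le> norm ((1 / norm (m j)) *\<^sub>R m j - d)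
        + norm (mexp (s j *\<^sub>R d) - mat 1 - s j *\<^sub>R d) / norm (s j)" for j
      proof -
        have "m j = s j *\<^sub>R ((1 / norm (m j)) *\<^sub>R m j)" using m(2) by (simp add: s_def)
        then have "a j - b j = s j *\<^sub>R ((1 / norm (m j)) *\<^sub>R m j - d) - (mexp (s j *\<^sub>R d) - mat 1 - s j *\<^sub>R d)"
          unfolding a_def b_def scaleR_right_diff_distrib by simp
        then have "norm (a j - b j) \<le> norm (s j *\<^sub>R ((1 / norm (m j)) *\<^sub>R m j - d))
            + norm (mexp (s j *\<^sub>R d) - mat 1 - s j *\<^sub>R d)"
          by (simp only: norm_triangle_ineq4)
        then have "norm (a j - b j) \<le> s j * norm ((1 / norm (m j)) *\<^sub>R m j - d)
            + norm (mexp (s j *\<^sub>R d) - mat 1 - s j *\<^sub>R d)"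
          using s[of j] by (simp only: norm_scaleR abs_of_pos)
        from divide_right_mono[OF this, of "s j"] show ?thesis using s[of j]
          by (simp add: add_divide_distrib)
      qed
      then show "\<forall>\<^sub>F j in sequentially. norm (a j - b j) / s j \<le> norm ((1 / norm (m j)) *\<^sub>R m j - d)
        + norm (mexp (s j *\<^sub>R d) - mat 1 - s j *\<^sub>R d) / norm (s j)"
        by (intro always_eventually allI)
    qed
  qed
  have "(\<lambda>j. mpow (a j) (k j) - mpow (b j) (k j)) \<longlonglongrightarrow> 0"
    by (rule Lim_null_comparison[OF always_eventually[OF allI[OF diff]]])
      (use tendsto_mult_right_zero[OF lim0] in simp)
  moreover have "(\<lambda>j. mpow (b j) (k j)) \<longlonglongrightarrow> mexp (t *\<^sub>R d)"
  proof -
    have "(\<lambda>j. real (k j) * s j) \<longlonglongrightarrow> t"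
    proof (rule tendsto_sandwich[OF _ _ _ tendsto_const])
      show "\<forall>\<^sub>F j in sequentially. t - s j \<le> real (k j) * s j" using k_ge by (intro always_eventually allI)
      show "\<forall>\<^sub>F j in sequentially. real (k j) * s j \<le> t" using k_le by (intro always_eventually allI)
      show "(\<lambda>j. t - s j) \<longlonglongrightarrow> t" using tendsto_diff[OF tendsto_const s0, of t] by simp
    qed
    moreover have "isCont (\<lambda>t. mexp (t *\<^sub>R d)) t" using continuous_mexp[of d]
      by (simp add: continuous_on_eq_continuous_at)
    ultimately show ?thesis unfolding bk by (rule isCont_tendsto_compose[rotated])
  qed
  ultimately have lim: "(\<lambda>j. mpow (a j) (k j)) \<longlonglongrightarrow> mexp (t *\<^sub>R d)"
    using tendsto_add[of "\<lambda>j. mpow (a j) (k j) - mpow (b j) (k j)" 0] by fastforce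
  show ?thesis
    by (rule closed_sequentially[OF cl _ lim]) (simp add: a_def linear_group_mpow[OF grp m(1)])
qed

text \<open>Otherwise nonzero \<open>m j\<close> in \<open>C\<close> tend to 0 with
  \<open>mat 1 + m j\<close> in \<open>K\<close>. By compactness of the unit sphere of
  \<open>C\<close> their directions accumulate at a unit vector of \<open>C\<close>, and that limit
  generates a one-parameter subgroup of \<open>K\<close>, contrary to the hypothesis on
  \<open>C\<close>.\<close>

lemma linear_group_slice:
  fixes K :: "(complex^'n^'n) set"
  assumes grp: "linear_group K" and cl: "closed K" and C: "subspace C" "C \<inter> group_lie_algebra K \<subseteq> {0}"
  shows "\<exists>e>0. \<forall>m\<in>C. norm m < e \<longrightarrow> mat 1 + m \<in> K \<longrightarrow> m = 0"
proof (rule ccontr)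
  assume "\<not> ?thesis"
  then have ex: "\<exists>m\<in>C. norm m < e \<and> mat 1 + m \<in> K \<and> m \<noteq> 0" if "e > 0" for e using that by blast
  have "\<forall>j. \<exists>m. m \<in> C \<and> norm m < 1 / Suc j \<and> mat 1 + m \<in> K \<and> m \<noteq> 0"
  proof
    fix j :: nat
    show "\<exists>m. m \<in> C \<and> norm m < 1 / Suc j \<and> mat 1 + m \<in> K \<and> m \<noteq> 0"
      using ex[of "1 / Suc j"] by auto
  qed
  from choice[OF this] obtain m where
    m: "\<And>j. m j \<in> C \<and> norm (m j) < 1 / Suc j \<and> mat 1 + m j \<in> K \<and> m j \<noteq> 0" by blast
  define u where "u j = (1 / norm (m j)) *\<^sub>R m j" for j
  have u: "u j \<in> C \<inter> sphere 0 1" for j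
    using m[of j] subspace_scale[OF C(1)] by (auto simp: u_def)
  have "compact (C \<inter> sphere 0 1)" by (intro closed_Int_compact closed_subspace C(1)) auto
  then obtain d r where d: "d \<in> C \<inter> sphere 0 1" "strict_mono (r :: nat \<Rightarrow> nat)" "(u \<circ> r) \<longlonglongrightarrow> d"
    using u unfolding compact_def by blast
  have m0: "m \<longlonglongrightarrow> 0"
    by (rule Lim_null_comparison[OF _ LIMSEQ_inverse_real_of_nat])
      (use m in \<open>auto intro!: always_eventually simp: inverse_eq_divide less_imp_le\<close>)
  have pos: "mexp (t *\<^sub>R d) \<in> K" if "t \<ge> 0" for t
  proof (rule mexp_limit_direction[OF grp cl _ _ _ _ that])
    show "mat 1 + (m \<circ> r) j \<in> K" "(m \<circ> r) j \<noteq> 0" for j using m by auto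
    show "(m \<circ> r) \<longlonglongrightarrow> 0" by (rule LIMSEQ_subseq_LIMSEQ[OF m0 d(2)])
    show "(\<lambda>j. (1 / norm ((m \<circ> r) j)) *\<^sub>R (m \<circ> r) j) \<longlonglongrightarrow> d" using d(3) by (simp add: u_def o_def)
  qed
  have "mexp (t *\<^sub>R d) \<in> K" for t
  proof (cases "t \<ge> 0")
    case False
    then have "matrix_inv (mexp ((- t) *\<^sub>R d)) \<in> K" by (intro linear_group_inv[OF grp] pos) simp
    then show ?thesis unfolding matrix_inv_mexp by simp
  qed (rule pos)
  then have "d \<in> group_lie_algebra K" by (simp add: group_lie_algebra_def)
  then have "d = 0" using d(1) C(2) by blast
  then show False using d(1) by simp
qed

section \<open>Products of exponentials and a local chart of a closed matrix group\<close>

text \<open>Canonical coordinates of the second kind. Taking the exponents as inner products with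
  \<open>u\<close> keeps the whole matrix space as the domain.\<close>

definition eprod :: "(complex^'n^'n) list \<Rightarrow> complex^'n^'n \<Rightarrow> complex^'n^'n" where
  "eprod xs u = foldr (\<lambda>X P. mexp ((u \<bullet> X) *\<^sub>R X) ** P) xs (mat 1)"

lemma eprod_Nil [simp]: "eprod [] u = mat 1"
  and eprod_Cons: "eprod (X # xs) u = mexp ((u \<bullet> X) *\<^sub>R X) ** eprod xs u"
  by (simp_all add: eprod_def)

lemma eprod_0 [simp]: "eprod xs 0 = mat 1"
  by (induction xs) (simp_all add: eprod_Cons)

lemma eprod_cong: "(\<And>X. X \<in> set xs \<Longrightarrow> u \<bullet> X = u' \<bullet> X) \<Longrightarrow> eprod xs u = eprod xs u'"
  by (induction xs) (simp_all add: eprod_Cons)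

lemma eprod_group: "linear_group K \<Longrightarrow> set xs \<subseteq> group_lie_algebra K \<Longrightarrow> eprod xs u \<in> K"
  by (induction xs) (auto simp: eprod_Cons linear_group_one group_lie_algebra_def intro: linear_group_mult)

lemma smooth_on_eprod: "smooth_on UNIV (eprod xs)"
proof (induction xs)
  case Nil
  show ?case using smooth_on_const[of UNIV "mat 1"] by (simp add: eprod_def)
next
  case (Cons X xs)
  have "smooth_on UNIV (\<lambda>u. mexp ((u \<bullet> X) *\<^sub>R X))"
    by (rule smooth_on_compose[OF _ _ smooth_on_mexp smooth_on_linear[OF _ bounded_linear_inner_left]]) auto
  from smooth_on_matrix_mult[OF _ this Cons] show ?case by (simp add: eprod_def)
qed

lemma eprod_derivative: "(eprod xs has_derivative (\<lambda>u. \<Sum>X\<leftarrow>xs. (u \<bullet> X) *\<^sub>R X)) (at 0)"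
proof (induction xs)
  case Nil
  show ?case by (simp add: eprod_def)
next
  case (Cons X xs)
  have in1: "((\<lambda>u. u \<bullet> X) has_derivative (\<lambda>u. u \<bullet> X)) (at 0)"
    by (rule bounded_linear_imp_has_derivative[OF bounded_linear_inner_left])
  have "((\<lambda>s. mexp (s *\<^sub>R X)) has_derivative (\<lambda>s. s *\<^sub>R X)) (at (0 \<bullet> X))"
    using mexp_derivative[of X 0] by (simp add: has_vector_derivative_def)
  from has_derivative_compose[OF in1 this]
  have "((\<lambda>u. mexp ((u \<bullet> X) *\<^sub>R X)) has_derivative (\<lambda>u. (u \<bullet> X) *\<^sub>R X)) (at 0)" .
  from matrix_mult.FDERIV[OF this Cons]
  have "((\<lambda>u. mexp ((u \<bullet> X) *\<^sub>R X) ** eprod xs u) has_derivative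
      (\<lambda>u. \<Sum>X\<leftarrow>X # xs. (u \<bullet> X) *\<^sub>R X)) (at 0)"
    by (simp add: add.commute)
  moreover have "eprod (X # xs) = (\<lambda>u. mexp ((u \<bullet> X) *\<^sub>R X) ** eprod xs u)"
    by (rule ext) (rule eprod_Cons)
  ultimately show ?case by simp
qed

definition proj :: "'a::euclidean_space set \<Rightarrow> 'a \<Rightarrow> 'a" where
  "proj B u = (\<Sum>X\<in>B. (u \<bullet> X) *\<^sub>R X)"

definition orthonormal :: "'a::euclidean_space set \<Rightarrow> bool" where
  "orthonormal B \<longleftrightarrow> finite B \<and> pairwise orthogonal B \<and> (\<forall>X\<in>B. norm X = 1)"

lemma proj_inner:
  assumes "orthonormal B" "Y \<in> B"
  shows "proj B u \<bullet> Y = u \<bullet> Y"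
proof -
  have "proj B u \<bullet> Y = (\<Sum>X\<in>B. (u \<bullet> X) * (X \<bullet> Y))" by (simp add: proj_def inner_sum_left)
  also have "\<dots> = (\<Sum>X\<in>{Y}. (u \<bullet> X) * (X \<bullet> Y))"
    using assms by (intro sum.mono_neutral_right) (auto simp: orthonormal_def pairwise_def orthogonal_def)
  also have "\<dots> = u \<bullet> Y" using assms by (simp add: orthonormal_def dot_square_norm)
  finally show ?thesis .
qed

lemma proj_in_span: "proj B u \<in> span B"
  unfolding proj_def by (intro span_sum span_scale span_base)

lemma orthogonal_span_inner: "(\<And>X. X \<in> B \<Longrightarrow> w \<bullet> X = 0) \<Longrightarrow> v \<in> span B \<Longrightarrow> w \<bullet> v = 0"
  using orthogonal_to_span[of v B w] by (simp add: orthogonal_def)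

lemma proj_residual:
  assumes "orthonormal B" "v \<in> span B"
  shows "(u - proj B u) \<bullet> v = 0"
  using assms proj_inner[OF assms(1)] by (intro orthogonal_span_inner[OF _ assms(2)]) (simp add: inner_diff_left)

lemma proj_id:
  assumes "orthonormal B" "u \<in> span B"
  shows "proj B u = u"
proof -
  have "u - proj B u \<in> span B" using assms(2) proj_in_span span_diff by blast
  then have "(u - proj B u) \<bullet> (u - proj B u) = 0" by (rule proj_residual[OF assms(1)])
  then show ?thesis by simp
qed

text \<open>Cauchy-Schwarz. An orthogonal projection and its residual both satisfy the hypothesis,
  hence do not increase norms.\<close>

lemma norm_le_if_self_inner:
  fixes p u :: "'a::real_inner"
  assumes "p \<bullet> p = u \<bullet> p"
  shows "norm p \<le> norm u"
proof (cases "p = 0")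
  case False
  have "norm p * norm p \<le> norm u * norm p"
    using assms norm_cauchy_schwarz[of u p] by (simp add: dot_square_norm power2_eq_square)
  then show ?thesis using False by (simp add: mult_le_cancel_right)
qed simp

lemma norm_proj_le: "orthonormal B \<Longrightarrow> norm (proj B u) \<le> norm u"
  using proj_residual[OF _ proj_in_span, of B u u]
  by (intro norm_le_if_self_inner) (simp add: inner_diff_left)

lemma norm_residual_le: "orthonormal B \<Longrightarrow> norm (u - proj B u) \<le> norm u"
  using proj_residual[OF _ proj_in_span, of B u u]
  by (intro norm_le_if_self_inner) (simp add: inner_diff_right inner_commute)

lemma bounded_linear_proj: "bounded_linear (proj B)"
  unfolding proj_def
  by (intro bounded_linear_sum bounded_linear_scaleR_left[THEN bounded_linear_compose]
      bounded_linear_inner_left)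

text \<open>\<open>s\<close> is meant to be the Lie algebra of a stabiliser. The last clause is von
  Neumann's theorem in the required form: elements of \<open>K\<close> near \<open>e w\<close> are
  \<open>e u\<close> times exponentials from \<open>s\<close>. It holds for all \<open>w\<close> in
  one ball and confines \<open>u\<close> to any prescribed open set around \<open>w\<close>, which
  later makes the chart open onto its image.\<close>

lemma group_chart:
  fixes K k s V :: "(complex^'n^'n) set"
  assumes grp: "linear_group K" and cl: "closed K" and k: "k = group_lie_algebra K"
    and sk: "subspace k" and ss: "subspace s" "s \<subseteq> k" and V: "V = {x\<in>k. \<forall>y\<in>s. x \<bullet> y = 0}"
  obtains e \<pi> \<rho> where "\<rho> > 0" "smooth_on UNIV e" "\<And>u. e u \<in> K" "(e has_derivative \<pi>) (at 0)"
    "e 0 = mat 1" "bounded_linear \<pi>" "\<And>u. \<pi> u \<in> V" "\<And>u. u \<in> V \<Longrightarrow> \<pi> u = u"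
    "\<And>U w. open U \<Longrightarrow> w \<in> V \<inter> U \<inter> ball 0 \<rho> \<Longrightarrow>
       \<exists>N. open N \<and> e w \<in> N \<and> (\<forall>g\<in>N \<inter> K. \<exists>u\<in>V \<inter> U \<inter> ball 0 \<rho>. \<exists>ys z. set ys \<subseteq> s \<and> g = e u ** eprod ys z)"
proof -
  have sV: "subspace V" unfolding V
    by (rule subspaceI) (auto simp: subspace_0[OF sk] subspace_add[OF sk] subspace_scale[OF sk] inner_add_left)
  obtain BV where BV: "BV \<subseteq> V" "pairwise orthogonal BV" "\<And>x. x \<in> BV \<Longrightarrow> norm x = 1"
      "independent BV" "card BV = dim V" "span BV = V"
    by (rule orthonormal_basis_subspace[OF sV]) blast
  obtain Bs where Bs: "Bs \<subseteq> s" "pairwise orthogonal Bs" "\<And>x. x \<in> Bs \<Longrightarrow> norm x = 1"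
      "independent Bs" "card Bs = dim s" "span Bs = s"
    by (rule orthonormal_basis_subspace[OF ss(1)]) blast
  define B where "B = BV \<union> Bs"
  have fin: "finite BV" "finite Bs" using BV(4) Bs(4) independent_imp_finite by auto
  have oBV: "orthonormal BV" and oBs: "orthonormal Bs"
    using fin BV Bs by (auto simp: orthonormal_def)
  have orth: "x \<bullet> y = 0" if "x \<in> BV" "y \<in> Bs" for x y using that BV(1) Bs(1) V by auto
  have oB: "orthonormal B"
    unfolding orthonormal_def B_def
  proof (intro conjI ballI)
    show "pairwise orthogonal (BV \<union> Bs)"
      using BV(2) Bs(2) orth unfolding pairwise_def orthogonal_def
      by (metis Un_iff inner_commute)
  qed (use fin BV(3) Bs(3) in auto)
  have disj: "BV \<inter> Bs = {}"
  proof (rule ccontr)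
    assume "BV \<inter> Bs \<noteq> {}"
    then obtain x where "x \<in> BV" "x \<in> Bs" by blast
    then have "x \<bullet> x = 0" "norm x = 1" using orth BV(3) by auto
    then show False by simp
  qed
  have projB: "proj B u = proj BV u + proj Bs u" for u
    unfolding proj_def B_def by (rule sum.union_disjoint[OF fin disj])
  have Vk: "V \<subseteq> k" using V by auto
  have spanB: "span B = k"
  proof
    show "span B \<subseteq> k" unfolding B_def using BV(1) Bs(1) Vk ss(2) by (intro span_minimal sk) auto
    show "k \<subseteq> span B"
    proof
      fix x assume x: "x \<in> k"
      have ps: "proj Bs x \<in> s" using proj_in_span[of Bs x] Bs(6) by simp
      have "x - proj Bs x \<in> V"
        unfolding V using x ps ss(2) subspace_diff[OF sk] proj_residual[OF oBs] Bs(6) by auto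
      then have "x - proj Bs x \<in> span B" using BV(6) span_mono[of BV B] by (auto simp: B_def)
      moreover have "proj Bs x \<in> span B" using ps Bs(6) span_mono[of Bs B] by (auto simp: B_def)
      ultimately have "(x - proj Bs x) + proj Bs x \<in> span B" by (rule span_add)
      then show "x \<in> span B" by simp
    qed
  qed
  obtain xs where xs: "set xs = BV" "distinct xs" using finite_distinct_list[OF fin(1)] by blast
  obtain ys where ys: "set ys = Bs" "distinct ys" using finite_distinct_list[OF fin(2)] by blast
  have sum_xs: "(\<Sum>X\<leftarrow>xs. (u \<bullet> X) *\<^sub>R X) = proj BV u" for u
    unfolding proj_def xs(1)[symmetric] by (rule sum_list_distinct_conv_sum_set[OF xs(2)])
  have sum_ys: "(\<Sum>X\<leftarrow>ys. (u \<bullet> X) *\<^sub>R X) = proj Bs u" for u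
    unfolding proj_def ys(1)[symmetric] by (rule sum_list_distinct_conv_sum_set[OF ys(2)])
  \<comment> \<open>The factor \<open>R\<close> fills the directions orthogonal to the Lie algebra.
    With it, \<open>\<Phi>\<close> maps the matrix space to itself with the identity as derivative
    at 0, so it is injective near 0 and invariance of domain applies.\<close>
  define R where "R u = mat 1 + (u - proj B u)" for u
  define \<Phi> where "\<Phi> u = (eprod xs u ** eprod ys u) ** R u" for u
  have blR: "bounded_linear (\<lambda>u. u - proj B u)"
    by (rule bounded_linear_sub[OF bounded_linear_ident bounded_linear_proj])
  have "smooth_on UNIV R" unfolding R_def
    by (rule smooth_on_add[OF _ smooth_on_const smooth_on_linear[OF _ blR]]) auto
  then have smooth: "smooth_on UNIV \<Phi>" unfolding \<Phi>_def
    by (intro smooth_on_matrix_mult smooth_on_eprod) auto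
  have "(R has_derivative (\<lambda>u. 0 + (u - proj B u))) (at 0)" unfolding R_def
    by (rule has_derivative_add[OF has_derivative_const bounded_linear_imp_has_derivative[OF blR]])
  from matrix_mult.FDERIV[OF matrix_mult.FDERIV[OF eprod_derivative[of xs] eprod_derivative[of ys]] this]
  have der0: "(\<Phi> has_derivative (\<lambda>u. u)) (at 0)"
    unfolding \<Phi>_def[symmetric] sum_xs sum_ys
    by (simp add: R_def projB linear_0[OF bounded_linear.linear[OF bounded_linear_proj]])
  obtain D where D: "\<And>x. x \<in> UNIV \<Longrightarrow> (\<Phi> has_derivative D x) (at x)"
    by (rule smooth_on_derivative[OF smooth]) blast
  have D0: "D 0 = (\<lambda>u. u)" using has_derivative_unique[OF D der0] by simp
  obtain r where r: "r > 0" "inj_on \<Phi> (ball 0 r)"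
  proof (rule has_derivative_locally_injective[of 0 UNIV "\<lambda>u. u" D \<Phi>])
    show "(\<lambda>u. u) \<circ> D 0 = id" by (simp add: D0 id_def o_def)
    show "\<exists>d>0. \<forall>x. dist 0 x < d \<longrightarrow> onorm (\<lambda>v. D x v - D 0 v) < e" if "e > 0" for e
      using smooth_derivative_continuous[OF open_UNIV UNIV_I smooth D that, of 0] by blast
  qed (use D bounded_linear_ident in auto)
  define C where "C = {u :: complex^'n^'n. \<forall>X\<in>B. u \<bullet> X = 0}"
  have sC: "subspace C" unfolding C_def by (rule subspaceI) (auto simp: inner_add_left)
  have "C \<inter> group_lie_algebra K \<subseteq> {0}"
  proof
    fix x assume x: "x \<in> C \<inter> group_lie_algebra K"
    then have "x \<in> span B" using spanB k by simp
    then have "x \<bullet> x = 0" using x by (intro orthogonal_span_inner[of B x x]) (auto simp: C_def)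
    then show "x \<in> {0}" by simp
  qed
  from linear_group_slice[OF grp cl sC this] obtain \<epsilon> where
    \<epsilon>: "\<epsilon> > 0" "\<And>m. m \<in> C \<Longrightarrow> norm m < \<epsilon> \<Longrightarrow> mat 1 + m \<in> K \<Longrightarrow> m = 0" by blast
  \<comment> \<open>\<open>r\<close> makes \<open>\<Phi>\<close> injective;
    \<open>\<epsilon>\<close> makes the slice orthogonal to the Lie algebra meet \<open>K\<close> in
    the identity alone.\<close>
  define \<rho> where "\<rho> = min r \<epsilon>"
  have eK: "eprod xs u \<in> K" "eprod ys u \<in> K" for u
    using BV(1) Vk Bs(1) ss(2) k by (auto intro!: eprod_group[OF grp] simp: xs(1) ys(1))
  show thesis
  proof (rule that[of \<rho> "eprod xs" "proj BV"])
    show "\<rho> > 0" using r(1) \<epsilon>(1) by (simp add: \<rho>_def)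
    show "smooth_on UNIV (eprod xs)" by (rule smooth_on_eprod)
    show "eprod xs u \<in> K" for u by (rule eK)
    show "(eprod xs has_derivative proj BV) (at 0)" using eprod_derivative[of xs] unfolding sum_xs .
    show "eprod xs 0 = mat 1" by simp
    show "bounded_linear (proj BV)" by (rule bounded_linear_proj)
    show "proj BV u \<in> V" for u using proj_in_span[of BV u] BV(6) by simp
    show "proj BV u = u" if "u \<in> V" for u using proj_id[OF oBV] that BV(6) by simp
    fix U w assume U: "open U" and w: "w \<in> V \<inter> U \<inter> ball 0 \<rho>"
    \<comment> \<open>Only the \<open>V\<close>-component is constrained by \<open>U\<close>; the
      exponentials along \<open>V\<close> depend on nothing else.\<close>
    define U' where "U' = ball 0 \<rho> \<inter> proj BV -` U"
    have "open U'" unfolding U'_def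
      by (intro open_Int open_ball open_vimage U linear_continuous_on bounded_linear_proj)
    moreover have "inj_on \<Phi> U'" by (rule inj_on_subset[OF r(2)]) (auto simp: U'_def \<rho>_def)
    moreover have "continuous_on U' \<Phi>"
      by (rule continuous_on_subset[OF smooth_on_continuous[OF smooth]]) auto
    ultimately have "open (\<Phi> ` U')" by (intro invariance_of_domain)
    moreover have "eprod xs w \<in> \<Phi> ` U'"
    proof
      have "eprod ys w = eprod ys 0" by (rule eprod_cong) (use w ys(1) Bs(1) V in auto)
      moreover have "proj B w = w" using proj_id[OF oB] w Vk spanB by auto
      ultimately show "eprod xs w = \<Phi> w" by (simp add: \<Phi>_def R_def)
      show "w \<in> U'" using w proj_id[OF oBV, of w] BV(6) by (auto simp: U'_def)
    qed
    moreover have "\<exists>u\<in>V \<inter> U \<inter> ball 0 \<rho>. \<exists>ys z. set ys \<subseteq> s \<and> g = eprod xs u ** eprod ys z"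
      if g: "g \<in> \<Phi> ` U' \<inter> K" for g
    proof -
      obtain u where u: "u \<in> U'" "g = \<Phi> u" using g by blast
      let ?h = "eprod xs u ** eprod ys u"
      have h: "?h \<in> K" by (rule linear_group_mult[OF grp eK])
      have "matrix_inv ?h ** g \<in> K"
        using g by (intro linear_group_mult[OF grp] linear_group_inv[OF grp h]) auto
      moreover have "matrix_inv ?h ** g = R u"
        unfolding u(2) \<Phi>_def matrix_mul_assoc[of "matrix_inv ?h" ?h "R u"]
        by (simp add: matrix_inv_mult(2)[OF linear_group_invertible[OF grp h]])
      ultimately have RK: "mat 1 + (u - proj B u) \<in> K" by (simp add: R_def)
      \<comment> \<open>\<open>R u\<close> is a quotient of two elements of \<open>K\<close>, hence
        in \<open>K\<close>, and lies in the orthogonal slice.\<close>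
      have "u - proj B u = 0"
      proof (rule \<epsilon>(2)[OF _ _ RK])
        show "u - proj B u \<in> C" by (simp add: C_def inner_diff_left proj_inner[OF oB])
        show "norm (u - proj B u) < \<epsilon>"
          using norm_residual_le[OF oB, of u] u(1) by (auto simp: U'_def \<rho>_def)
      qed
      then have "g = ?h" unfolding u(2) \<Phi>_def R_def by simp
      moreover have "eprod xs u = eprod xs (proj BV u)"
        by (rule eprod_cong) (simp add: proj_inner[OF oBV] xs(1))
      moreover have "proj BV u \<in> V \<inter> U \<inter> ball 0 \<rho>"
        using u(1) norm_proj_le[OF oBV, of u] proj_in_span[of BV u] BV(6) by (auto simp: U'_def)
      moreover have "set ys \<subseteq> s" using ys(1) Bs(1) by simp
      ultimately show ?thesis by metis
    qed
    ultimately show "\<exists>N. open N \<and> eprod xs w \<in> N \<and>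
        (\<forall>g\<in>N \<inter> K. \<exists>u\<in>V \<inter> U \<inter> ball 0 \<rho>. \<exists>ys z. set ys \<subseteq> s \<and> g = eprod xs u ** eprod ys z)"
      by (intro exI[of _ "\<Phi> ` U'"]) blast
  qed
qed

section \<open>Conjugates of a matrix subspace\<close>

lemma bounded_bilinear_matrix_vector_mult:
  "bounded_bilinear ((*v) :: complex^'n^'n \<Rightarrow> complex^'n \<Rightarrow> complex^'n)"
  unfolding bilinear_conv_bounded_bilinear[symmetric] bilinear_def
  by (auto intro!: linearI simp: vec_eq_iff matrix_vector_mult_def algebra_simps sum.distrib
      scaleR_sum_right)

lemma scaleR_eq_mat_mult: "r *\<^sub>R X = mat (complex_of_real r) ** (X :: complex^'n^'n)"
  by (simp add: vec_eq_iff mat_mult_entry) (simp add: scaleR_conv_of_real)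

text \<open>Flattening turns subspaces of matrices into subspaces of a coordinate space, so that
  projections onto them, and maps such as conjugation, are again matrices.\<close>

definition vc :: "complex^'n^'n \<Rightarrow> complex^('n \<times> 'n)" where
  "vc X = (\<chi> p. X $ fst p $ snd p)"

lemma vc_add: "vc (X + Y) = vc X + vc Y" and vc_diff: "vc (X - Y) = vc X - vc Y"
  and vc_scale: "vc (mat c ** X) = c *s vc X" and vc_0 [simp]: "vc 0 = 0"
  by (simp_all add: vc_def vec_eq_iff mat_mult_entry)

lemma vc_inj: "vc X = vc Y \<longleftrightarrow> X = Y"
  by (auto simp: vc_def vec_eq_iff)

lemma bounded_linear_vc: "bounded_linear vc"
  unfolding linear_conv_bounded_linear[symmetric]
  by (rule linearI) (simp_all add: vc_def vec_eq_iff)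

definition conjg :: "complex^'n^'n \<Rightarrow> complex^'n^'n \<Rightarrow> complex^'n^'n" where
  "conjg b X = b ** X ** matrix_inv b"

text \<open>The Kronecker product of \<open>b\<close> with the transpose of \<open>c\<close>, which
  is the matrix of \<open>X \<mapsto> b ** X ** c\<close> in flattened coordinates.\<close>

definition two_sided :: "complex^'n^'n \<Rightarrow> complex^'n^'n \<Rightarrow> complex^('n \<times> 'n)^('n \<times> 'n)" where
  "two_sided b c = (\<chi> p q. b $ fst p $ fst q * c $ snd q $ snd p)"

definition conj_matrix :: "complex^'n^'n \<Rightarrow> complex^('n \<times> 'n)^('n \<times> 'n)" where
  "conj_matrix b = two_sided b (matrix_inv b)"

lemma two_sided_vc: "two_sided b c *v vc X = vc (b ** X ** c)"
proof (subst vec_eq_iff, rule allI)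
  fix p
  have "(two_sided b c *v vc X) $ p
      = (\<Sum>q\<in>UNIV \<times> UNIV. b $ fst p $ fst q * c $ snd q $ snd p * X $ fst q $ snd q)"
    by (simp add: two_sided_def vc_def matrix_vector_mult_def)
  also have "\<dots> = (\<Sum>k\<in>UNIV. \<Sum>l\<in>UNIV. b $ fst p $ k * c $ l $ snd p * X $ k $ l)"
    unfolding sum.cartesian_product by (simp add: case_prod_beta)
  also have "\<dots> = (\<Sum>l\<in>UNIV. \<Sum>k\<in>UNIV. b $ fst p $ k * c $ l $ snd p * X $ k $ l)"
    by (rule sum.swap)
  also have "\<dots> = vc (b ** X ** c) $ p"
    by (simp add: vc_def matrix_matrix_mult_def sum_distrib_left sum_distrib_right mult_ac)
  finally show "(two_sided b c *v vc X) $ p = vc (b ** X ** c) $ p" .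
qed

lemma conj_matrix_vc: "conj_matrix b *v vc X = vc (conjg b X)"
  by (simp add: conj_matrix_def two_sided_vc conjg_def)

lemma matrix_inv_one [simp]: "matrix_inv (mat 1 :: complex^'n^'n) = mat 1"
  by (rule matrix_inv_unique) simp_all

lemma conj_matrix_one: "conj_matrix (mat 1) = mat 1"
  unfolding conj_matrix_def matrix_inv_one
  by (auto simp: two_sided_def vec_eq_iff mat_def prod_eq_iff)

lemma holomorphic_matrix_id: "open S \<Longrightarrow> holomorphic_matrix S (\<lambda>A. A)"
  by (simp add: holomorphic_matrix_def holomorphic_entry)

lemma open_det_nonzero: "open {b :: complex^'n^'n. det b \<noteq> 0}"
proof -
  have "continuous_on UNIV (\<lambda>b :: complex^'n^'n. det b)"
    by (intro smooth_on_continuous holomorphic_on_matrices_smooth holomorphic_det holomorphic_matrix_id) auto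
  then have "open (UNIV \<inter> (\<lambda>b :: complex^'n^'n. det b) -` (- {0}))"
    by (intro continuous_open_preimage) (auto intro: open_Compl)
  then show ?thesis by (simp add: vimage_def)
qed

lemma holomorphic_conj_matrix:
  "open S \<Longrightarrow> S \<subseteq> {b. det b \<noteq> 0} \<Longrightarrow> holomorphic_matrix S conj_matrix"
  using holomorphic_matrix_inv[OF _ holomorphic_matrix_id, of S]
  unfolding holomorphic_matrix_def conj_matrix_def two_sided_def
  by (auto intro!: holomorphic_mult holomorphic_entry)

text \<open>
  Near a subspace \<open>F\<close> the subspaces \<open>b F b\<^sup>-\<^sup>1\<close> are parametrised by the projections \<open>P b\<close> onto them
  along a fixed complement of \<open>F\<close>.
\<close>

locale matrix_flag =
  fixes F :: "(complex^'n^'n) set"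
  assumes F_0: "0 \<in> F" and F_add: "X \<in> F \<Longrightarrow> Y \<in> F \<Longrightarrow> X + Y \<in> F"
    and F_scale: "X \<in> F \<Longrightarrow> mat c ** X \<in> F"
begin

lemma F_subspace: "subspace F"
  by (rule subspaceI) (auto simp: F_0 F_add F_scale scaleR_eq_mat_mult)

lemma vc_F: "vec.subspace (vc ` F)"
  unfolding vec.subspace_def
  by (auto simp: image_iff vc_add[symmetric] vc_scale[symmetric] vc_inj intro: F_add F_scale)
    (metis F_0 vc_0)

text \<open>The kernel of this projection is the fixed complement of \<open>F\<close>; any choice
  serves.\<close>

definition Q :: "complex^('n \<times> 'n)^('n \<times> 'n)" where
  "Q = (SOME Q. (\<forall>x. Q *v x \<in> vc ` F) \<and> (\<forall>x\<in>vc ` F. Q *v x = x))"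

lemma Q: "Q *v x \<in> vc ` F" "x \<in> vc ` F \<Longrightarrow> Q *v x = x"
proof -
  have "Vector_Spaces.linear (*s) (*s) (\<lambda>x :: complex^('n \<times> 'n). x)" by (rule vec.linear_ident)
  from vec.linear_exists_left_inverse_on[OF this vc_F inj_on_id2]
  obtain g where g: "range g \<subseteq> vc ` F" "Vector_Spaces.linear (*s) (*s) g" "\<forall>v\<in>vc ` F. g v = v"
    by blast
  have "(\<forall>x. matrix g *v x \<in> vc ` F) \<and> (\<forall>x\<in>vc ` F. matrix g *v x = x)"
    unfolding matrix_works[OF g(2)] using g(1,3) by blast
  then have "(\<forall>x. Q *v x \<in> vc ` F) \<and> (\<forall>x\<in>vc ` F. Q *v x = x)"
    unfolding Q_def by (rule someI)
  then show "Q *v x \<in> vc ` F" "x \<in> vc ` F \<Longrightarrow> Q *v x = x" by auto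
qed

text \<open>Conjugation by \<open>b\<close> on \<open>F\<close>, the identity on the kernel of
  \<open>Q\<close>. It carries \<open>Q\<close> to the projection onto the conjugate of
  \<open>F\<close> along the same kernel.\<close>

definition L :: "complex^'n^'n \<Rightarrow> complex^('n \<times> 'n)^('n \<times> 'n)" where
  "L b = conj_matrix b ** Q + (mat 1 + - Q)"

text \<open>Nonvanishing of \<open>det (L b)\<close> says that the conjugate of \<open>F\<close> is
  still a complement of the kernel of \<open>Q\<close>.\<close>

definition \<Omega> :: "(complex^'n^'n) set" where
  "\<Omega> = {b. det b \<noteq> 0 \<and> det (L b) \<noteq> 0}"

definition P :: "complex^'n^'n \<Rightarrow> complex^('n \<times> 'n)^('n \<times> 'n)" where
  "P b = L b ** Q ** matrix_inv (L b)"

lemma holomorphic_L: "open S \<Longrightarrow> S \<subseteq> {b. det b \<noteq> 0} \<Longrightarrow> holomorphic_matrix S L"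
  unfolding L_def
  by (intro holomorphic_matrix_add holomorphic_matrix_mult holomorphic_matrix_const holomorphic_conj_matrix)

lemma open_\<Omega>: "open \<Omega>"
proof -
  have "continuous_on {b. det b \<noteq> 0} (\<lambda>b. det (L b))"
    by (intro smooth_on_continuous holomorphic_on_matrices_smooth holomorphic_det holomorphic_L
        open_det_nonzero) auto
  then have "open ({b. det b \<noteq> 0} \<inter> (\<lambda>b. det (L b)) -` (- {0}))"
    by (intro continuous_open_preimage open_det_nonzero) (auto intro: open_Compl)
  moreover have "\<Omega> = {b. det b \<noteq> 0} \<inter> (\<lambda>b. det (L b)) -` (- {0})" by (auto simp: \<Omega>_def)
  ultimately show ?thesis by simp
qed

lemma holomorphic_P: "holomorphic_matrix \<Omega> P"
proof -
  have "holomorphic_matrix \<Omega> L" by (rule holomorphic_L[OF open_\<Omega>]) (auto simp: \<Omega>_def)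
  then show ?thesis unfolding P_def
    by (intro holomorphic_matrix_mult holomorphic_matrix_const holomorphic_matrix_inv open_\<Omega>)
      (auto simp: \<Omega>_def)
qed

lemma smooth_P: "smooth_on \<Omega> P"
  by (rule holomorphic_matrix_smooth[OF open_\<Omega> holomorphic_P])

lemma L_one: "L (mat 1) = mat 1"
  by (simp add: L_def conj_matrix_one)

lemma one_in_\<Omega>: "mat 1 \<in> \<Omega>"
  by (simp add: \<Omega>_def L_one)

lemma P_one: "P (mat 1) = Q"
  by (simp add: P_def L_one)

lemma L_mult: "L b *v x = conj_matrix b *v (Q *v x) + (x - Q *v x)"
  by (simp add: L_def matrix_vector_mult_add_rdistrib matrix_vector_mul_assoc
      bounded_bilinear.diff_left[OF bounded_bilinear_matrix_vector_mult])

lemma P_L: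
  assumes "b \<in> \<Omega>"
  shows "P b *v (L b *v w) = L b *v (Q *v w)"
proof -
  have "invertible (L b)" using assms by (simp add: \<Omega>_def invertible_det_nz)
  then have "P b ** L b = L b ** Q"
    unfolding P_def matrix_mul_assoc[symmetric] by (simp add: matrix_inv_mult)
  then show ?thesis by (simp add: matrix_vector_mul_assoc)
qed

lemma P_conj:
  assumes "b \<in> \<Omega>" "X \<in> F"
  shows "P b *v vc (conjg b X) = vc (conjg b X)"
proof -
  have "Q *v vc X = vc X" using Q(2) assms(2) by blast
  then have "L b *v vc X = vc (conjg b X)" by (simp add: L_mult conj_matrix_vc)
  then show ?thesis using P_L[OF assms(1), of "vc X"] \<open>Q *v vc X = vc X\<close> by simp
qed

lemma P_kernel:
  assumes "b \<in> \<Omega>" "Q *v y = 0"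
  shows "P b *v y = 0"
proof -
  have "L b *v y = y" using assms(2) by (simp add: L_mult)
  then show ?thesis using P_L[OF assms(1), of y] assms(2) by simp
qed

text \<open>A projection is determined by its image and its kernel, and the kernel does not depend
  on \<open>b\<close>. Hence \<open>P\<close> descends to the space of conjugates.\<close>

lemma P_eq:
  assumes b: "b \<in> \<Omega>" "b' \<in> \<Omega>" and eq: "conjg b ` F = conjg b' ` F"
  shows "P b = P b'"
proof -
  have "P b *v z = P b' *v z" for z
  proof -
    have "invertible (L b)" using b(1) by (simp add: \<Omega>_def invertible_det_nz)
    then have "L b *v (matrix_inv (L b) *v z) = z"
      by (simp add: matrix_vector_mul_assoc matrix_inv_mult)
    then obtain w where w: "z = L b *v w" by metis
    obtain X where X: "X \<in> F" "Q *v w = vc X" using Q(1) by blast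
    have z: "z = vc (conjg b X) + (w - Q *v w)" unfolding w L_mult X(2) conj_matrix_vc by simp
    have "Q *v (Q *v w) = Q *v w" using Q by blast
    then have ker: "Q *v (w - Q *v w) = 0" by (simp add: matrix_vector_mult_diff_distrib)
    obtain X' where X': "X' \<in> F" "conjg b X = conjg b' X'" using eq X(1) by blast
    have "P b *v z = vc (conjg b X)"
      unfolding z matrix_vector_right_distrib P_conj[OF b(1) X(1)] P_kernel[OF b(1) ker] by simp
    moreover have "P b' *v z = vc (conjg b X)"
      unfolding z matrix_vector_right_distrib X'(2) P_conj[OF b(2) X'(1)] P_kernel[OF b(2) ker] by simp
    ultimately show ?thesis by simp
  qed
  then show ?thesis by (simp add: matrix_eq)
qed

lemma conjg_mexp_derivative:
  "((\<lambda>t. conjg (mexp (t *\<^sub>R X)) Y) has_vector_derivative (X ** Y - Y ** X)) (at 0)"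
proof -
  have "((\<lambda>t. mexp (t *\<^sub>R X) ** Y ** mexp ((- t) *\<^sub>R X)) has_vector_derivative
      (mexp (0 *\<^sub>R X) ** Y) ** (- (mexp ((- 0) *\<^sub>R X) ** X)) + (X ** mexp (0 *\<^sub>R X)) ** Y ** mexp ((- 0) *\<^sub>R X)) (at 0)"
    by (rule matrix_mult.has_vector_derivative[OF bounded_linear.has_vector_derivative[OF
          matrix_mult.bounded_linear_left mexp_derivative] mexp_derivative_minus])
  then show ?thesis by (simp add: conjg_def matrix_inv_mexp matrix_mult.minus_right)
qed

text \<open>Differentiates, along \<open>mexp (t *\<^sub>R X)\<close>, the identity that
  \<open>P\<close> fixes the conjugate of \<open>Y\<close>. If \<open>P\<close> is stationary in the
  direction \<open>X\<close>, the derivative of the conjugate, which is the commutator, is itself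
  fixed by \<open>Q\<close>. So only directions that normalise \<open>F\<close> escape the
  coordinates.\<close>

lemma P_derivative_kernel:
  assumes D: "(P has_derivative D) (at (mat 1))" and DX: "D X = 0" and Y: "Y \<in> F"
  shows "X ** Y - Y ** X \<in> F"
proof -
  define v where "v t = vc (conjg (mexp (t *\<^sub>R X)) Y)" for t
  have v: "(v has_vector_derivative vc (X ** Y - Y ** X)) (at 0)"
    unfolding v_def by (rule bounded_linear.has_vector_derivative[OF bounded_linear_vc conjg_mexp_derivative])
  have m: "((\<lambda>t. mexp (t *\<^sub>R X)) has_vector_derivative X) (at 0)"
    using mexp_derivative[of X 0] by simp
  have "((\<lambda>t. P (mexp (t *\<^sub>R X))) has_derivative (\<lambda>s. D (s *\<^sub>R X))) (at 0)"
    using has_derivative_compose[OF m[unfolded has_vector_derivative_def], of P D] D by simp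
  then have Pm: "((\<lambda>t. P (mexp (t *\<^sub>R X))) has_vector_derivative 0) (at 0)"
    using DX linear_scale[OF has_derivative_linear[OF D]] by (simp add: has_vector_derivative_def)
  have "((\<lambda>t. P (mexp (t *\<^sub>R X)) *v v t) has_vector_derivative
      P (mexp (0 *\<^sub>R X)) *v vc (X ** Y - Y ** X) + 0 *v v 0) (at 0)"
    by (rule bounded_bilinear.has_vector_derivative[OF bounded_bilinear_matrix_vector_mult Pm v])
  then have d1: "((\<lambda>t. P (mexp (t *\<^sub>R X)) *v v t) has_vector_derivative Q *v vc (X ** Y - Y ** X)) (at 0)"
    by (simp add: P_one)
  have op: "open ((\<lambda>t. mexp (t *\<^sub>R X)) -` \<Omega>)"
    using continuous_mexp[of X] open_\<Omega> by (rule open_vimage[rotated])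
  have eq: "P (mexp (t *\<^sub>R X)) *v v t = v t" if "t \<in> (\<lambda>t. mexp (t *\<^sub>R X)) -` \<Omega>" for t
    unfolding v_def using that Y by (intro P_conj) auto
  have "(v has_vector_derivative Q *v vc (X ** Y - Y ** X)) (at 0)"
    by (rule has_vector_derivative_transform_within_open[OF d1 op _ eq]) (use one_in_\<Omega> in auto)
  then have "vc (X ** Y - Y ** X) = Q *v vc (X ** Y - Y ** X)"
    using v vector_derivative_unique_at by blast
  then have "vc (X ** Y - Y ** X) \<in> vc ` F" using Q(1) by metis
  then show ?thesis by (auto simp: vc_inj)
qed

text \<open>The conjugate of \<open>Y\<close> solves the linear equation whose matrix
  \<open>A\<close> is \<open>ad X\<close> in flattened coordinates, so it is
  \<open>mexp (t *\<^sub>R A)\<close> applied to \<open>Y\<close>. The partial sums of that series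
  preserve \<open>F\<close>, and \<open>F\<close> is closed.\<close>

lemma conjg_mexp_invariant:
  assumes X: "\<And>Y. Y \<in> F \<Longrightarrow> X ** Y - Y ** X \<in> F" and Y: "Y \<in> F"
  shows "conjg (mexp (t *\<^sub>R X)) Y \<in> F"
proof -
  define A where "A = two_sided X (mat 1) + - two_sided (mat 1) X"
  have A: "A *v vc Z = vc (X ** Z - Z ** X)" for Z
    by (simp add: A_def matrix_vector_mult_add_rdistrib two_sided_vc vc_diff
        bounded_bilinear.diff_left[OF bounded_bilinear_matrix_vector_mult])
  define v where "v t = vc (mexp (t *\<^sub>R X) ** Y ** mexp ((- t) *\<^sub>R X))" for t
  have v: "(v has_vector_derivative A *v v t) (at t)" for t
  proof -
    have "((\<lambda>t. mexp (t *\<^sub>R X) ** Y ** mexp ((- t) *\<^sub>R X)) has_vector_derivative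
        (mexp (t *\<^sub>R X) ** Y) ** (- (mexp ((- t) *\<^sub>R X) ** X)) + (X ** mexp (t *\<^sub>R X)) ** Y ** mexp ((- t) *\<^sub>R X)) (at t)"
      by (rule matrix_mult.has_vector_derivative[OF bounded_linear.has_vector_derivative[OF
            matrix_mult.bounded_linear_left mexp_derivative] mexp_derivative_minus])
    from bounded_linear.has_vector_derivative[OF bounded_linear_vc this]
    show ?thesis unfolding v_def A by (simp add: matrix_mult.minus_right matrix_mul_assoc)
  qed
  have "((\<lambda>t. mexp ((- t) *\<^sub>R A) *v v t) has_vector_derivative 0) (at t)" for t
  proof -
    have "((\<lambda>t. mexp ((- t) *\<^sub>R A) *v v t) has_vector_derivative
      (mexp ((- t) *\<^sub>R A) *v (A *v v t) + - (mexp ((- t) *\<^sub>R A) ** A) *v v t)) (at t)"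
      by (rule bounded_bilinear.has_vector_derivative[OF bounded_bilinear_matrix_vector_mult mexp_derivative_minus v])
    then show ?thesis
      by (simp add: bounded_bilinear.minus_left[OF bounded_bilinear_matrix_vector_mult] matrix_vector_mul_assoc)
  qed
  then obtain c where c: "\<And>t. mexp ((- t) *\<^sub>R A) *v v t = c"
    using has_vector_derivative_zero_constant[of UNIV "\<lambda>t. mexp ((- t) *\<^sub>R A) *v v t"] by auto
  have "v t = mexp (t *\<^sub>R A) *v (mexp ((- t) *\<^sub>R A) *v v t)"
    by (simp only: matrix_vector_mul_assoc mexp_minus_right matrix_vector_mul_lid)
  also have "\<dots> = mexp (t *\<^sub>R A) *v vc Y" using c[of t] c[of 0] by (simp add: v_def)
  finally have vt: "v t = mexp (t *\<^sub>R A) *v vc Y" .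
  have sF: "subspace (vc ` F)"
    by (rule linear_subspace_image[OF bounded_linear.linear[OF bounded_linear_vc] F_subspace])
  have pow: "mpow A k *v vc Y \<in> vc ` F" for k
  proof (induction k)
    case 0
    then show ?case using Y by simp
  next
    case (Suc k)
    then obtain Z where "Z \<in> F" "mpow A k *v vc Y = vc Z" by blast
    then have "mpow A (Suc k) *v vc Y = vc (X ** Z - Z ** X)" "X ** Z - Z ** X \<in> F"
      using X by (simp_all add: mpow_Suc matrix_vector_mul_assoc[symmetric] A)
    then show ?case by blast
  qed
  have bl: "bounded_linear (\<lambda>M :: complex^('n \<times> 'n)^('n \<times> 'n). M *v vc Y)"
    by (rule bounded_bilinear.bounded_linear_left[OF bounded_bilinear_matrix_vector_mult])
  have sums: "(\<lambda>k. ((t ^ k / fact k) *\<^sub>R mpow A k) *v vc Y) sums (mexp (t *\<^sub>R A) *v vc Y)"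
    unfolding mexp_series by (rule bounded_linear.sums[OF bl summable_sums[OF summable_mexp]])
  have "mexp (t *\<^sub>R A) *v vc Y \<in> vc ` F"
  proof (rule closed_sequentially[OF closed_subspace[OF sF] _ sums[unfolded sums_def]])
    show "(\<Sum>k<n. ((t ^ k / fact k) *\<^sub>R mpow A k) *v vc Y) \<in> vc ` F" for n
      unfolding bounded_bilinear.scaleR_left[OF bounded_bilinear_matrix_vector_mult]
      by (intro subspace_sum[OF sF] subspace_scale[OF sF] pow)
  qed
  then have "vc (conjg (mexp (t *\<^sub>R X)) Y) \<in> vc ` F"
    using vt by (simp add: v_def conjg_def matrix_inv_mexp)
  then show ?thesis by (auto simp: vc_inj)
qed

end

section \<open>Traces and commutators\<close>

context lie_algebra
begin

definition linear_map_on :: "'g set \<Rightarrow> ('g \<Rightarrow> 'g) \<Rightarrow> bool" where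
  "linear_map_on L T \<longleftrightarrow> (\<forall>x\<in>L. \<forall>y\<in>L. T (x + y) = T x + T y) \<and>
     (\<forall>c. \<forall>x\<in>L. T (scale c x) = scale c (T x))"

lemma linear_map_on_sum:
  assumes "linear_map_on L T" "subspace L" "finite A" "\<And>a. a \<in> A \<Longrightarrow> x a \<in> L"
  shows "T (\<Sum>a\<in>A. scale (r a) (x a)) = (\<Sum>a\<in>A. scale (r a) (T (x a)))"
  using assms(3,4)
proof (induction A rule: finite_induct)
  case empty
  have "T (scale 0 0) = scale 0 (T 0)"
    using assms(1) subspace_0[OF assms(2)] unfolding linear_map_on_def by blast
  then show ?case by simp
next
  case (insert a A)
  have "(\<Sum>a\<in>A. scale (r a) (x a)) \<in> L"
    by (rule subspace_sum[OF assms(2)]) (auto intro!: subspace_scale[OF assms(2)] insert.prems)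
  moreover have "scale (r a) (x a) \<in> L"
    by (auto intro!: subspace_scale[OF assms(2)] insert.prems)
  ultimately have "T (scale (r a) (x a) + (\<Sum>a\<in>A. scale (r a) (x a)))
      = scale (r a) (T (x a)) + T (\<Sum>a\<in>A. scale (r a) (x a))"
    using assms(1) insert.prems unfolding linear_map_on_def by simp
  then show ?case using insert by simp
qed

text \<open>Both sides are the same double sum of products of matrix entries. Admitting two spaces
  covers at once the independence of the basis, with the identity for \<open>S\<close>, and the
  passage from a space to the image of an operator.\<close>

lemma trace_commute:
  assumes B: "finite B" "independent B" "span B = L"
    and C: "finite C" "independent C" "span C = M"
    and S: "linear_map_on L S" "S ` L \<subseteq> M" and T: "linear_map_on M T" "T ` M \<subseteq> L"
  shows "(\<Sum>b\<in>B. representation B (T (S b)) b) = (\<Sum>c\<in>C. representation C (S (T c)) c)"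
proof -
  have expand: "representation B' (T' (S' b)) b
      = (\<Sum>c\<in>C'. representation C' (S' b) c * representation B' (T' c) b)"
    if B': "finite B'" "independent B'" and C': "finite C'" "independent C'"
      and S': "S' ` span B' \<subseteq> span C'" and T': "linear_map_on (span C') T'" "T' ` span C' \<subseteq> span B'"
      and b: "b \<in> B'" for B' C' S' T' b
  proof -
    have "S' b \<in> span C'" using S' b by (auto intro: span_base)
    then have "S' b = (\<Sum>c\<in>C'. scale (representation C' (S' b) c) c)"
      using sum_representation_eq[OF C'(2) _ C'(1)] by simp
    then have "T' (S' b) = T' (\<Sum>c\<in>C'. scale (representation C' (S' b) c) c)" by simp
    also have "\<dots> = (\<Sum>c\<in>C'. scale (representation C' (S' b) c) (T' c))"
      by (rule linear_map_on_sum[OF T'(1) subspace_span C'(1)]) (auto intro: span_base)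
    finally have eq: "T' (S' b) = (\<Sum>c\<in>C'. scale (representation C' (S' b) c) (T' c))" .
    have "T' c \<in> span B'" if "c \<in> C'" for c using T'(2) that by (auto intro: span_base)
    then show ?thesis unfolding eq
      by (subst representation_sum[OF B'(2)])
        (auto simp: representation_scale[OF B'(2)] intro!: span_scale)
  qed
  have "(\<Sum>b\<in>B. representation B (T (S b)) b)
      = (\<Sum>b\<in>B. \<Sum>c\<in>C. representation C (S b) c * representation B (T c) b)"
    using assms by (intro sum.cong refl expand) auto
  also have "\<dots> = (\<Sum>c\<in>C. \<Sum>b\<in>B. representation B (T c) b * representation C (S b) c)"
    by (subst sum.swap) (simp add: mult.commute)
  also have "\<dots> = (\<Sum>c\<in>C. representation C (S (T c)) c)"
    using assms by (intro sum.cong refl expand[symmetric]) auto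
  finally show ?thesis .
qed

lemma trace_on_eq:
  assumes B: "finite B" "independent B" "span B = L"
    and T: "linear_map_on L T" "T ` L \<subseteq> L"
  shows "trace_on L T = (\<Sum>b\<in>B. representation B (T b) b)"
proof -
  define C where "C = (SOME B. independent B \<and> span B = L)"
  have C: "independent C \<and> span C = L"
    unfolding C_def using B by (intro someI[where P="\<lambda>B. independent B \<and> span B = L"]) auto
  have "finite C"
    using independent_span_bound[OF B(1)] C B(3) span_superset by blast
  then show ?thesis
    unfolding trace_on_def C_def[symmetric] Let_def
    using trace_commute[of C L B L id T] B C T by (auto simp: linear_map_on_def)
qed

lemma trace_on_commute:
  assumes B: "finite B" "span B = L"
    and M: "subspace M" "M \<subseteq> L"
    and S: "linear_map_on L S" "S ` L \<subseteq> M" and T: "linear_map_on M T" "T ` M \<subseteq> L"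
  shows "trace_on L (\<lambda>x. T (S x)) = trace_on M (\<lambda>x. S (T x))"
proof -
  obtain B' where B': "B' \<subseteq> B" "independent B'" "B \<subseteq> span B'"
    using maximal_independent_subset by blast
  have fin: "finite B'" using B' B(1) finite_subset by blast
  have sp: "span B' = L"
    using B' B(2) span_mono[OF B'(1)] span_minimal[OF B'(3) subspace_span] by auto
  obtain C where C: "C \<subseteq> M" "independent C" "M \<subseteq> span C"
    using maximal_independent_subset by blast
  have finC: "finite C"
    using independent_span_bound[OF B(1) C(2)] C(1) M(2) B(2) by blast
  have spC: "span C = M"
    using C span_minimal[OF C(1) M(1)] by auto
  have "trace_on L (\<lambda>x. T (S x)) = (\<Sum>b\<in>B'. representation B' (T (S b)) b)"
    using S T by (intro trace_on_eq fin sp B') (auto simp: linear_map_on_def image_subset_iff)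
  also have "\<dots> = (\<Sum>c\<in>C. representation C (S (T c)) c)"
    by (rule trace_commute[OF fin B'(2) sp finC C(2) spC S T])
  also have "\<dots> = trace_on M (\<lambda>x. S (T x))"
    using S T M(2)
    by (intro trace_on_eq[symmetric] finC spC C) (auto simp: linear_map_on_def image_subset_iff subset_iff)
  finally show ?thesis .
qed

text \<open>\<open>T\<close> factors through its image, so its trace on \<open>L\<close> equals its
  trace on the image, where the order of nilpotency is smaller by one.\<close>

lemma trace_on_nilpotent:
  assumes B: "finite B" "span B = L"
    and T: "linear_map_on L T" "T ` L \<subseteq> L" and nil: "\<And>x. x \<in> L \<Longrightarrow> (T ^^ m) x = 0"
  shows "trace_on L T = 0"
  using B T nil
proof (induction m arbitrary: L B)
  case 0
  have "0 \<in> L" using subspace_0[OF subspace_span[of B]] "0.prems"(2) by simp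
  then have L: "L = {0}" using "0.prems"(5) by force
  show ?case using trace_on_eq[of "{}" L T] "0.prems"(3,4) unfolding L
    by (simp add: independent_empty)
next
  case (Suc m)
  let ?M = "T ` L"
  have sL: "subspace L" using Suc.prems subspace_span by metis
  have sM: "subspace ?M"
  proof (rule subspaceI)
    have "T (scale 0 0) = scale 0 (T 0)"
      using Suc.prems(3) subspace_0[OF sL] unfolding linear_map_on_def by blast
    then show "0 \<in> ?M" using subspace_0[OF sL] by (force simp: image_iff)
  next
    fix x y assume "x \<in> ?M" "y \<in> ?M"
    then obtain a b where "a \<in> L" "b \<in> L" "x = T a" "y = T b" by blast
    then have "a + b \<in> L" "x + y = T (a + b)"
      using Suc.prems(3) subspace_add[OF sL] unfolding linear_map_on_def by auto
    then show "x + y \<in> ?M" by blast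
  next
    fix c x assume "x \<in> ?M"
    then obtain a where "a \<in> L" "x = T a" by blast
    then have "scale c a \<in> L" "scale c x = T (scale c a)"
      using Suc.prems(3) subspace_scale[OF sL] unfolding linear_map_on_def by auto
    then show "scale c x \<in> ?M" by blast
  qed
  obtain C where C: "C \<subseteq> ?M" "independent C" "?M \<subseteq> span C"
    using maximal_independent_subset by blast
  have finC: "finite C"
    using independent_span_bound[OF Suc.prems(1) C(2)] C(1) Suc.prems(2,4) by blast
  have spC: "span C = ?M" using C span_minimal[OF C(1) sM] by auto
  have "trace_on L (\<lambda>x. T x) = trace_on ?M (\<lambda>x. T x)"
    using trace_on_commute[OF Suc.prems(1,2) sM Suc.prems(4,3), of "\<lambda>x. x"] Suc.prems(4)
    by (auto simp: linear_map_on_def)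
  also have "\<dots> = 0"
  proof (rule Suc.IH[OF finC spC])
    show "linear_map_on ?M T" using Suc.prems(3,4) unfolding linear_map_on_def by blast
    show "T ` ?M \<subseteq> ?M" using Suc.prems(4) by blast
    show "(T ^^ m) x = 0" if "x \<in> ?M" for x
      using that Suc.prems(5) by (auto simp: funpow_swap1)
  qed
  finally show ?case .
qed

section \<open>Brackets, commutators and the centre\<close>

lemma linear_map_on_br: "linear_map_on L (br x)"
  by (simp add: linear_map_on_def br_add_right br_scale_right)

lemma br_0_left [simp]: "br 0 x = 0"
  using br_scale_left[of 0 0 x] by simp

lemma br_0_right [simp]: "br x 0 = 0"
  using br_scale_right[of x 0 0] by simp

lemma br_minus_left [simp]: "br (- x) y = - br x y"
  using br_add_left[of x "- x" y] by (simp add: minus_unique)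

lemma br_minus_right [simp]: "br x (- y) = - br x y"
  using br_add_right[of x y "- y"] by (simp add: minus_unique)

lemma br_diff_right: "br x (y - z) = br x y - br x z"
  using br_add_right[of x y "- z"] by simp

lemma br_anti: "br y x = - br x y"
proof -
  have "br (x + y) (x + y) = br x y + br y x"
    by (simp only: br_add_left br_add_right) (simp add: br_self)
  then have "br x y + br y x = 0" by (simp add: br_self)
  then show ?thesis by (metis add.commute eq_neg_iff_add_eq_0)
qed

lemma br_br: "br (br x y) z = br x (br y z) - br y (br x z)"
proof -
  have "br x (br y z) - br y (br x z) - br (br x y) z = 0"
    using jacobi[of x y z] by (simp add: br_anti[of z x] br_anti[of z "br x y"])
  then show ?thesis by simp
qed

lemma lie_subalgebra_subspace: "lie_subalgebra L \<Longrightarrow> subspace L"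
  by (simp add: lie_subalgebra_def)

lemma commutator_subspace: "subspace (commutator A B)"
  by (simp add: commutator_def)

lemma br_in_commutator: "x \<in> A \<Longrightarrow> y \<in> B \<Longrightarrow> br x y \<in> commutator A B"
  unfolding commutator_def by (rule span_base) blast

lemma commutator_least:
  assumes "subspace S" "\<And>x y. x \<in> A \<Longrightarrow> y \<in> B \<Longrightarrow> br x y \<in> S"
  shows "commutator A B \<subseteq> S"
  unfolding commutator_def by (rule span_minimal) (use assms in auto)

lemma commutator_mono: "A \<subseteq> A' \<Longrightarrow> B \<subseteq> B' \<Longrightarrow> commutator A B \<subseteq> commutator A' B'"
  by (rule commutator_least[OF commutator_subspace]) (auto intro: br_in_commutator)

lemma subspace_br_preimage: "subspace S \<Longrightarrow> subspace {y. br x y \<in> S}"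
  by (rule subspaceI) (auto simp: br_add_right br_scale_right subspace_0 subspace_add subspace_scale)

lemma commutator_invariant:
  assumes "\<And>y. y \<in> A \<Longrightarrow> br x y \<in> A" "\<And>y. y \<in> B \<Longrightarrow> br x y \<in> B" "z \<in> commutator A B"
  shows "br x z \<in> commutator A B"
proof -
  have "commutator A B \<subseteq> {z. br x z \<in> commutator A B}"
  proof (rule commutator_least[OF subspace_br_preimage[OF commutator_subspace]])
    fix a b assume ab: "a \<in> A" "b \<in> B"
    have "br x (br a b) = br (br x a) b + br a (br x b)" by (simp add: br_br)
    then show "br a b \<in> {z. br x z \<in> commutator A B}"
      using ab assms(1,2) by (auto intro!: subspace_add[OF commutator_subspace] br_in_commutator)
  qed
  then show ?thesis using assms(3) by blast
qed

lemma lie_ideal_commutator: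
  assumes "lie_ideal I L"
  shows "lie_ideal (commutator I I) L"
proof -
  have "commutator I I \<subseteq> I"
    by (rule commutator_least) (use assms in \<open>auto simp: lie_ideal_def\<close>)
  then show ?thesis
    using assms commutator_invariant[of I _ I] by (auto simp: lie_ideal_def commutator_subspace)
qed

lemma center_subspace: "subspace L \<Longrightarrow> subspace (center L)"
  unfolding center_def
  by (rule subspaceI) (auto simp: br_add_left br_scale_left subspace_0 subspace_add subspace_scale)

lemma center_ideal: "lie_subalgebra L \<Longrightarrow> lie_ideal (center L) L"
  unfolding lie_ideal_def
proof (intro conjI ballI)
  assume L: "lie_subalgebra L"
  show "subspace (center L)" by (rule center_subspace[OF lie_subalgebra_subspace[OF L]])
  show "center L \<subseteq> L" by (auto simp: center_def)
  fix x y assume "x \<in> L" "y \<in> center L"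
  then have "br x y = 0" using br_anti[of x y] by (simp add: center_def)
  then show "br x y \<in> center L"
    using subspace_0[OF center_subspace[OF lie_subalgebra_subspace[OF L]]] by simp
qed

lemma center_solvable: "solvable (center L)"
proof -
  have "commutator (center L) (center L) \<subseteq> {0}"
    by (rule commutator_least) (auto simp: center_def)
  then have "commutator (center L) (center L) = {0}"
    using subspace_0[OF commutator_subspace] by blast
  then show ?thesis unfolding solvable_def by (intro exI[of _ 1]) simp
qed

lemma span_image_lessThan:
  assumes "x \<in> span (f ` {..<n})"
  shows "\<exists>c. x = (\<Sum>i<n::nat. scale (c i) (f i))"
  using assms
proof (induction n arbitrary: x)
  case 0
  then show ?case by simp
next
  case (Suc n)
  have "f ` {..<Suc n} = insert (f n) (f ` {..<n})" by (auto simp: lessThan_Suc)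
  then obtain k where "x - scale k (f n) \<in> span (f ` {..<n})"
    using Suc.prems span_breakdown_eq by metis
  then obtain c where c: "x - scale k (f n) = (\<Sum>i<n. scale (c i) (f i))"
    using Suc.IH by blast
  have "x = (\<Sum>i<Suc n. scale ((c(n := k)) i) (f i))"
    using c by (simp add: algebra_simps)
  then show ?case by blast
qed

end

section \<open>Eigenvectors of complex operators\<close>

context complex_lie_algebra
begin

definition basis :: "'g set" where
  "basis = (SOME B. finite B \<and> independent B \<and> span B = UNIV)"

lemma basis: "finite basis \<and> independent basis \<and> span basis = UNIV"
proof -
  obtain B where B: "finite B" "span B = UNIV" using finite_dimensional by blast
  obtain C where C: "C \<subseteq> B" "independent C" "B \<subseteq> span C"
    using maximal_independent_subset by blast
  have "span C = UNIV" using span_minimal[OF C(3) subspace_span] B(2) by auto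
  then have "finite C \<and> independent C \<and> span C = UNIV" using C B finite_subset by auto
  then show ?thesis unfolding basis_def by (rule someI)
qed

sublocale finite_dimensional_vector_space scale basis
proof unfold_locales
  show "finite basis" "independent basis" "span basis = UNIV" using basis by blast+
qed

lemma subspace_finite_span: "subspace W \<Longrightarrow> \<exists>A. finite A \<and> span A = W"
  by (metis basis_subspace_exists)

text \<open>Finite dimension yields a nonzero polynomial p with p(T) w = 0. One of least degree has
  a root z; dividing by that linear factor leaves a polynomial whose value at \<open>w\<close> is
  nonzero by minimality and is killed by T - z.\<close>

lemma exists_eigenvector:
  assumes W: "subspace W" "W \<noteq> {0}" and T: "linear_map_on W T" "T ` W \<subseteq> W"
  shows "\<exists>w\<in>W. w \<noteq> 0 \<and> (\<exists>c. T w = scale c w)"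
proof -
  obtain w where w: "w \<in> W" "w \<noteq> 0" using W subspace_0 by auto
  \<comment> \<open>This is p(T) applied to \<open>w\<close>, spelled out on the vector because
    \<open>T\<close> is linear only on \<open>W\<close>.\<close>
  define ev where "ev p = (\<Sum>i\<le>degree p. scale (coeff p i) ((T ^^ i) w))" for p
  have TW: "(T ^^ i) w \<in> W" for i by (induction i) (use w T(2) in auto)
  have ev_ge: "ev p = (\<Sum>i\<le>N. scale (coeff p i) ((T ^^ i) w))" if "degree p \<le> N" for p N
    unfolding ev_def using that
    by (intro sum.mono_neutral_left) (auto simp: coeff_eq_0)
  have evW: "ev p \<in> W" for p
    unfolding ev_def by (intro subspace_sum[OF W(1)] subspace_scale[OF W(1)] TW)
  have step: "ev ([:- c, 1:] * q) = T (ev q) - scale c (ev q)" for c q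
  proof -
    let ?N = "degree q"
    have "degree ([:- c, 1:] * q) \<le> Suc ?N" using degree_mult_le[of "[:-c, 1:]" q] by simp
    then have "ev ([:- c, 1:] * q)
        = (\<Sum>i\<le>Suc ?N. scale (coeff ([:- c, 1:] * q) i) ((T ^^ i) w))" by (rule ev_ge)
    also have "\<dots> = (\<Sum>i\<le>Suc ?N. scale (case i of 0 \<Rightarrow> 0 | Suc j \<Rightarrow> coeff q j) ((T ^^ i) w)
                      - scale (c * coeff q i) ((T ^^ i) w))"
      by (intro sum.cong refl) (auto simp: coeff_pCons scale_left_diff_distrib[symmetric] split: nat.splits)
    also have "\<dots> = (\<Sum>i\<le>Suc ?N. scale (case i of 0 \<Rightarrow> 0 | Suc j \<Rightarrow> coeff q j) ((T ^^ i) w))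
                      - (\<Sum>i\<le>Suc ?N. scale (c * coeff q i) ((T ^^ i) w))"
      by (rule sum_subtractf)
    also have "(\<Sum>i\<le>Suc ?N. scale (case i of 0 \<Rightarrow> 0 | Suc j \<Rightarrow> coeff q j) ((T ^^ i) w))
        = (\<Sum>i\<le>?N. scale (coeff q i) (T ((T ^^ i) w)))"
      by (subst sum.atMost_Suc_shift) simp
    also have "\<dots> = T (ev q)"
      unfolding ev_def by (subst linear_map_on_sum[OF T(1) W(1)]) (auto simp: TW)
    also have "(\<Sum>i\<le>Suc ?N. scale (c * coeff q i) ((T ^^ i) w)) = scale c (ev q)"
      unfolding ev_def by (simp add: scale_sum_right coeff_eq_0)
    finally show ?thesis .
  qed
  have "\<exists>n. (T ^^ n) w \<in> span ((\<lambda>i. (T ^^ i) w) ` {..<n})"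
  proof (rule ccontr)
    assume "\<not> ?thesis"
    then have no: "(T ^^ n) w \<notin> span ((\<lambda>i. (T ^^ i) w) ` {..<n})" for n by blast
    have "independent ((\<lambda>i. (T ^^ i) w) ` {..<n}) \<and> card ((\<lambda>i. (T ^^ i) w) ` {..<n}) = n" for n
    proof (induction n)
      case 0
      show ?case by (simp add: independent_empty)
    next
      case (Suc n)
      have "(T ^^ n) w \<notin> (\<lambda>i. (T ^^ i) w) ` {..<n}"
        using no[of n] span_base[of "(T ^^ n) w"] by metis
      then show ?case using Suc no by (simp add: lessThan_Suc independent_insertI)
    qed
    from this[of "Suc (dim UNIV)"] show False
      using independent_card_le_dim[OF subset_UNIV, of "(\<lambda>i. (T ^^ i) w) ` {..<Suc (dim UNIV)}"]
      by linarith
  qed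
  then obtain n where n: "(T ^^ n) w \<in> span ((\<lambda>i. (T ^^ i) w) ` {..<n})" by blast
  obtain c where c: "(T ^^ n) w = (\<Sum>i<n. scale (c i) ((T ^^ i) w))"
    using span_image_lessThan[OF n] by (rule exE)
  define p0 where "p0 = monom 1 n - (\<Sum>i<n. monom (c i) i)"
  have cp: "coeff p0 i = (if i = n then 1 else if i < n then - c i else 0)" for i
    unfolding p0_def by (auto simp: coeff_sum sum.delta)
  have "degree p0 \<le> n" by (rule degree_le) (auto simp: cp)
  then have "ev p0 = (\<Sum>i\<le>n. scale (coeff p0 i) ((T ^^ i) w))" by (rule ev_ge)
  also have "\<dots> = (\<Sum>i<n. scale (coeff p0 i) ((T ^^ i) w)) + (T ^^ n) w"
    by (simp add: lessThan_Suc_atMost[symmetric] cp)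
  also have "(\<Sum>i<n. scale (coeff p0 i) ((T ^^ i) w)) = - (T ^^ n) w"
    unfolding c sum_negf[symmetric] by (intro sum.cong refl) (auto simp: cp)
  finally have "ev p0 = 0" by simp
  moreover have "p0 \<noteq> 0" using cp[of n] by auto
  ultimately have "\<exists>p. p \<noteq> 0 \<and> ev p = 0" by blast
  then obtain p where p: "p \<noteq> 0" "ev p = 0" and min: "\<And>q. q \<noteq> 0 \<Longrightarrow> ev q = 0 \<Longrightarrow> degree p \<le> degree q"
    using ex_has_least_nat[of "\<lambda>p. p \<noteq> 0 \<and> ev p = 0" _ degree] by blast
  have "degree p \<noteq> 0"
  proof
    assume d: "degree p = 0"
    then have "scale (coeff p 0) w = 0" using p(2) unfolding ev_def by simp
    moreover have "coeff p 0 \<noteq> 0" using p(1) d by (metis leading_coeff_0_iff)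
    ultimately show False using w(2) by simp
  qed
  then obtain z where "poly p z = 0"
    using fundamental_theorem_of_algebra[of p] by (metis constant_degree)
  then obtain q where q: "p = [:- z, 1:] * q" by (metis poly_eq_0_iff_dvd dvdE)
  have "q \<noteq> 0" using p(1) q by auto
  then have "degree p = Suc (degree q)" unfolding q by (subst degree_mult_eq) auto
  then have "ev q \<noteq> 0" using min[OF \<open>q \<noteq> 0\<close>] by fastforce
  moreover have "T (ev q) = scale z (ev q)" using step[of z q] p(2) q by simp
  ultimately show ?thesis using evW by blast
qed

end

section \<open>Lie algebras with an adjoint-invariant Hermitian form\<close>

locale hermitian_lie_algebra = complex_lie_algebra scale br
  for scale :: "complex \<Rightarrow> 'g::ab_group_add \<Rightarrow> 'g" and br :: "'g \<Rightarrow> 'g \<Rightarrow> 'g" +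
  fixes \<tau> :: "'g \<Rightarrow> 'g" and H :: "'g \<Rightarrow> 'g \<Rightarrow> complex"
  assumes \<tau>_add: "\<tau> (x + y) = \<tau> x + \<tau> y"
    and \<tau>_scale: "\<tau> (scale c x) = scale (cnj c) (\<tau> x)"
    and \<tau>_br: "\<tau> (br x y) = br (\<tau> x) (\<tau> y)"
    and \<tau>_\<tau> [simp]: "\<tau> (\<tau> x) = x"
    and H_add_left: "H (x + y) z = H x z + H y z"
    and H_scale_left: "H (scale c x) z = c * H x z"
    and H_commute: "H y x = cnj (H x y)"
    and H_pos: "x \<noteq> 0 \<Longrightarrow> Re (H x x) > 0"
    and H_br: "H (br x y) z = - H y (br (\<tau> x) z)"
    and H_\<tau>: "H (\<tau> x) (\<tau> y) = cnj (H x y)"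
begin

lemma H_add_right: "H z (x + y) = H z x + H z y"
  using H_add_left[of x y z] by (metis H_commute complex_cnj_add)

lemma H_scale_right: "H z (scale c x) = cnj c * H z x"
  using H_scale_left[of c x z] by (metis H_commute complex_cnj_mult)

lemma H_0_left [simp]: "H 0 z = 0"
  using H_scale_left[of 0 0 z] by simp

lemma H_0_right [simp]: "H z 0 = 0"
  using H_scale_right[of z 0 0] by simp

lemma H_minus_left [simp]: "H (- x) z = - H x z"
  using H_add_left[of x "- x" z] by (simp add: minus_unique)

lemma H_minus_right [simp]: "H z (- x) = - H z x"
  using H_add_right[of z x "- x"] by (simp add: minus_unique)

lemma H_diff_left: "H (x - y) z = H x z - H y z"
  using H_add_left[of x "- y" z] by simp

lemma H_diff_right: "H z (x - y) = H z x - H z y"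
  using H_add_right[of z x "- y"] by simp

lemma H_sum_left: "H (\<Sum>a\<in>A. x a) z = (\<Sum>a\<in>A. H (x a) z)"
  by (induction A rule: infinite_finite_induct) (auto simp: H_add_left)

lemma H_eq_0_iff [simp]: "H x x = 0 \<longleftrightarrow> x = 0"
  using H_pos[of x] by fastforce

lemma H_self_real: "H x x = of_real (Re (H x x))"
  using H_commute[of x x] by (simp add: complex_eq_iff)

lemma H_self_nonneg: "Re (H x x) \<ge> 0"
  using H_pos[of x] by (cases "x = 0") auto

lemma H_eq_0_commute: "H x y = 0 \<Longrightarrow> H y x = 0"
  using H_commute[of y x] by simp

lemma H_br_right: "H x (br y z) = - H (br (\<tau> y) x) z"
  using H_br[of "\<tau> y" x z] by simp

lemma \<tau>_0 [simp]: "\<tau> 0 = 0"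
  using \<tau>_scale[of 0 0] by simp

lemma \<tau>_minus [simp]: "\<tau> (- x) = - \<tau> x"
  using \<tau>_add[of x "- x"] by (simp add: minus_unique)

lemma subspace_H_left: "subspace {x. H x y = 0}"
  by (rule subspaceI) (auto simp: H_add_left H_scale_left)

lemma subspace_H_right: "subspace {x. H y x = 0}"
  by (rule subspaceI) (auto simp: H_add_right H_scale_right)

text \<open>One Gram-Schmidt step per generator; a generator whose residual \<open>a'\<close>
  vanishes adds nothing to the span.\<close>

lemma orthogonal_projection_span:
  "finite A \<Longrightarrow> \<exists>w\<in>span A. \<forall>u\<in>span A. H (x - w) u = 0"
proof (induction A arbitrary: x rule: finite_induct)
  case empty
  then show ?case by simp
next
  case (insert a A)
  obtain a0 where a0: "a0 \<in> span A" "\<forall>u\<in>span A. H (a - a0) u = 0" using insert.IH by blast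
  obtain w0 where w0: "w0 \<in> span A" "\<forall>u\<in>span A. H (x - w0) u = 0" using insert.IH by blast
  define a' where "a' = a - a0"
  show ?case
  proof (cases "a' = 0")
    case True
    then have "a \<in> span A" using a0 by (simp add: a'_def)
    then show ?thesis using insert.IH by (simp add: span_redundant)
  next
    case False
    define w where "w = w0 + scale (H x a' / H a' a') a'"
    have sub: "span A \<subseteq> span (insert a A)" by (rule span_mono) auto
    have a'_in: "a' \<in> span (insert a A)"
      unfolding a'_def using a0 sub by (intro span_diff) (auto intro: span_base)
    have "H (x - w) u = 0" if "u \<in> span A" for u
      using w0 a0 that by (auto simp: w_def a'_def[symmetric] H_diff_left H_add_left H_scale_left)
    moreover have "H (x - w) a' = 0"
    proof -
      have "H w0 a' = 0" using a0 w0 by (intro H_eq_0_commute[of a' w0]) (simp add: a'_def)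
      then show ?thesis using False by (simp add: w_def H_diff_left H_add_left H_scale_left)
    qed
    moreover have "a = a' + a0" by (simp add: a'_def)
    ultimately have "insert a A \<subseteq> {u. H (x - w) u = 0}"
      using a0(1) by (auto simp: H_add_right intro: span_base)
    then have "span (insert a A) \<subseteq> {u. H (x - w) u = 0}"
      by (rule span_minimal[OF _ subspace_H_right])
    moreover have "w \<in> span (insert a A)"
      unfolding w_def using w0 sub a'_in by (intro span_add span_scale) auto
    ultimately show ?thesis by blast
  qed
qed

lemma orthogonal_projection:
  assumes "subspace W"
  shows "\<exists>w\<in>W. \<forall>u\<in>W. H (x - w) u = 0"
  using orthogonal_projection_span subspace_finite_span[OF assms] by metis

section \<open>Radicals of subalgebras stable under the conjugation\<close>

definition stable :: "'g set \<Rightarrow> bool" where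
  "stable L \<longleftrightarrow> lie_subalgebra L \<and> (\<forall>x\<in>L. \<tau> x \<in> L)"

text \<open>Moving \<open>ad x\<close> across \<open>H\<close> leaves the bracket of
  \<open>\<tau> x\<close> with a central element, and \<open>\<tau> x\<close> is again in
  \<open>L\<close>.\<close>

lemma orthogonal_center_commutator:
  assumes "stable L" "z \<in> center L" "d \<in> commutator L L"
  shows "H d z = 0"
proof -
  have "commutator L L \<subseteq> {d. H d z = 0}"
  proof (rule commutator_least[OF subspace_H_left])
    fix x y assume "x \<in> L" "y \<in> L"
    then have "br (\<tau> x) z = 0"
      using assms br_anti[of "\<tau> x" z] by (auto simp: center_def stable_def)
    then show "br x y \<in> {d. H d z = 0}" by (simp add: H_br)
  qed
  then show ?thesis using assms(3) by blast
qed

lemma center_commutator_trivial: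
  "stable L \<Longrightarrow> z \<in> center L \<Longrightarrow> z \<in> commutator L L \<Longrightarrow> z = 0"
  using orthogonal_center_commutator[of L z z] by simp

text \<open>The adjoint of \<open>ad x\<close> is \<open>- ad (\<tau> x)\<close>, so \<open>[x, \<tau> x] = 0\<close> makes \<open>ad x\<close> normal.\<close>

lemma normal_norm:
  assumes "br x (\<tau> x) = 0"
  shows "H (br x y) (br x y) = H (br (\<tau> x) y) (br (\<tau> x) y)"
proof -
  have "br (\<tau> x) (br x y) = br x (br (\<tau> x) y)"
    using br_br[of x "\<tau> x" y] assms by simp
  then show ?thesis by (simp add: H_br)
qed

text \<open>A normal operator and its adjoint have the same kernel, so [x, y] is also killed by the
  adjoint of \<open>ad x\<close>; pairing with \<open>y\<close> gives the norm of [x, y].\<close>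

lemma normal_square_zero:
  assumes "br x (\<tau> x) = 0" "br x (br x y) = 0"
  shows "br x y = 0"
proof -
  have "br (\<tau> x) (br x y) = 0"
    using normal_norm[OF assms(1), of "br x y"] assms(2) by simp
  then have "H (br x y) (br x y) = 0" by (simp add: H_br[of x y "br x y"])
  then show ?thesis by simp
qed

lemma normal_nilpotent:
  assumes "br x (\<tau> x) = 0" "(br x ^^ m) y = 0"
  shows "br x y = 0"
  using assms(2)
proof (induction m)
  case 0
  then show ?case by simp
next
  case (Suc m)
  show ?case
  proof (cases m)
    case 0
    then show ?thesis using Suc.prems by simp
  next
    case (Suc k)
    then have "br x (br x ((br x ^^ k) y)) = 0" using Suc.prems by simp
    then have "br x ((br x ^^ k) y) = 0" by (rule normal_square_zero[OF assms(1)])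
    then show ?thesis using Suc.IH Suc by simp
  qed
qed

text \<open>The element \<open>u\<close> = [x, \<tau> x] commutes with \<open>x\<close>, both lying
  in the abelian ideal, and with \<open>\<tau> x\<close>, because \<open>\<tau> u\<close> is
  \<open>- u\<close>. Hence \<open>H u u = 0\<close> and \<open>ad x\<close> is normal. Its square
  vanishes on \<open>L\<close>, and then so does \<open>ad x\<close>.\<close>

lemma abelian_ideal_central:
  assumes L: "stable L" and A: "lie_ideal A L" and abelian: "\<And>x y. x \<in> A \<Longrightarrow> y \<in> A \<Longrightarrow> br x y = 0"
  shows "A \<subseteq> center L"
proof
  fix x assume x: "x \<in> A"
  then have xL: "x \<in> L" "\<tau> x \<in> L" using L A by (auto simp: lie_ideal_def stable_def)
  have ideal': "br x y \<in> A" if "y \<in> L" for y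
    using A x that br_anti[of x y] by (simp add: lie_ideal_def subspace_neg)
  define u where "u = br x (\<tau> x)"
  have "u \<in> A" unfolding u_def by (rule ideal'[OF xL(2)])
  then have "br x u = 0" using abelian x by blast
  moreover have "\<tau> u = - u" by (simp add: u_def \<tau>_br br_anti[of "\<tau> x" x])
  ultimately have "br (\<tau> x) u = 0"
    using \<tau>_br[of x u] by simp
  then have "H u u = 0" by (simp add: u_def H_br[of x "\<tau> x"])
  then have normal: "br x (\<tau> x) = 0" by (simp add: u_def)
  show "x \<in> center L" unfolding center_def
    using xL ideal' abelian[OF x] normal_square_zero[OF normal] by blast
qed

text \<open>By induction on the derived length [J, J] is central. It also lies in [L, L], which
  meets the centre only in 0, so \<open>J\<close> is abelian.\<close>

lemma solvable_ideal_central: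
  assumes L: "stable L"
  shows "lie_ideal J L \<Longrightarrow> ((\<lambda>D. commutator D D) ^^ k) J = {0} \<Longrightarrow> J \<subseteq> center L"
proof (induction k arbitrary: J)
  case 0
  then show ?case
    using subspace_0[OF center_subspace[of L]] L by (simp add: stable_def lie_subalgebra_def)
next
  case (Suc k)
  have "commutator J J \<subseteq> center L"
    using Suc.IH[OF lie_ideal_commutator[OF Suc.prems(1)]] Suc.prems(2)
    by (simp only: funpow_Suc_right o_def)
  moreover have "commutator J J \<subseteq> commutator L L"
    using Suc.prems(1) by (intro commutator_mono) (auto simp: lie_ideal_def)
  ultimately have "commutator J J \<subseteq> {0}" using center_commutator_trivial[OF L] by blast
  then have "br x y = 0" if "x \<in> J" "y \<in> J" for x y using br_in_commutator[OF that] by blast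
  then show ?case by (rule abelian_ideal_central[OF L Suc.prems(1)])
qed

lemma radical_stable:
  assumes "stable L"
  shows "radical L = center L"
proof
  have sub: "lie_subalgebra L" using assms by (simp add: stable_def)
  show "radical L \<subseteq> center L" unfolding radical_def
    using solvable_ideal_central[OF assms]
    by (intro span_minimal center_subspace[OF lie_subalgebra_subspace[OF sub]])
      (auto simp: solvable_def)
  show "center L \<subseteq> radical L" unfolding radical_def
    using center_ideal[OF sub] center_solvable by (intro subsetI span_base) blast
qed

lemma reductive_stable: "stable L \<Longrightarrow> reductive L"
  by (simp add: reductive_def radical_stable stable_def)

text \<open>The last nonzero term of the lower central series is central; unless it is
  \<open>L\<close> itself, it lies in [L, L] too and must vanish. This turns the nilpotency in the
  definition of a Cartan subalgebra into commutativity.\<close>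

lemma stable_nilpotent_abelian:
  assumes L: "stable L" and nil: "nilpotent L" and xy: "x \<in> L" "y \<in> L"
  shows "br x y = 0"
proof -
  define C where "C k = ((\<lambda>C. commutator L C) ^^ k) L" for k
  have C_Suc: "C (Suc k) = commutator L (C k)" for k by (simp add: C_def)
  have sub: "lie_subalgebra L" using L by (simp add: stable_def)
  have C0: "C k \<subseteq> L" for k
  proof (induction k)
    case (Suc k)
    then show ?case unfolding C_Suc
      using sub by (intro commutator_least) (auto simp: lie_subalgebra_def)
  qed (simp add: C_def)
  obtain m where m: "C m = {0}" using nil unfolding nilpotent_def C_def by blast
  have "C 1 = {0}"
  proof (rule ccontr)
    assume "C 1 \<noteq> {0}"
    define k where "k = (LEAST k. C k = {0})"
    have k: "C k = {0}" unfolding k_def by (rule LeastI[of "\<lambda>k. C k = {0}", OF m])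
    have "k \<noteq> 1" using k \<open>C 1 \<noteq> {0}\<close> by metis
    moreover have "k \<noteq> 0"
    proof
      assume "k = 0"
      then have "L = {0}" using k by (simp add: C_def)
      then have "C 1 \<subseteq> {0}" using C0[of 1] by simp
      then show False using \<open>C 1 \<noteq> {0}\<close> subspace_0[OF commutator_subspace] C_Suc[of 0] by auto
    qed
    ultimately obtain j where j: "k = Suc (Suc j)" by (metis One_nat_def not0_implies_Suc)
    have "C (Suc j) \<subseteq> center L"
    proof
      fix z assume z: "z \<in> C (Suc j)"
      have "br w z = 0" if "w \<in> L" for w
        using br_in_commutator[OF that z] k j C_Suc by auto
      then show "z \<in> center L" using z C0[of "Suc j"] br_anti[of _ z] unfolding center_def by force
    qed
    moreover have "C (Suc j) \<subseteq> commutator L L"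
      unfolding C_Suc by (rule commutator_mono[OF subset_refl C0])
    ultimately have "C (Suc j) \<subseteq> {0}" using center_commutator_trivial[OF L] by blast
    then have "C (Suc j) = {0}" using subspace_0[OF commutator_subspace] unfolding C_Suc by blast
    then show False using not_less_Least[of "Suc j" "\<lambda>k. C k = {0}"] j k_def by simp
  qed
  then show ?thesis using br_in_commutator[OF xy] by (simp add: C_def)
qed

end

section \<open>Weights of a self-centralising abelian subalgebra\<close>

locale self_centralizing = hermitian_lie_algebra scale br \<tau> H
  for scale :: "complex \<Rightarrow> 'g::ab_group_add \<Rightarrow> 'g" and br \<tau> H +
  fixes h :: "'g set"
  assumes h_subspace: "subspace h"
    and h_\<tau>: "x \<in> h \<Longrightarrow> \<tau> x \<in> h"
    and h_abelian: "x \<in> h \<Longrightarrow> y \<in> h \<Longrightarrow> br x y = 0"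
    and h_centralizer: "(\<And>x. x \<in> h \<Longrightarrow> br x z = 0) \<Longrightarrow> z \<in> h"
begin

definition invariant :: "'g set \<Rightarrow> bool" where
  "invariant W \<longleftrightarrow> subspace W \<and> (\<forall>x\<in>h. \<forall>w\<in>W. br x w \<in> W)"

text \<open>By Riesz representation the weights are identified with elements of \<open>h\<close>.\<close>

definition weight :: "'g \<Rightarrow> 'g \<Rightarrow> bool" where
  "weight a w \<longleftrightarrow> a \<in> h \<and> (\<forall>x\<in>h. br x w = scale (H x a) w)"

text \<open>The representing vector is explicit: up to the factor \<open>- 1 / H w w\<close> it is
  [w, \<tau> w]. Since \<open>w\<close> and \<open>\<tau> w\<close> have opposite eigenvalues, this
  bracket commutes with \<open>h\<close> and therefore belongs to \<open>h\<close>.\<close>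

lemma weight_if_eigenvector:
  assumes l: "\<And>x. x \<in> h \<Longrightarrow> br x w = scale (l x) w" and "w \<noteq> 0"
  shows "\<exists>a. weight a w"
proof -
  define N where "N = H w w"
  have N: "N \<noteq> 0" "cnj N = N" using \<open>w \<noteq> 0\<close> H_commute[of w w] by (auto simp: N_def)
  have l\<tau>: "cnj (l (\<tau> x)) = - l x" if "x \<in> h" for x
  proof -
    have "l x * N = H (br x w) w" using l[OF that] by (simp add: N_def H_scale_left)
    also have "\<dots> = - H w (br (\<tau> x) w)" by (rule H_br)
    also have "br (\<tau> x) w = scale (l (\<tau> x)) w" by (rule l[OF h_\<tau>[OF that]])
    finally have "(cnj (l (\<tau> x)) + l x) * N = 0" by (simp add: N_def H_scale_right algebra_simps)
    then show ?thesis using N(1) by (simp add: eq_neg_iff_add_eq_0)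
  qed
  have br\<tau>: "br x (\<tau> w) = scale (- l x) (\<tau> w)" if "x \<in> h" for x
    using \<tau>_br[of "\<tau> x" w] l[OF h_\<tau>[OF that]] l\<tau>[OF that] by (simp add: \<tau>_scale)
  define a where "a = scale (- 1 / N) (br w (\<tau> w))"
  have "br x a = 0" if "x \<in> h" for x
  proof -
    have "br x (br w (\<tau> w)) = br (br x w) (\<tau> w) + br w (br x (\<tau> w))"
      using br_br[of x w "\<tau> w"] by simp
    also have "\<dots> = 0" using that by (simp add: l br\<tau> br_scale_left br_scale_right)
    finally show ?thesis by (simp add: a_def br_scale_right)
  qed
  then have ah: "a \<in> h" by (rule h_centralizer)
  moreover have "H x a = l x" if "x \<in> h" for x
  proof -
    have "H x (br w (\<tau> w)) = H (br x (\<tau> w)) (\<tau> w)"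
      by (simp add: H_br_right br_anti[of x "\<tau> w"])
    also have "\<dots> = - l x * N"
      using br\<tau>[OF that] N(2) by (simp add: H_scale_left H_\<tau> N_def)
    finally show ?thesis using N by (simp add: a_def H_scale_right)
  qed
  ultimately show ?thesis unfolding weight_def using l by auto
qed

lemma invariant_subspace: "invariant W \<Longrightarrow> subspace W"
  by (simp add: invariant_def)

text \<open>If all of \<open>h\<close> acts on \<open>W\<close> by scalars, every vector qualifies.
  Otherwise some element of \<open>h\<close> has a proper nonzero eigenspace in \<open>W\<close>,
  which is invariant because \<open>h\<close> is abelian and has smaller dimension.\<close>

lemma exists_weight_vector:
  "invariant W \<Longrightarrow> W \<noteq> {0} \<Longrightarrow> \<exists>w\<in>W. w \<noteq> 0 \<and> (\<exists>a. weight a w)"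
proof (induction "dim W" arbitrary: W rule: less_induct)
  case less
  note W = invariant_subspace[OF less.prems(1)]
  show ?case
  proof (cases "\<forall>x\<in>h. \<exists>c. \<forall>w\<in>W. br x w = scale c w")
    case True
    then obtain l where l: "\<And>x w. x \<in> h \<Longrightarrow> w \<in> W \<Longrightarrow> br x w = scale (l x) w" by metis
    obtain w where "w \<in> W" "w \<noteq> 0" using less.prems(2) subspace_0[OF W] by blast
    then show ?thesis using weight_if_eigenvector[of w l] l by blast
  next
    case False
    then obtain x where x: "x \<in> h" "\<And>c. \<exists>w\<in>W. br x w \<noteq> scale c w" by blast
    obtain w c where w: "w \<in> W" "w \<noteq> 0" "br x w = scale c w"
      using exists_eigenvector[OF W less.prems(2) linear_map_on_br[of W x]] less.prems(1) x(1)
      unfolding invariant_def by blast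
    define W' where "W' = {w\<in>W. br x w = scale c w}"
    have sW': "subspace W'" unfolding W'_def using W
      by (intro subspaceI) (auto simp: subspace_0 subspace_add subspace_scale br_add_right
          br_scale_right scale_right_distrib mult.commute)
    have "br y w \<in> W'" if "y \<in> h" "w \<in> W'" for y w
    proof -
      have "br x (br y w) = br y (br x w)"
        using br_br[of x y w] h_abelian[OF x(1) that(1)] by simp
      then show ?thesis using that less.prems(1) by (auto simp: W'_def invariant_def br_scale_right)
    qed
    then have "invariant W'" using sW' by (simp add: invariant_def)
    moreover have "dim W' < dim W"
    proof (rule dim_psubset)
      have "W' \<subset> W" using x(2)[of c] by (auto simp: W'_def)
      then show "span W' \<subset> span W" using W sW' by (simp add: span_eq_iff[THEN iffD2])
    qed
    moreover have "W' \<noteq> {0}" using w by (auto simp: W'_def)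
    ultimately obtain w' where "w' \<in> W'" "w' \<noteq> 0" "\<exists>a. weight a w'" using less.hyps by blast
    then show ?thesis by (auto simp: W'_def)
  qed
qed

text \<open>The orthogonal complement of the span in \<open>W\<close> is invariant, since
  \<open>h\<close> is \<open>\<tau>\<close>-stable. If it were nonzero it would contain a weight
  vector, which would be orthogonal to itself.\<close>

lemma span_weight_vectors:
  assumes "invariant W"
  shows "span {w\<in>W. \<exists>a. weight a w} = W"
proof
  let ?E = "span {w\<in>W. \<exists>a. weight a w}"
  note W = invariant_subspace[OF assms]
  show EW: "?E \<subseteq> W" by (rule span_minimal[OF _ W]) auto
  have E_inv: "br x u \<in> ?E" if x: "x \<in> h" and "u \<in> ?E" for x u
  proof -
    have "{w\<in>W. \<exists>a. weight a w} \<subseteq> {u. br x u \<in> ?E}"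
    proof
      fix w assume w: "w \<in> {w\<in>W. \<exists>a. weight a w}"
      then obtain a where "weight a w" by blast
      then have "br x w = scale (H x a) w" using x by (simp add: weight_def)
      then show "w \<in> {u. br x u \<in> ?E}" using span_scale[OF span_base[OF w]] by simp
    qed
    then have "?E \<subseteq> {u. br x u \<in> ?E}"
      by (rule span_minimal[OF _ subspace_br_preimage[OF subspace_span]])
    then show ?thesis using that by blast
  qed
  define P where "P = {x\<in>W. \<forall>u\<in>?E. H x u = 0}"
  have "subspace P" unfolding P_def
    by (rule subspaceI) (auto simp: subspace_0[OF W] subspace_add[OF W] subspace_scale[OF W]
        H_add_left H_scale_left)
  moreover have "br x p \<in> P" if "x \<in> h" "p \<in> P" for x p
    using that assms E_inv[OF h_\<tau>] by (auto simp: P_def invariant_def H_br)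
  ultimately have P: "invariant P" by (simp add: invariant_def)
  have "P = {0}"
  proof (rule ccontr)
    assume "P \<noteq> {0}"
    then obtain w a where w: "w \<in> P" "w \<noteq> 0" "weight a w" using exists_weight_vector[OF P] by blast
    then have "w \<in> ?E" by (intro span_base) (auto simp: P_def)
    then have "H w w = 0" using w by (auto simp: P_def)
    then show False using w by simp
  qed
  show "W \<subseteq> ?E"
  proof
    fix x assume x: "x \<in> W"
    obtain w where w: "w \<in> ?E" "\<forall>u\<in>?E. H (x - w) u = 0"
      using orthogonal_projection[OF subspace_span] by blast
    then have "x - w \<in> P" using x EW subspace_diff[OF W] by (auto simp: P_def)
    then show "x \<in> ?E" using w \<open>P = {0}\<close> by simp
  qed
qed

section \<open>Relations between weight vectors\<close>

lemma weight_zero: "weight 0 w \<longleftrightarrow> w \<in> h"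
  unfolding weight_def using h_centralizer[of w] h_abelian subspace_0[OF h_subspace] by auto

lemma weight_H_\<tau>:
  assumes "weight a w" "w \<noteq> 0" "x \<in> h"
  shows "cnj (H (\<tau> x) a) = - H x a"
proof -
  have "H x a * H w w = H (br x w) w" using assms by (simp add: weight_def H_scale_left)
  also have "\<dots> = - H w (br (\<tau> x) w)" by (rule H_br)
  also have "br (\<tau> x) w = scale (H (\<tau> x) a) w"
    using assms h_\<tau>[OF assms(3)] by (simp add: weight_def)
  finally have "(cnj (H (\<tau> x) a) + H x a) * H w w = 0" by (simp add: H_scale_right algebra_simps)
  then show ?thesis using assms(2) by (simp add: eq_neg_iff_add_eq_0)
qed

lemma weight_\<tau>:
  assumes "weight a w"
  shows "weight (- a) (\<tau> w)"
proof (cases "w = 0")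
  case True
  then show ?thesis using assms subspace_neg[OF h_subspace] by (simp add: weight_def)
next
  case False
  have "br x (\<tau> w) = scale (H x (- a)) (\<tau> w)" if "x \<in> h" for x
    using \<tau>_br[of "\<tau> x" w] assms weight_H_\<tau>[OF assms False that] h_\<tau>[OF that]
    by (simp add: weight_def \<tau>_scale)
  then show ?thesis using assms subspace_neg[OF h_subspace] by (simp add: weight_def)
qed

lemma weight_br:
  assumes "weight a w" "weight b x"
  shows "weight (a + b) (br w x)"
proof -
  have "br y (br w x) = scale (H y (a + b)) (br w x)" if "y \<in> h" for y
  proof -
    have "br y (br w x) = br (br y w) x + br w (br y x)" using br_br[of y w x] by simp
    then show ?thesis using assms that
      by (simp add: weight_def br_scale_left br_scale_right H_add_right scale_left_distrib)
  qed
  then show ?thesis using assms subspace_add[OF h_subspace] by (simp add: weight_def)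
qed

text \<open>The element of \<open>h\<close> that separates the weights is \<open>a - b\<close>
  itself: its eigenvalues on \<open>w\<close> and \<open>x\<close> differ by
  \<open>H (a - b) (a - b)\<close>.\<close>

lemma weight_orthogonal:
  assumes w: "weight a w" and x: "weight b x" and "a \<noteq> b"
  shows "H w x = 0"
proof (cases "x = 0")
  case False
  have y: "a - b \<in> h" using w x subspace_diff[OF h_subspace] by (simp add: weight_def)
  have "H (a - b) a * H w x = H (br (a - b) w) x"
    using w y by (simp add: weight_def H_scale_left)
  also have "\<dots> = H (a - b) b * H w x"
    using x h_\<tau>[OF y] weight_H_\<tau>[OF x False y] by (simp add: weight_def H_br H_scale_right)
  finally have "H (a - b) (a - b) * H w x = 0" by (simp add: H_diff_right left_diff_distrib)
  then show ?thesis using \<open>a \<noteq> b\<close> by simp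
qed simp

lemma weight_unique: "weight a w \<Longrightarrow> weight b w \<Longrightarrow> w \<noteq> 0 \<Longrightarrow> a = b"
  using weight_orthogonal[of a w b w] by fastforce

text \<open>The bracket has weight 0, so it lies in \<open>h\<close>, where it is determined by its
  products with the elements of \<open>h\<close>. This is the relation that yields the coroot in the
  usual theory.\<close>

lemma br_\<tau>_weight:
  assumes "weight a w"
  shows "br w (\<tau> w) = scale (- H w w) a"
proof -
  let ?d = "br w (\<tau> w) + scale (H w w) a"
  have ah: "a \<in> h" using assms by (simp add: weight_def)
  have "weight (a + - a) (br w (\<tau> w))" by (rule weight_br[OF assms weight_\<tau>[OF assms]])
  then have "br w (\<tau> w) \<in> h" by (simp add: weight_zero)
  then have dh: "?d \<in> h" using ah h_subspace by (intro subspace_add subspace_scale)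
  have "H x ?d = 0" if "x \<in> h" for x
  proof -
    have "H x (br w (\<tau> w)) = H (br x (\<tau> w)) (\<tau> w)"
      by (simp add: H_br_right br_anti[of x "\<tau> w"])
    also have "\<dots> = - H x a * cnj (H w w)"
      using weight_\<tau>[OF assms] that by (simp add: weight_def H_scale_left H_\<tau>)
    finally show ?thesis by (simp add: H_add_right H_scale_right)
  qed
  then have "?d = 0" using dh H_eq_0_iff by blast
  then show ?thesis by (simp add: eq_neg_iff_add_eq_0)
qed

text \<open>Evaluates [[e, \<tau> e], x] once by the formula for [e, \<tau> e] and once by the
  Jacobi identity, and pairs the result with \<open>x\<close>.\<close>

lemma weight_norm_identity:
  assumes e: "weight a e" and x: "weight b x"
  shows "H (br e x) (br e x) = H (br (\<tau> e) x) (br (\<tau> e) x) - H e e * cnj (H a b) * H x x"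
proof -
  have "a \<in> h" using e by (simp add: weight_def)
  then have "br a x = scale (H a b) x" using x by (simp add: weight_def)
  then have "br (br e (\<tau> e)) x = scale (- H e e * H a b) x"
    unfolding br_\<tau>_weight[OF e] by (simp add: br_scale_left)
  then have "br e (br (\<tau> e) x) - br (\<tau> e) (br e x) = scale (- H e e * H a b) x"
    by (simp add: br_br)
  then have "H x (br e (br (\<tau> e) x)) - H x (br (\<tau> e) (br e x)) = cnj (- H e e * H a b) * H x x"
    by (metis H_diff_right H_scale_right)
  moreover have "cnj (H e e) = H e e" using H_commute[of e e] by simp
  ultimately show ?thesis by (simp add: H_br algebra_simps)
qed

text \<open>If [e, x] vanished, the norm identity would give [\<tau> e, x] a negative squared
  norm.\<close>

lemma weight_br_nonzero:
  assumes e: "weight a e" "e \<noteq> 0" and x: "weight b x" "x \<noteq> 0" and neg: "Re (H a b) < 0"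
  shows "br e x \<noteq> 0"
proof
  assume "br e x = 0"
  then have eq: "H (br (\<tau> e) x) (br (\<tau> e) x) = H e e * cnj (H a b) * H x x"
    using weight_norm_identity[OF e(1) x(1)] by simp
  obtain p r where pr: "H e e = of_real p" "H x x = of_real r" using H_self_real by blast
  have "Re (H (br (\<tau> e) x) (br (\<tau> e) x)) = p * Re (H a b) * r" unfolding eq pr by simp
  moreover have "p * Re (H a b) * r < 0"
    using H_pos[OF e(2)] H_pos[OF x(2)] neg pr by (simp add: mult_pos_neg mult_neg_pos)
  ultimately show False using H_self_nonneg[of "br (\<tau> e) x"] by linarith
qed

text \<open>Let \<open>y\<close> be the part of \<open>x\<close> orthogonal to \<open>e\<close>. The
  bracket [\<tau> e, y] lies in \<open>h\<close> and acts on \<open>e\<close> by a scalar, so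
  orthogonality of \<open>y\<close> and \<open>e\<close> makes its norm 0. The norm identity then
  gives [e, y] a negative squared norm unless \<open>y\<close> is 0.\<close>

lemma weight_space_one_dimensional:
  assumes e: "weight a e" "e \<noteq> 0" and x: "weight a x" and "a \<noteq> 0"
  shows "\<exists>c. x = scale c e"
proof -
  define y where "y = x - scale (H x e / H e e) e"
  have y: "weight a y" using e(1) x
    by (simp add: weight_def y_def br_diff_right br_scale_right scale_right_diff_distrib mult.commute)
  have ye: "H y e = 0" using e(2) by (simp add: y_def H_diff_left H_scale_left)
  have "weight (- a + a) (br (\<tau> e) y)" by (rule weight_br[OF weight_\<tau>[OF e(1)] y])
  then have t: "br (\<tau> e) y \<in> h" by (simp add: weight_zero)
  have "H (br (\<tau> e) y) (br (\<tau> e) y) = H y (br (br (\<tau> e) y) e)"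
    by (simp add: H_br[of "\<tau> e" y] br_anti[of e "br (\<tau> e) y"])
  also have "\<dots> = 0" using e(1) t ye by (simp add: weight_def H_scale_right)
  finally have eq: "H (br e y) (br e y) = - (H e e * cnj (H a a) * H y y)"
    using weight_norm_identity[OF e(1) y] by simp
  obtain p q r where pqr: "H e e = of_real p" "H a a = of_real q" "H y y = of_real r"
    using H_self_real by blast
  have "Re (H (br e y) (br e y)) = - (p * q * r)" unfolding eq pqr by simp
  then have le: "p * q * r \<le> 0" using H_self_nonneg[of "br e y"] by linarith
  have "y = 0"
  proof (rule ccontr)
    assume "y \<noteq> 0"
    then have "p > 0" "q > 0" "r > 0"
      using H_pos[OF e(2)] H_pos[OF \<open>a \<noteq> 0\<close>] H_pos[of y] pqr by simp_all
    then have "p * q * r > 0" by simp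
    then show False using le by simp
  qed
  then show ?thesis by (auto simp: y_def)
qed

definition weights :: "'g set \<Rightarrow> 'g set" where
  "weights W = {a. \<exists>w\<in>W. w \<noteq> 0 \<and> weight a w}"

text \<open>Weight vectors chosen for different weights are orthogonal, hence independent.\<close>

lemma finite_weights: "finite (weights W)"
proof -
  have "\<forall>a\<in>weights W. \<exists>w. w \<noteq> 0 \<and> weight a w" by (auto simp: weights_def)
  from bchoice[OF this] obtain w where w: "\<And>a. a \<in> weights W \<Longrightarrow> w a \<noteq> 0 \<and> weight a (w a)"
    by blast
  have inj: "inj_on w (weights W)"
  proof (rule inj_onI)
    fix a b assume "a \<in> weights W" "b \<in> weights W" "w a = w b"
    then show "a = b" using w[of a] w[of b] weight_unique[of a "w a" b] by simp
  qed
  have "independent (w ` weights W)"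
    unfolding independent_explicit_finite_subsets
  proof (intro allI impI ballI)
    fix S u v assume S: "S \<subseteq> w ` weights W" "finite S" "(\<Sum>v\<in>S. scale (u v) v) = 0" "v \<in> S"
    obtain a where a: "a \<in> weights W" "v = w a" using S by blast
    have "H z v = 0" if z: "z \<in> S - {v}" for z
    proof -
      obtain b where b: "b \<in> weights W" "z = w b" using z S by blast
      then have "b \<noteq> a" using z a by auto
      then show ?thesis using weight_orthogonal[of b "w b" a "w a"] w a b by auto
    qed
    then have "(\<Sum>z\<in>S. u z * H z v) = (\<Sum>z\<in>{v}. u z * H z v)"
      using S by (intro sum.mono_neutral_right) auto
    moreover have "H (\<Sum>z\<in>S. scale (u z) z) v = (\<Sum>z\<in>S. u z * H z v)"
      by (simp add: H_sum_left H_scale_left)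
    ultimately have "u v * H v v = 0" using S(3) by simp
    then show "u v = 0" using w[OF a(1)] a by simp
  qed
  then have "finite (w ` weights W)" by (rule finiteI_independent)
  then show ?thesis by (rule finite_imageD[OF _ inj])
qed

lemma invariant_subalgebra: "lie_subalgebra q \<Longrightarrow> h \<subseteq> q \<Longrightarrow> invariant q"
  by (auto simp: invariant_def lie_subalgebra_def)

text \<open>The normaliser of \<open>f\<close> is \<open>h\<close>-invariant, so it is spanned by
  weight vectors. For such a \<open>w\<close> of weight \<open>a \<noteq> 0\<close>, bracketing with
  the element \<open>a\<close> of \<open>h\<close> multiplies \<open>w\<close> by a nonzero scalar
  and at the same time lands in \<open>f\<close>.\<close>

lemma self_normalizing:
  assumes f: "lie_subalgebra f" "h \<subseteq> f" and z: "\<And>y. y \<in> f \<Longrightarrow> br z y \<in> f"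
  shows "z \<in> f"
proof -
  define N where "N = {z. \<forall>y\<in>f. br z y \<in> f}"
  note sf = lie_subalgebra_subspace[OF f(1)]
  have "subspace N" unfolding N_def
    by (rule subspaceI) (auto simp: br_add_left br_scale_left subspace_0[OF sf]
        subspace_add[OF sf] subspace_scale[OF sf])
  moreover have "br x z \<in> N" if "x \<in> h" "z \<in> N" for x z
  proof -
    have "br (br x z) y \<in> f" if "y \<in> f" for y
      unfolding br_br using f \<open>x \<in> h\<close> \<open>z \<in> N\<close> that
      by (intro subspace_diff[OF sf]) (auto simp: N_def lie_subalgebra_def)
    then show ?thesis by (simp add: N_def)
  qed
  ultimately have N: "invariant N" by (simp add: invariant_def)
  have "{w\<in>N. \<exists>a. weight a w} \<subseteq> f"
  proof clarify
    fix w a assume w: "w \<in> N" "weight a w"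
    show "w \<in> f"
    proof (cases "a = 0")
      case True
      then show ?thesis using w f by (auto simp: weight_zero)
    next
      case False
      have a: "a \<in> h" "br a w = scale (H a a) w" using w(2) by (auto simp: weight_def)
      then have "br w a \<in> f" using w(1) f(2) by (auto simp: N_def)
      then have "scale (- H a a) w \<in> f" using a(2) br_anti[of w a] by simp
      then have "scale (1 / - H a a) (scale (- H a a) w) \<in> f" by (rule subspace_scale[OF sf])
      then show ?thesis using False by simp
    qed
  qed
  then have "N \<subseteq> f" using span_minimal[OF _ sf] span_weight_vectors[OF N] by blast
  then show ?thesis using z by (auto simp: N_def)
qed

section \<open>The nilpotent ideal and its complement in a subalgebra containing
  \<open>h\<close>\<close>

text \<open>When \<open>H\<close> comes from the Killing form, \<open>H x (\<tau> y)\<close> is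
  \<open>- B x y\<close>, so this is the radical of the Killing form restricted to \<open>q\<close>.
  For a parabolic subalgebra of a semisimple algebra this is the usual nilradical.\<close>

definition nilpart :: "'g set \<Rightarrow> 'g set" where
  "nilpart q = {x\<in>q. \<forall>y\<in>q. H x (\<tau> y) = 0}"

definition levi :: "'g set \<Rightarrow> 'g set" where
  "levi q = {x\<in>q. \<tau> x \<in> q}"

lemma nilpart_subspace: "subspace q \<Longrightarrow> subspace (nilpart q)"
  unfolding nilpart_def
  by (rule subspaceI) (auto simp: subspace_0 subspace_add subspace_scale H_add_left H_scale_left)

lemma levi_subspace: "subspace q \<Longrightarrow> subspace (levi q)"
  unfolding levi_def
  by (rule subspaceI) (auto simp: subspace_0 subspace_add subspace_scale \<tau>_add \<tau>_scale)

lemma nilpart_ideal: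
  assumes "lie_subalgebra q" "x \<in> q" "y \<in> nilpart q"
  shows "br x y \<in> nilpart q"
proof -
  have "H (br x y) (\<tau> z) = 0" if "z \<in> q" for z
  proof -
    have "br x z \<in> q" using assms that by (simp add: lie_subalgebra_def)
    then have "H y (\<tau> (br x z)) = 0" using assms(3) by (simp add: nilpart_def)
    then show ?thesis by (simp add: H_br \<tau>_br)
  qed
  then show ?thesis using assms by (simp add: nilpart_def lie_subalgebra_def)
qed

lemma stable_levi: "lie_subalgebra q \<Longrightarrow> stable (levi q)"
  using levi_subspace[of q]
  by (auto simp: stable_def lie_subalgebra_def levi_def \<tau>_br)

lemma nilpart_levi_trivial: "x \<in> nilpart q \<Longrightarrow> x \<in> levi q \<Longrightarrow> x = 0"
  using H_eq_0_iff[of x] by (force simp: levi_def nilpart_def)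

text \<open>Every weight vector \<open>w\<close> of \<open>q\<close> falls into one of the summands.
  If \<open>\<tau> w\<close> is not in \<open>q\<close>, then \<open>q\<close> has no nonzero vector
  of the weight opposite to that of \<open>w\<close>: weight spaces are one-dimensional, and a
  multiple of that vector would be \<open>\<tau> w\<close>. So \<open>w\<close> is orthogonal to the
  conjugate of \<open>q\<close>.\<close>

lemma nilpart_levi_decomposition:
  assumes q: "lie_subalgebra q" "h \<subseteq> q" and x: "x \<in> q"
  shows "\<exists>a\<in>nilpart q. \<exists>b\<in>levi q. x = a + b"
proof -
  note sq = lie_subalgebra_subspace[OF q(1)]
  let ?S = "{a + b | a b. a \<in> nilpart q \<and> b \<in> levi q}"
  have sS: "subspace ?S" by (rule subspace_sums[OF nilpart_subspace[OF sq] levi_subspace[OF sq]])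
  have inS: "w \<in> ?S" if "w \<in> levi q" for w
    using that subspace_0[OF nilpart_subspace[OF sq]] by force
  have inS': "w \<in> ?S" if "w \<in> nilpart q" for w
    using that subspace_0[OF levi_subspace[OF sq]] by force
  have inv: "invariant q" by (rule invariant_subalgebra[OF q])
  have "{w\<in>q. \<exists>a. weight a w} \<subseteq> ?S"
  proof (rule subsetI, clarsimp simp del: ex_simps)
    fix w a assume w: "w \<in> q" "weight a w"
    show "\<exists>a b. w = a + b \<and> a \<in> nilpart q \<and> b \<in> levi q"
    proof (cases "\<tau> w \<in> q")
      case True
      then show ?thesis using inS[of w] w by (simp add: levi_def)
    next
      case False
      have "a \<noteq> 0"
      proof
        assume "a = 0"
        then have "\<tau> w \<in> h" using w(2) h_\<tau> weight_zero by blast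
        then show False using False q(2) by blast
      qed
      have "w \<noteq> 0" using False subspace_0[OF sq] by auto
      have "{y\<in>q. \<exists>b. weight b y} \<subseteq> {y. H w (\<tau> y) = 0}"
      proof clarify
        fix y b assume y: "y \<in> q" "weight b y"
        show "H w (\<tau> y) = 0"
        proof (cases "a = - b")
          case False
          then show ?thesis using weight_orthogonal[OF w(2) weight_\<tau>[OF y(2)]] by simp
        next
          case True
          obtain c where c: "\<tau> y = scale c w"
            using weight_space_one_dimensional[of a w "\<tau> y"] weight_\<tau>[OF y(2)] True w
              \<open>a \<noteq> 0\<close> \<open>w \<noteq> 0\<close> by auto
          have "c = 0"
          proof (rule ccontr)
            assume "c \<noteq> 0"
            have "y = scale (cnj c) (\<tau> w)" using arg_cong[OF c, of \<tau>] by (simp add: \<tau>_scale)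
            then have "\<tau> w = scale (1 / cnj c) y" using \<open>c \<noteq> 0\<close> by simp
            then show False using \<open>\<tau> w \<notin> q\<close> subspace_scale[OF sq y(1), of "1 / cnj c"] by simp
          qed
          then show ?thesis using c by simp
        qed
      qed
      moreover have "subspace {y. H w (\<tau> y) = 0}"
        by (rule subspaceI) (auto simp: \<tau>_add \<tau>_scale H_add_right H_scale_right)
      ultimately have "span {y\<in>q. \<exists>b. weight b y} \<subseteq> {y. H w (\<tau> y) = 0}"
        by (rule span_minimal)
      then have "q \<subseteq> {y. H w (\<tau> y) = 0}" unfolding span_weight_vectors[OF inv] .
      then have "w \<in> nilpart q" using w by (auto simp: nilpart_def)
      then show ?thesis using inS' by simp
    qed
  qed
  then have "span {w\<in>q. \<exists>a. weight a w} \<subseteq> ?S" by (rule span_minimal[OF _ sS])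
  then have "q \<subseteq> ?S" unfolding span_weight_vectors[OF inv] .
  then show ?thesis using x by blast
qed

text \<open>
  Closure of \<open>S\<close> under sums of vectors at an obtuse angle rules out a vanishing sum: in a shortest
  one, some summand would be at an obtuse angle to the first.
\<close>

lemma sum_list_nonzero:
  assumes S: "0 \<notin> S" "\<And>a b. a \<in> S \<Longrightarrow> b \<in> S \<Longrightarrow> Re (H b a) < 0 \<Longrightarrow> a + b \<in> S"
  shows "xs \<noteq> [] \<Longrightarrow> set xs \<subseteq> S \<Longrightarrow> sum_list xs \<noteq> 0"
proof (induction "length xs" arbitrary: xs rule: less_induct)
  case less
  show ?case
  proof
    assume sum0: "sum_list xs = 0"
    obtain a ys where xs: "xs = a # ys" using less.prems(1) by (cases xs) auto
    have "a \<noteq> 0" using S(1) less.prems xs by auto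
    have Hsum: "H (sum_list zs) a = (\<Sum>y\<leftarrow>zs. H y a)" for zs
      by (induction zs) (auto simp: H_add_left)
    have "Re (\<Sum>y\<leftarrow>ys. H y a) \<ge> 0" if "\<And>y. y \<in> set ys \<Longrightarrow> Re (H y a) \<ge> 0"
      using that by (induction ys) auto
    moreover have "H a a + (\<Sum>y\<leftarrow>ys. H y a) = 0" using sum0 Hsum[of xs] xs by simp
    then have "Re (H a a) + Re (\<Sum>y\<leftarrow>ys. H y a) = 0"
      unfolding plus_complex.simps(1)[symmetric] by simp
    then have "Re (\<Sum>y\<leftarrow>ys. H y a) < 0" using H_pos[OF \<open>a \<noteq> 0\<close>] by linarith
    ultimately obtain y where y: "y \<in> set ys" "Re (H y a) < 0"
      by fastforce
    have ayS: "a + y \<in> S" using S(2)[of a y] y less.prems xs by auto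
    define zs where "zs = (a + y) # remove1 y ys"
    have "length zs < length xs"
      unfolding zs_def xs using y length_pos_if_in_set[OF y(1)] by (simp add: length_remove1)
    moreover have "set zs \<subseteq> S" using ayS less.prems xs set_remove1_subset[of y ys] by (auto simp: zs_def)
    moreover have "sum_list ys = y + sum_list (remove1 y ys)"
      using y(1) by (induction ys) (auto simp: algebra_simps)
    then have "sum_list zs = 0" using sum0 by (simp add: zs_def xs algebra_simps)
    ultimately show False using less.hyps[of zs] by (simp add: zs_def)
  qed
qed

text \<open>The decreasing spaces \<open>W m\<close> become stationary. A nonzero stationary space
  has a weight \<open>b\<close> that is minimal for adding weights of the nilpotent part, so a
  weight vector of weight \<open>b\<close> is orthogonal to all brackets that span the next space,
  which is the same space.\<close>

lemma nilpart_nilpotent: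
  assumes q: "lie_subalgebra q" "h \<subseteq> q"
  shows "\<exists>m. ((\<lambda>C. commutator (nilpart q) C) ^^ m) UNIV = {0}"
proof -
  note sq = lie_subalgebra_subspace[OF q(1)]
  let ?n = "nilpart q"
  define W where "W m = ((\<lambda>C. commutator ?n C) ^^ m) UNIV" for m
  have W_Suc: "W (Suc m) = commutator ?n (W m)" for m by (simp add: W_def)
  have sn: "subspace ?n" by (rule nilpart_subspace[OF sq])
  have n_inv: "invariant ?n"
    unfolding invariant_def using sn nilpart_ideal[OF q(1)] q(2) by blast
  have W_inv: "invariant (W m)" for m
  proof (induction m)
    case 0
    then show ?case by (simp add: W_def invariant_def)
  next
    case (Suc m)
    then show ?case unfolding W_Suc invariant_def
      using n_inv commutator_subspace commutator_invariant[of ?n _ "W m"] by (auto simp: invariant_def)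
  qed
  have decr: "W (Suc m) \<subseteq> W m" for m
  proof (induction m)
    case (Suc m)
    then show ?case unfolding W_Suc by (intro commutator_mono) auto
  qed (simp add: W_def)
  have "\<exists>m. W (Suc m) = W m"
  proof (rule ccontr)
    assume no: "\<nexists>m. W (Suc m) = W m"
    have "dim (W (Suc m)) < dim (W m)" for m
    proof (rule dim_psubset)
      have "W (Suc m) \<subset> W m" using decr no by blast
      then show "span (W (Suc m)) \<subset> span (W m)"
        by (simp add: invariant_subspace[OF W_inv] span_eq_iff[THEN iffD2])
    qed
    then have lt: "dim (W (Suc m)) < dim (W m)" for m by blast
    have "dim (W m) + m \<le> dim (W 0)" for m
    proof (induction m)
      case (Suc m)
      then show ?case using lt[of m] by linarith
    qed simp
    from this[of "Suc (dim (W 0))"] show False by simp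
  qed
  then obtain m where m: "W (Suc m) = W m" by blast
  have "W m = {0}"
  proof (rule ccontr)
    assume W0: "W m \<noteq> {0}"
    define S where "S = weights ?n"
    have "0 \<notin> S"
      proof
      assume "0 \<in> S"
      then obtain w where w: "w \<in> ?n" "w \<noteq> 0" "w \<in> h"
        by (auto simp: S_def weights_def weight_zero)
      then have "w \<in> levi q" using q(2) h_\<tau>[of w] by (auto simp: levi_def)
      then show False using nilpart_levi_trivial[of w q] w by blast
    qed
    moreover have "a + b \<in> S" if ab: "a \<in> S" "b \<in> S" "Re (H b a) < 0" for a b
    proof -
      obtain w x where w: "w \<in> ?n" "w \<noteq> 0" "weight a w" and x: "x \<in> ?n" "x \<noteq> 0" "weight b x"
        using ab by (auto simp: S_def weights_def)
      have "Re (H a b) < 0" using ab(3) H_commute[of a b] by simp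
      then have "br w x \<noteq> 0" by (rule weight_br_nonzero[OF w(3,2) x(3,2)])
      moreover have "br w x \<in> ?n" using nilpart_ideal[OF q(1) _ x(1)] w(1) by (simp add: nilpart_def)
      moreover have "weight (a + b) (br w x)" by (rule weight_br[OF w(3) x(3)])
      ultimately show ?thesis by (auto simp: S_def weights_def)
    qed
    ultimately have sums: "\<And>xs. xs \<noteq> [] \<Longrightarrow> set xs \<subseteq> S \<Longrightarrow> sum_list xs \<noteq> 0"
      using sum_list_nonzero[of S] by blast
    \<comment> \<open>An edge adds a weight of the nilpotent part, so a cycle would be a vanishing
      sum of such weights. Finiteness then makes the relation well-founded.\<close>
    define R where "R = {(b, b'). b \<in> weights UNIV \<and> b' \<in> weights UNIV \<and> b' - b \<in> S}"
    have R_sum: "\<exists>xs. xs \<noteq> [] \<and> set xs \<subseteq> S \<and> b' - b = sum_list xs" if "(b, b') \<in> R\<^sup>+" for b b'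
      using that
    proof (induction rule: trancl_induct)
      case (base y)
      then show ?case by (intro exI[of _ "[y - b]"]) (auto simp: R_def)
    next
      case (step y z)
      then obtain xs where "xs \<noteq> []" "set xs \<subseteq> S" "y - b = sum_list xs" by blast
      then show ?case using step by (intro exI[of _ "(z - y) # xs"]) (auto simp: R_def algebra_simps)
    qed
    have "acyclic R" unfolding acyclic_def
    proof (intro allI notI)
      fix c assume "(c, c) \<in> R\<^sup>+"
      from R_sum[OF this] obtain xs where "xs \<noteq> []" "set xs \<subseteq> S" "0 = sum_list xs" by auto
      then show False using sums[of xs] by simp
    qed
    moreover have "finite R"
      by (rule finite_subset[of _ "weights UNIV \<times> weights UNIV"]) (auto simp: R_def finite_weights)
    ultimately have "wf R" using finite_acyclic_wf by blast
    moreover have "\<exists>b. b \<in> weights (W m)"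
      using exists_weight_vector[OF W_inv W0] by (auto simp: weights_def)
    ultimately have "\<exists>b\<in>weights (W m). \<forall>c. (c, b) \<in> R \<longrightarrow> c \<notin> weights (W m)"
      unfolding wf_eq_minimal by blast
    then obtain b where b: "b \<in> weights (W m)" and min: "\<And>c. (c, b) \<in> R \<Longrightarrow> c \<notin> weights (W m)"
      by blast
    obtain w where w: "w \<in> W m" "w \<noteq> 0" "weight b w" using b by (auto simp: weights_def)
    have orth_weight: "H (br x y) w = 0"
      if x: "x \<in> ?n" "weight a x" and y: "y \<in> W m" "weight c y" for x a y c
    proof (cases "x = 0 \<or> y = 0")
      case False
      have "a + c \<noteq> b"
      proof
        assume "a + c = b"
        moreover have "a \<in> S" using x False by (auto simp: S_def weights_def)
        moreover have cW: "c \<in> weights (W m)" using y False by (auto simp: weights_def)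
        moreover have "weights (W m) \<subseteq> weights UNIV" by (auto simp: weights_def)
        ultimately have "(c, b) \<in> R" using b by (auto simp: R_def)
        then show False using min cW by blast
      qed
      then show ?thesis using weight_orthogonal[OF weight_br[OF x(2) y(2)] w(3)] by simp
    qed auto
    have orth_n: "H (br x y) w = 0" if x: "x \<in> ?n" "weight a x" and y: "y \<in> W m" for x a y
    proof -
      have "subspace {y. H (br x y) w = 0}"
        by (rule subspaceI) (auto simp: br_add_right br_scale_right H_add_left H_scale_left)
      moreover have "{y\<in>W m. \<exists>c. weight c y} \<subseteq> {y. H (br x y) w = 0}"
        using orth_weight[OF x] by blast
      ultimately have "span {y\<in>W m. \<exists>c. weight c y} \<subseteq> {y. H (br x y) w = 0}"
        by (intro span_minimal)
      then show ?thesis using y span_weight_vectors[OF W_inv] by auto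
    qed
    have "H (br x y) w = 0" if x: "x \<in> ?n" and y: "y \<in> W m" for x y
    proof -
      have "subspace {x. H (br x y) w = 0}"
        by (rule subspaceI) (auto simp: br_add_left br_scale_left H_add_left H_scale_left)
      moreover have "{x\<in>?n. \<exists>c. weight c x} \<subseteq> {x. H (br x y) w = 0}"
        using orth_n[OF _ _ y] by blast
      ultimately have "span {x\<in>?n. \<exists>c. weight c x} \<subseteq> {x. H (br x y) w = 0}"
        by (intro span_minimal)
      then show ?thesis using x span_weight_vectors[OF n_inv] by auto
    qed
    then have "W (Suc m) \<subseteq> {u. H u w = 0}"
      unfolding W_Suc by (intro commutator_least subspace_H_left) auto
    then have "H w w = 0" using w(1) m by blast
    then show False using w(2) by simp
  qed
  then show ?thesis unfolding W_def by blast
qed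

end

section \<open>The reductive complement\<close>

text \<open>\<open>nilpotent_orthogonal\<close> records a trace property of the Killing form that
  the axioms on an abstract Hermitian form do not express.\<close>

locale cartan_decomposition = self_centralizing scale br \<tau> H h
  for scale :: "complex \<Rightarrow> 'g::ab_group_add \<Rightarrow> 'g" and br \<tau> H h +
  fixes \<theta> :: "'g \<Rightarrow> 'g"
  assumes \<theta>_add: "\<theta> (x + y) = \<theta> x + \<theta> y"
    and \<theta>_scale: "\<theta> (scale c x) = scale c (\<theta> x)"
    and \<theta>_br: "\<theta> (br x y) = br (\<theta> x) (\<theta> y)"
    and \<theta>_\<theta> [simp]: "\<theta> (\<theta> x) = x"
    and \<theta>_\<tau>: "\<theta> (\<tau> x) = \<tau> (\<theta> x)"
    and H_\<theta>: "H (\<theta> x) (\<theta> y) = H x y"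
    and h_\<theta>: "x \<in> h \<Longrightarrow> \<theta> x \<in> h"
    and nilpotent_orthogonal: "(\<And>y. (br x ^^ m) y = 0) \<Longrightarrow> br x (\<tau> z) = 0 \<Longrightarrow> H x z = 0"
begin

definition \<kappa> :: "'g set" where
  "\<kappa> = {x. \<theta> x = x}"

lemma \<theta>_0 [simp]: "\<theta> 0 = 0"
  using \<theta>_scale[of 0 0] by simp

lemma stable_\<kappa>: "stable \<kappa>"
proof -
  have "subspace \<kappa>" by (rule subspaceI) (auto simp: \<kappa>_def \<theta>_add \<theta>_scale)
  then show ?thesis by (auto simp: stable_def lie_subalgebra_def \<kappa>_def \<theta>_br \<theta>_\<tau>)
qed

lemma \<kappa>_subspace: "subspace \<kappa>"
  using stable_\<kappa> by (simp add: stable_def lie_subalgebra_def)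

text \<open>The component \<open>x - d\<close> orthogonal to [\<kappa>, \<kappa>] is central in
  \<kappa>. The nilpotent \<open>x\<close> commutes with its conjugate and is therefore orthogonal
  to it, as is \<open>d\<close>; so this component is orthogonal to itself.\<close>

lemma nilpotent_in_commutator:
  assumes x: "x \<in> \<kappa>" and nil: "\<And>y. (br x ^^ m) y = 0"
  shows "x \<in> commutator \<kappa> \<kappa>"
proof -
  obtain d where d: "d \<in> commutator \<kappa> \<kappa>" "\<forall>u\<in>commutator \<kappa> \<kappa>. H (x - d) u = 0"
    using orthogonal_projection[OF commutator_subspace] by blast
  have "commutator \<kappa> \<kappa> \<subseteq> \<kappa>"
    using stable_\<kappa> by (intro commutator_least) (auto simp: stable_def lie_subalgebra_def)
  then have c\<kappa>: "x - d \<in> \<kappa>" using x d(1) subspace_diff[OF \<kappa>_subspace] by blast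
  have central: "br y (x - d) = 0" if "y \<in> \<kappa>" for y
  proof -
    have "H (br y (x - d)) z = 0" if "z \<in> \<kappa>" for z
    proof -
      have "br (\<tau> y) z \<in> commutator \<kappa> \<kappa>"
        using \<open>y \<in> \<kappa>\<close> that stable_\<kappa> by (intro br_in_commutator) (auto simp: stable_def)
      then show ?thesis using d(2) by (simp add: H_br)
    qed
    moreover have "br y (x - d) \<in> \<kappa>"
      using that c\<kappa> stable_\<kappa> by (simp add: stable_def lie_subalgebra_def)
    ultimately show ?thesis using H_eq_0_iff by blast
  qed
  have "\<tau> x \<in> \<kappa>" using x stable_\<kappa> by (simp add: stable_def)
  then have "\<tau> (br (\<tau> x) (x - d)) = 0" using central by simp
  then have "br x (\<tau> (x - d)) = 0" by (simp add: \<tau>_br)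
  then have "H x (x - d) = 0" by (rule nilpotent_orthogonal[OF nil])
  moreover have "x - d \<in> center \<kappa>"
    using c\<kappa> central br_anti[of "x - d"] by (auto simp: center_def)
  then have "H d (x - d) = 0" using orthogonal_center_commutator[OF stable_\<kappa> _ d(1)] by blast
  ultimately have "H (x - d) (x - d) = 0" by (simp add: H_diff_left)
  then show ?thesis using d(1) by simp
qed

theorem reductive_complement_levi:
  assumes f: "lie_subalgebra f" "h \<subseteq> f" and v_def: "v = f \<inter> \<kappa>"
  shows "reductive_complement {x\<in>v. \<tau> x \<in> v} (nil_ideal \<kappa> v) v"
proof -
  note sf = lie_subalgebra_subspace[OF f(1)]
  define q where "q = {x\<in>f. \<theta> x \<in> f}"
  have "subspace q" unfolding q_def
    by (rule subspaceI) (auto simp: \<theta>_add \<theta>_scale subspace_0[OF sf] subspace_add[OF sf] subspace_scale[OF sf])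
  then have q: "lie_subalgebra q" "h \<subseteq> q"
    using f h_\<theta> by (auto simp: q_def lie_subalgebra_def \<theta>_br)
  have \<theta>q: "\<theta> x \<in> q" if "x \<in> q" for x using that by (simp add: q_def)
  have v: "v = q \<inter> \<kappa>" by (auto simp: v_def q_def \<kappa>_def)
  define n where "n = nilpart q \<inter> \<kappa>"
  define r where "r = {x\<in>v. \<tau> x \<in> v}"
  have r: "r = levi q \<inter> \<kappa>" using stable_\<kappa> by (auto simp: r_def v levi_def stable_def)
  have \<kappa>_sub: "lie_subalgebra \<kappa>" using stable_\<kappa> by (simp add: stable_def)
  have v_sub: "lie_subalgebra v"
    using q(1) \<kappa>_sub by (auto simp: v lie_subalgebra_def subspace_inter)
  note sv = lie_subalgebra_subspace[OF v_sub]
  have sn: "subspace n" unfolding n_def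
    by (intro subspace_inter nilpart_subspace \<kappa>_subspace lie_subalgebra_subspace[OF q(1)])
  have nq: "nilpart q \<subseteq> q" by (auto simp: nilpart_def)
  have n_ideal: "lie_ideal n v"
    using sn nq nilpart_ideal[OF q(1)] \<kappa>_sub by (auto simp: lie_ideal_def n_def v lie_subalgebra_def)
  have r_stable: "stable r"
    using stable_levi[OF q(1)] stable_\<kappa> by (auto simp: r stable_def lie_subalgebra_def subspace_inter)
  have sr: "subspace r" using r_stable by (simp add: stable_def lie_subalgebra_def)
  have nr: "x = 0" if "x \<in> n" "x \<in> r" for x
    using nilpart_levi_trivial that by (auto simp: n_def r)
  have split: "\<exists>a\<in>n. \<exists>b\<in>r. x = a + b" if x: "x \<in> v" for x
  proof -
    obtain a b where ab: "a \<in> nilpart q" "b \<in> levi q" "x = a + b"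
      using nilpart_levi_decomposition[OF q] x v by blast
    have \<theta>a: "\<theta> a \<in> nilpart q"
    proof -
      have "H (\<theta> a) (\<tau> y) = 0" if "y \<in> q" for y
      proof -
        have "H a (\<tau> (\<theta> y)) = 0" using ab(1) \<theta>q[OF that] by (simp add: nilpart_def)
        then show ?thesis using H_\<theta>[of a "\<theta> (\<tau> y)"] by (simp add: \<theta>_\<tau>)
      qed
      then show ?thesis using ab(1) \<theta>q by (simp add: nilpart_def)
    qed
    have \<theta>b: "\<theta> b \<in> levi q" using ab(2) \<theta>q \<theta>_\<tau>[of b, symmetric] by (simp add: levi_def)
    have "\<theta> a + \<theta> b = a + b" using x ab(3) by (simp add: v \<kappa>_def \<theta>_add)
    then have eq: "\<theta> a - a = b - \<theta> b" by (simp add: algebra_simps)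
    have "\<theta> a - a \<in> nilpart q"
      using \<theta>a ab(1) subspace_diff[OF nilpart_subspace[OF lie_subalgebra_subspace[OF q(1)]]] by blast
    moreover have "\<theta> a - a \<in> levi q" unfolding eq
      using \<theta>b ab(2) subspace_diff[OF levi_subspace[OF lie_subalgebra_subspace[OF q(1)]]] by blast
    ultimately have "\<theta> a = a" using nilpart_levi_trivial by force
    moreover from this have "\<theta> b = b" using eq by simp
    ultimately show ?thesis using ab by (auto simp: n_def r \<kappa>_def)
  qed
  have nv: "n \<subseteq> v" and rv: "r \<subseteq> v" using n_ideal by (auto simp: lie_ideal_def r_def)
  have n_br: "br y x \<in> n" if "x \<in> n" "y \<in> v" for x y using n_ideal that by (simp add: lie_ideal_def)
  have n_br': "br x y \<in> n" if "x \<in> n" "y \<in> v" for x y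
    using n_br[OF that] br_anti[of x y] subspace_neg[OF sn] by simp

  \<comment> \<open>The series starts from the whole algebra, so one \<open>m\<close> bounds the
    order of nilpotency of \<open>br x\<close> for all \<open>x\<close> in \<open>n\<close>. It also
    dominates the derived series of \<open>n\<close>.\<close>
  define W where "W k = ((\<lambda>C. commutator (nilpart q) C) ^^ k) UNIV" for k
  have W_Suc: "W (Suc k) = commutator (nilpart q) (W k)" for k by (simp add: W_def)
  obtain m where m: "W m = {0}" using nilpart_nilpotent[OF q] unfolding W_def by blast
  have n_nil: "(br x ^^ m) y = 0" if "x \<in> n" for x y
  proof -
    have "(br x ^^ k) y \<in> W k" for k
    proof (induction k)
      case (Suc k)
      then show ?case using that unfolding W_Suc by (auto simp: n_def intro: br_in_commutator)
    qed (simp add: W_def)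
    then show ?thesis using m by blast
  qed
  have n_solvable: "solvable n"
  proof -
    define D where "D k = ((\<lambda>D. commutator D D) ^^ k) n" for k
    have D_Suc: "D (Suc k) = commutator (D k) (D k)" for k by (simp add: D_def)
    have D: "subspace (D k) \<and> D k \<subseteq> n \<and> D k \<subseteq> W k" for k
    proof (induction k)
      case 0
      then show ?case using sn by (simp add: D_def W_def)
    next
      case (Suc k)
      have "D (Suc k) \<subseteq> n"
        unfolding D_Suc using Suc n_br nv by (intro commutator_least sn) blast
      moreover have "D (Suc k) \<subseteq> W (Suc k)"
        unfolding D_Suc W_Suc using Suc by (intro commutator_mono) (auto simp: n_def)
      ultimately show ?case by (simp add: D_Suc commutator_subspace)
    qed
    have "D m = {0}" using D[of m] m subspace_0[of "D m"] by auto
    then show ?thesis unfolding solvable_def D_def by blast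
  qed
  have n_commutator: "n \<subseteq> commutator \<kappa> \<kappa>"
    using nilpotent_in_commutator[OF _ n_nil] by (auto simp: n_def)
  have n_nil_ideal: "n \<subseteq> nil_ideal \<kappa> v"
  proof
    fix x assume x: "x \<in> n"
    have "x \<in> radical v" unfolding radical_def
      using x n_ideal n_solvable by (intro span_base) blast
    moreover have "nilpotent_element \<kappa> x"
      unfolding nilpotent_element_def using x n_commutator n_nil by blast
    ultimately show "x \<in> nil_ideal \<kappa> v" by (simp add: nil_ideal_def)
  qed

  \<comment> \<open>Locates the radical of \<open>v\<close>: modulo \<open>n\<close>, a solvable
    ideal of \<open>v\<close> becomes a solvable ideal of the reductive \<open>r\<close> and is
    central there.\<close>
  let ?R = "{a + b | a b. a \<in> n \<and> b \<in> center r}"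
  have sR: "subspace ?R" by (rule subspace_sums[OF sn center_subspace[OF sr]])
  have rad: "radical v \<subseteq> ?R"
  proof -
    have "I \<subseteq> ?R" if I: "lie_ideal I v" "solvable I" for I
    proof -
      text \<open>The projection to \<open>r\<close> along the ideal \<open>n\<close> is a homomorphism.\<close>
      define \<pi> where "\<pi> A = {b\<in>r. \<exists>a\<in>n. a + b \<in> A}" for A
      have \<pi>_subspace: "subspace (\<pi> A)" if A: "subspace A" for A
      proof (rule subspaceI)
        show "0 \<in> \<pi> A" unfolding \<pi>_def using subspace_0[OF A] subspace_0[OF sn] subspace_0[OF sr] by force
      next
        fix x y assume "x \<in> \<pi> A" "y \<in> \<pi> A"
        then obtain a b where ab: "a \<in> n" "a + x \<in> A" "x \<in> r" "b \<in> n" "b + y \<in> A" "y \<in> r"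
          by (auto simp: \<pi>_def)
        have "(a + b) + (x + y) = (a + x) + (b + y)" by (simp add: algebra_simps)
        then have "(a + b) + (x + y) \<in> A" by (simp only: subspace_add[OF A ab(2,5)])
        then show "x + y \<in> \<pi> A"
          using subspace_add[OF sn ab(1,4)] subspace_add[OF sr ab(3,6)] unfolding \<pi>_def by blast
      next
        fix c x assume "x \<in> \<pi> A"
        then obtain a where a: "a \<in> n" "a + x \<in> A" "x \<in> r" by (auto simp: \<pi>_def)
        have "scale c a + scale c x \<in> A" using subspace_scale[OF A a(2)] by (simp add: scale_right_distrib)
        then show "scale c x \<in> \<pi> A"
          using subspace_scale[OF sn a(1)] subspace_scale[OF sr a(3)] unfolding \<pi>_def by blast
      qed
      have r_br: "br x y \<in> r" if "x \<in> r" "y \<in> r" for x y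
        using r_stable that by (simp add: stable_def lie_subalgebra_def)
      have \<pi>_br: "br x y \<in> \<pi> B" if x: "x \<in> r" "a \<in> n" and y: "y \<in> r" "b \<in> n" and B: "br (a + x) (b + y) \<in> B"
        for x y a b B
      proof -
        have eq: "br (a + x) (b + y) = (br a (b + y) + br x b) + br x y"
          by (simp add: br_add_left br_add_right algebra_simps)
        have "b + y \<in> v" using y nv rv subspace_add[OF sv] by blast
        then have "br a (b + y) + br x b \<in> n"
          using x y n_br n_br' rv subspace_add[OF sn] by blast
        then show ?thesis unfolding \<pi>_def using B eq r_br[OF x(1) y(1)] by auto
      qed
      have "\<pi> I \<subseteq> r" by (auto simp: \<pi>_def)
      moreover have "br x y \<in> \<pi> I" if x: "x \<in> r" and y: "y \<in> \<pi> I" for x y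
      proof -
        obtain b where b: "b \<in> n" "b + y \<in> I" "y \<in> r" using y by (auto simp: \<pi>_def)
        have "br (0 + x) (b + y) \<in> I" using b(2) x rv I(1) by (auto simp: lie_ideal_def)
        then show ?thesis using \<pi>_br[OF x subspace_0[OF sn] b(3,1)] by blast
      qed
      ultimately have \<pi>I: "lie_ideal (\<pi> I) r"
        using I(1) \<pi>_subspace by (simp add: lie_ideal_def)
      define D where "D k = ((\<lambda>D. commutator D D) ^^ k) I" for k
      have D_Suc: "D (Suc k) = commutator (D k) (D k)" for k by (simp add: D_def)
      have sD: "subspace (D k)" for k
        using I(1) by (cases k) (auto simp: D_Suc commutator_subspace D_def lie_ideal_def)
      define E where "E k = ((\<lambda>D. commutator D D) ^^ k) (\<pi> I)" for k
      have E_Suc: "E (Suc k) = commutator (E k) (E k)" for k by (simp add: E_def)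
      have ED: "E k \<subseteq> \<pi> (D k)" for k
      proof (induction k)
        case (Suc k)
        show ?case unfolding E_Suc
        proof (rule commutator_least[OF \<pi>_subspace[OF sD]])
          fix x y assume "x \<in> E k" "y \<in> E k"
          then have "x \<in> \<pi> (D k)" "y \<in> \<pi> (D k)" using Suc by auto
          then obtain a b where ab: "x \<in> r" "a \<in> n" "a + x \<in> D k" "y \<in> r" "b \<in> n" "b + y \<in> D k"
            unfolding \<pi>_def by blast
          have "br (a + x) (b + y) \<in> D (Suc k)" unfolding D_Suc by (rule br_in_commutator[OF ab(3,6)])
          then show "br x y \<in> \<pi> (D (Suc k))" by (rule \<pi>_br[OF ab(1,2,4,5)])
        qed
      qed (simp add: D_def E_def)
      obtain k where k: "D k = {0}" using I(2) unfolding solvable_def D_def by blast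
      have "E k \<subseteq> {0}"
      proof
        fix x assume "x \<in> E k"
        then obtain a where a: "x \<in> r" "a \<in> n" "a + x = 0" using ED[of k] k by (auto simp: \<pi>_def)
        then have "x = - a" by (simp add: eq_neg_iff_add_eq_0 add.commute)
        then show "x \<in> {0}" using nr[of x] a subspace_neg[OF sn] by simp
      qed
      moreover have "subspace (E k)"
        using \<pi>I by (cases k) (auto simp: E_Suc commutator_subspace E_def lie_ideal_def)
      ultimately have "E k = {0}" using subspace_0 by blast
      then have "\<pi> I \<subseteq> center r" unfolding E_def by (rule solvable_ideal_central[OF r_stable \<pi>I])
      show "I \<subseteq> ?R"
      proof
        fix x assume x: "x \<in> I"
        then have "x \<in> v" using I(1) by (auto simp: lie_ideal_def)
        then obtain a b where ab: "a \<in> n" "b \<in> r" "x = a + b" using split by blast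
        then have "b \<in> \<pi> I" using x by (auto simp: \<pi>_def)
        then show "x \<in> ?R" using ab \<open>\<pi> I \<subseteq> center r\<close> by blast
      qed
    qed
    then show ?thesis unfolding radical_def by (intro span_minimal sR) blast
  qed

  have nil_ideal_n: "nil_ideal \<kappa> v \<subseteq> n"
  proof
    fix x assume "x \<in> nil_ideal \<kappa> v"
    then obtain l where x: "x \<in> radical v" "x \<in> commutator \<kappa> \<kappa>" and l: "\<And>y. y \<in> \<kappa> \<Longrightarrow> (br x ^^ l) y = 0"
      unfolding nil_ideal_def nilpotent_element_def by blast
    obtain a z where az: "a \<in> n" "z \<in> center r" "x = a + z" using x(1) rad by blast
    have zr: "z \<in> r" and z_central: "\<And>y. y \<in> r \<Longrightarrow> br z y = 0" using az(2) by (auto simp: center_def)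
    have zv: "z \<in> v" and av: "a \<in> v" using zr az(1) rv nv by auto
    \<comment> \<open>The terms of this filtration are invariant under \<open>v\<close>, and
      \<open>U m\<close> vanishes because it is contained in \<open>W m\<close>.\<close>
    define U where "U k = ((\<lambda>C. commutator n C) ^^ k) \<kappa>" for k
    have U_Suc: "U (Suc k) = commutator n (U k)" for k by (simp add: U_def)
    have sU: "subspace (U k)" for k by (cases k) (auto simp: U_Suc commutator_subspace U_def \<kappa>_subspace)
    have U_inv: "br y u \<in> U k" if "y \<in> v" "u \<in> U k" for y u k
      using that(2)
    proof (induction k arbitrary: u)
      case 0
      then show ?case using that(1) \<kappa>_sub by (simp add: U_def v lie_subalgebra_def)
    next
      case (Suc k)
      show ?case unfolding U_Suc
        by (rule commutator_invariant[OF n_br[OF _ that(1)] Suc.IH Suc.prems[unfolded U_Suc]])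
    qed
    have U_\<kappa>: "U k \<subseteq> \<kappa>" for k
    proof (induction k)
      case (Suc k)
      show ?case unfolding U_Suc
        using Suc \<kappa>_sub by (intro commutator_least \<kappa>_subspace) (auto simp: n_def lie_subalgebra_def)
    qed (simp add: U_def)
    have U_W: "U k \<subseteq> W k" for k
    proof (induction k)
      case (Suc k)
      then show ?case unfolding U_Suc W_Suc by (intro commutator_mono) (auto simp: n_def)
    qed (simp add: W_def)
    text \<open>Modulo \<open>U (Suc k)\<close> the element \<open>x\<close> acts on \<open>U k\<close> as \<open>z\<close>.\<close>
    have U_step: "(br z ^^ l) u \<in> U (Suc k)" if u: "u \<in> U k" for u k
    proof -
      have zU: "(br z ^^ j) u \<in> U k" for j by (induction j) (auto simp: u U_inv[OF zv])
      have "(br x ^^ j) u - (br z ^^ j) u \<in> U (Suc k)" for j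
      proof (induction j)
        case 0
        then show ?case by (simp add: subspace_0[OF sU])
      next
        case (Suc j)
        have "x \<in> v" using az subspace_add[OF sv] av zv by blast
        have "(br x ^^ Suc j) u - (br z ^^ Suc j) u
            = br x ((br x ^^ j) u - (br z ^^ j) u) + br a ((br z ^^ j) u)"
          by (simp add: az(3) br_diff_right br_add_left)
        moreover have "br a ((br z ^^ j) u) \<in> U (Suc k)"
          unfolding U_Suc by (rule br_in_commutator[OF az(1) zU])
        ultimately show ?case using U_inv[OF \<open>x \<in> v\<close> Suc] subspace_add[OF sU] by simp
      qed
      from this[of l] have "0 - (br z ^^ l) u \<in> U (Suc k)" using l[of u] U_\<kappa> u by force
      then show ?thesis using subspace_neg[OF sU] by force
    qed
    have z_nil: "((br z ^^ l) ^^ k) y \<in> U k" if "y \<in> \<kappa>" for y k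
      by (induction k) (use that U_step in \<open>auto simp: U_def\<close>)
    \<comment> \<open>Each block of \<open>l\<close> applications of \<open>z\<close> descends one
      step, and \<open>m\<close> steps exhaust the filtration. As \<open>z\<close> commutes with
      \<open>\<tau> z\<close>, this nilpotency on \<kappa> already means that \<open>z\<close> acts
      as 0.\<close>
    have z0: "br z y = 0" if "y \<in> \<kappa>" for y
    proof (rule normal_nilpotent)
      show "br z (\<tau> z) = 0" using z_central zr r_stable by (simp add: stable_def)
      have "((br z ^^ l) ^^ m) y = 0" using z_nil[OF that, of m] U_W[of m] m by blast
      then show "(br z ^^ (l * m)) y = 0" by (simp add: funpow_mult)
    qed
    have "z \<in> center \<kappa>" using z0 zv by (simp add: center_def v)
    moreover have "z \<in> commutator \<kappa> \<kappa>"
      using subspace_diff[OF commutator_subspace x(2)] n_commutator az by force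
    ultimately have "z = 0" by (rule center_commutator_trivial[OF stable_\<kappa>])
    then show "x \<in> n" using az by simp
  qed
  then have nil_ideal_eq: "nil_ideal \<kappa> v = n" using n_nil_ideal by blast
  have "v = {a + b | a b. a \<in> n \<and> b \<in> r}"
    using split nv rv subspace_add[OF sv] by blast
  then have "direct_sum v n r"
    unfolding direct_sum_def using sn sr nr subspace_0[OF sn] subspace_0[OF sr] by blast
  then show ?thesis
    unfolding reductive_complement_def nil_ideal_eq r_def[symmetric]
    using reductive_stable[OF r_stable] by simp
qed

end

section \<open>Cartan involutions\<close>

context complex_lie_algebra
begin

lemma linear_map_on_compose_br: "linear_map_on UNIV (\<lambda>z. br x (br y z))"
  by (simp add: linear_map_on_def br_add_right br_scale_right)

section \<open>Trace and Killing form of the complex Lie algebra\<close>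

lemma trace_add:
  assumes "linear_map_on UNIV S" "linear_map_on UNIV T"
  shows "trace_on UNIV (\<lambda>z. S z + T z) = trace_on UNIV S + trace_on UNIV T"
proof -
  have "linear_map_on UNIV (\<lambda>z. S z + T z)"
    using assms by (auto simp: linear_map_on_def scale_right_distrib algebra_simps)
  then show ?thesis using assms basis
    by (simp add: trace_on_eq[of basis] representation_add sum.distrib)
qed

lemma trace_scale:
  assumes "linear_map_on UNIV T"
  shows "trace_on UNIV (\<lambda>z. scale c (T z)) = c * trace_on UNIV T"
proof -
  have "linear_map_on UNIV (\<lambda>z. scale c (T z))"
    using assms by (auto simp: linear_map_on_def scale_right_distrib mult.commute)
  then show ?thesis using assms basis
    by (simp add: trace_on_eq[of basis] representation_scale sum_distrib_left)
qed

lemma trace_on_UNIV_commute: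
  assumes "linear_map_on UNIV S" "linear_map_on UNIV T"
  shows "trace_on UNIV (\<lambda>z. T (S z)) = trace_on UNIV (\<lambda>z. S (T z))"
  using trace_on_commute[of basis UNIV UNIV S T] basis assms by simp

abbreviation B :: "'g \<Rightarrow> 'g \<Rightarrow> complex" where
  "B \<equiv> killing_form UNIV"

lemma B_commute: "B x y = B y x"
  unfolding killing_form_def by (rule trace_on_UNIV_commute) (rule linear_map_on_br)+

lemma B_add_left: "B (x + y) z = B x z + B y z"
  unfolding killing_form_def br_add_left by (rule trace_add) (rule linear_map_on_compose_br)+

lemma B_scale_left: "B (scale c x) z = c * B x z"
  unfolding killing_form_def br_scale_left by (rule trace_scale) (rule linear_map_on_compose_br)

lemma B_add_right: "B z (x + y) = B z x + B z y"
  using B_add_left[of x y z] B_commute by metis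

lemma B_scale_right: "B z (scale c x) = c * B z x"
  using B_scale_left[of c x z] B_commute by metis

lemma B_minus_left: "B (- x) z = - B x z"
  using B_scale_left[of "-1" x z] by simp

lemma B_minus_right: "B z (- x) = - B z x"
  using B_scale_right[of z "-1" x] by simp

text \<open>After both brackets are expanded inside the trace, one pair of terms remains to be
  compared, and cyclicity of the trace identifies them.\<close>

lemma B_invariant: "B (br x y) z = B x (br y z)"
proof -
  have lin3: "linear_map_on UNIV (\<lambda>w. br a (br b (br c w)))" for a b c
    by (simp add: linear_map_on_def br_add_right br_scale_right)
  have lin3': "linear_map_on UNIV (\<lambda>w. scale (- 1) (br a (br b (br c w))))" for a b c
    by (simp add: linear_map_on_def br_add_right br_scale_right scale_right_diff_distrib)
  have "(\<lambda>w. br (br x y) (br z w)) = (\<lambda>w. br x (br y (br z w)) + scale (- 1) (br y (br x (br z w))))"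
    by (simp add: br_br fun_eq_iff)
  then have "B (br x y) z
      = trace_on UNIV (\<lambda>w. br x (br y (br z w))) - trace_on UNIV (\<lambda>w. br y (br x (br z w)))"
    unfolding killing_form_def by (simp only: trace_add[OF lin3 lin3'] trace_scale[OF lin3]) simp
  also have "trace_on UNIV (\<lambda>w. br y (br x (br z w))) = trace_on UNIV (\<lambda>w. br x (br z (br y w)))"
    by (rule trace_on_UNIV_commute[OF linear_map_on_compose_br linear_map_on_br])
  also have "trace_on UNIV (\<lambda>w. br x (br y (br z w))) - trace_on UNIV (\<lambda>w. br x (br z (br y w)))
      = B x (br y z)"
  proof -
    have "(\<lambda>w. br x (br (br y z) w)) = (\<lambda>w. br x (br y (br z w)) + scale (- 1) (br x (br z (br y w))))"
      by (simp add: br_br fun_eq_iff br_diff_right)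
    then show ?thesis
      unfolding killing_form_def by (simp only: trace_add[OF lin3 lin3'] trace_scale[OF lin3]) simp
  qed
  finally show ?thesis .
qed

text \<open>For commuting \<open>x\<close> and \<open>w\<close> the powers of
  \<open>ad x ad w\<close> are products of powers, so the composite is nilpotent along with
  \<open>ad x\<close> and has trace 0.\<close>

lemma B_nilpotent_commuting:
  assumes nil: "\<And>y. (br x ^^ m) y = 0" and comm: "br x w = 0"
  shows "B x w = 0"
proof -
  have swap: "br x (br w y) = br w (br x y)" for y using br_br[of x w y] comm by simp
  have swap': "(br x ^^ k) (br w y) = br w ((br x ^^ k) y)" for k y
    by (induction k) (auto simp: swap)
  have "((\<lambda>z. br x (br w z)) ^^ k) y = (br x ^^ k) ((br w ^^ k) y)" for k y
    by (induction k) (auto simp: swap')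
  then have "((\<lambda>z. br x (br w z)) ^^ m) y = 0" for y using nil by simp
  then show ?thesis unfolding killing_form_def
    by (intro trace_on_nilpotent[of basis]) (use basis linear_map_on_compose_br in auto)
qed

lemma re_span_subset: "re.span A \<subseteq> span A"
proof (rule re.span_minimal)
  show "A \<subseteq> span A" by (rule span_superset)
  show "re.subspace (span A)"
    by (rule re.subspaceI) (auto intro: span_zero span_add span_scale)
qed

lemma subspace_complexify:
  assumes D: "re.subspace D"
  shows "subspace (complexify D)"
proof (rule subspaceI)
  show "0 \<in> complexify D" unfolding complexify_def using re.subspace_0[OF D] by force
next
  fix z w assume "z \<in> complexify D" "w \<in> complexify D"
  then obtain x y x' y' where "x \<in> D" "y \<in> D" "x' \<in> D" "y' \<in> D"
    "z = x + scale \<i> y" "w = x' + scale \<i> y'" by (auto simp: complexify_def)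
  then have "z + w = (x + x') + scale \<i> (y + y')" "x + x' \<in> D" "y + y' \<in> D"
    using re.subspace_add[OF D] by (auto simp: scale_right_distrib algebra_simps)
  then show "z + w \<in> complexify D" unfolding complexify_def by blast
next
  fix c z assume "z \<in> complexify D"
  then obtain x y where xy: "x \<in> D" "y \<in> D" "z = x + scale \<i> y" by (auto simp: complexify_def)
  have c: "c = of_real (Re c) + \<i> * of_real (Im c)" by (rule complex_eq)
  have "scale c z = scale (of_real (Re c) + \<i> * of_real (Im c)) z" using c by simp
  also have "\<dots> = (scale (of_real (Re c)) x + scale (of_real (- Im c)) y)
      + scale \<i> (scale (of_real (Im c)) x + scale (of_real (Re c)) y)"
    unfolding xy(3) by (simp add: scale_left_distrib scale_right_distrib algebra_simps)
  finally show "scale c z \<in> complexify D" unfolding complexify_def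
    using xy re.subspace_add[OF D] re.subspace_scale[OF D] by blast
qed

end

section \<open>Complexification of a Cartan involution\<close>

locale cartan_involution_pair = complex_lie_algebra scale br
  for scale :: "complex \<Rightarrow> 'g::ab_group_add \<Rightarrow> 'g" and br +
  fixes g0 :: "'g set" and \<theta> :: "'g \<Rightarrow> 'g"
  assumes real_form: "real_form g0" and involution: "cartan_involution g0 \<theta>"
begin

lemma g0_subspace: "re.subspace g0" and g0_br: "x \<in> g0 \<Longrightarrow> y \<in> g0 \<Longrightarrow> br x y \<in> g0"
  using real_form by (auto simp: real_form_def re.lie_subalgebra_def)

lemmas g0_intros = re.subspace_0[OF g0_subspace] re.subspace_add[OF g0_subspace]
  re.subspace_diff[OF g0_subspace] re.subspace_neg[OF g0_subspace] re.subspace_scale[OF g0_subspace] g0_br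

lemma \<theta>_g0: "x \<in> g0 \<Longrightarrow> \<theta> x \<in> g0"
  and \<theta>_\<theta>: "x \<in> g0 \<Longrightarrow> \<theta> (\<theta> x) = x"
  and \<theta>_add: "x \<in> g0 \<Longrightarrow> y \<in> g0 \<Longrightarrow> \<theta> (x + y) = \<theta> x + \<theta> y"
  and \<theta>_scale: "x \<in> g0 \<Longrightarrow> \<theta> (scale (complex_of_real r) x) = scale (complex_of_real r) (\<theta> x)"
  and \<theta>_br: "x \<in> g0 \<Longrightarrow> y \<in> g0 \<Longrightarrow> \<theta> (br x y) = br (\<theta> x) (\<theta> y)"
  and \<theta>_pos: "x \<in> g0 \<Longrightarrow> x \<noteq> 0 \<Longrightarrow> re.killing_form g0 x (\<theta> x) < 0"
  using involution unfolding cartan_involution_def by auto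

lemma \<theta>_minus: "x \<in> g0 \<Longrightarrow> \<theta> (- x) = - \<theta> x"
  using \<theta>_scale[of x "-1"] by simp

lemma \<theta>_diff: "x \<in> g0 \<Longrightarrow> y \<in> g0 \<Longrightarrow> \<theta> (x - y) = \<theta> x - \<theta> y"
  using \<theta>_add[of x "- y"] by (simp add: \<theta>_minus g0_intros)

text \<open>\<open>rp\<close> and \<open>ip\<close> are real and imaginary part with respect to
  \<open>g0\<close>. Identities in the complexification are checked on these parts, because the laws
  of \<open>\<theta>\<close> are known only on \<open>g0\<close>.\<close>

definition rp :: "'g \<Rightarrow> 'g" where
  "rp z = fst (SOME p. fst p \<in> g0 \<and> snd p \<in> g0 \<and> z = fst p + scale \<i> (snd p))"

definition ip :: "'g \<Rightarrow> 'g" where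
  "ip z = snd (SOME p. fst p \<in> g0 \<and> snd p \<in> g0 \<and> z = fst p + scale \<i> (snd p))"

lemma parts: "rp z \<in> g0 \<and> ip z \<in> g0 \<and> z = rp z + scale \<i> (ip z)"
proof -
  have "z \<in> complexify g0" using real_form by (simp add: real_form_def)
  then obtain x y where "x \<in> g0" "y \<in> g0" "z = x + scale \<i> y" by (auto simp: complexify_def)
  then have "\<exists>p. fst p \<in> g0 \<and> snd p \<in> g0 \<and> z = fst p + scale \<i> (snd p)"
    by (intro exI[of _ "(x, y)"]) simp
  from someI_ex[OF this] show ?thesis unfolding rp_def ip_def .
qed

lemma rp_g0 [simp]: "rp z \<in> g0" and ip_g0 [simp]: "ip z \<in> g0"
  using parts by blast+

lemma parts_sum: "rp z + scale \<i> (ip z) = z"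
  using parts by metis

lemma parts_unique:
  assumes "x \<in> g0" "y \<in> g0" "x' \<in> g0" "y' \<in> g0" "x + scale \<i> y = x' + scale \<i> y'"
  shows "x = x'" "y = y'"
proof -
  have eq: "x - x' = scale \<i> (y' - y)"
    using assms(5) by (simp add: scale_right_diff_distrib algebra_simps)
  then have "x - x' \<in> scale \<i> ` g0" using assms g0_intros by blast
  moreover have "x - x' \<in> g0" using assms g0_intros by blast
  ultimately have "x - x' \<in> {0}" using real_form unfolding real_form_def by blast
  then have "x - x' = 0" by simp
  then show "x = x'" "y = y'" using eq by auto
qed

lemma parts_eqI:
  assumes "x \<in> g0" "y \<in> g0" "z = x + scale \<i> y"
  shows "rp z = x" "ip z = y"
  using parts_unique[of "rp z" "ip z" x y] assms parts_sum[of z] by auto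

lemma eqI: "rp z = rp w \<Longrightarrow> ip z = ip w \<Longrightarrow> z = w"
  using parts_sum by metis

lemma
  rp_real: "x \<in> g0 \<Longrightarrow> rp x = x" and ip_real: "x \<in> g0 \<Longrightarrow> ip x = 0"
  using parts_eqI[of x 0 x] g0_intros(1) by auto

lemma rp_add: "rp (z + w) = rp z + rp w" and ip_add: "ip (z + w) = ip z + ip w"
proof -
  have eq: "z + w = (rp z + rp w) + scale \<i> (ip z + ip w)"
    using parts_sum[of z] parts_sum[of w] by (simp add: scale_right_distrib algebra_simps)
  show "rp (z + w) = rp z + rp w" "ip (z + w) = ip z + ip w"
    by (rule parts_eqI[OF _ _ eq]; intro g0_intros rp_g0 ip_g0)+
qed

lemma
  rp_scale: "rp (scale c z) = scale (of_real (Re c)) (rp z) - scale (of_real (Im c)) (ip z)" (is ?r)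
  and ip_scale: "ip (scale c z) = scale (of_real (Im c)) (rp z) + scale (of_real (Re c)) (ip z)" (is ?i)
proof -
  have c: "c = of_real (Re c) + \<i> * of_real (Im c)" by (rule complex_eq)
  have "scale c z = scale (of_real (Re c) + \<i> * of_real (Im c)) (rp z + scale \<i> (ip z))"
    using c parts_sum by simp
  also have "\<dots> = (scale (of_real (Re c)) (rp z) - scale (of_real (Im c)) (ip z))
      + scale \<i> (scale (of_real (Im c)) (rp z) + scale (of_real (Re c)) (ip z))"
    by (simp add: scale_left_distrib scale_right_distrib algebra_simps)
  finally have eq: "scale c z = \<dots>" .
  show ?r ?i
    by (rule parts_eqI[OF _ _ eq]; intro g0_intros rp_g0 ip_g0)+
qed

lemma
  rp_br: "rp (br z w) = br (rp z) (rp w) - br (ip z) (ip w)" (is ?r)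
  and ip_br: "ip (br z w) = br (rp z) (ip w) + br (ip z) (rp w)" (is ?i)
proof -
  have "br z w = br (rp z + scale \<i> (ip z)) (rp w + scale \<i> (ip w))" using parts_sum by simp
  also have "\<dots> = (br (rp z) (rp w) - br (ip z) (ip w)) + scale \<i> (br (rp z) (ip w) + br (ip z) (rp w))"
    by (simp add: br_add_left br_add_right br_scale_left br_scale_right scale_right_distrib algebra_simps)
  finally have eq: "br z w = \<dots>" .
  show ?r ?i
    by (rule parts_eqI[OF _ _ eq]; intro g0_intros rp_g0 ip_g0)+
qed

text \<open>\<open>\<sigma>\<close> is the conjugation with respect to \<open>g0\<close> and
  \<open>\<Theta>\<close> the complex-linear extension of \<open>\<theta>\<close>. The fixed points
  of the composite \<open>\<tau>\<close> are x + i y with \<open>\<theta> x = x\<close> and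
  \<open>\<theta> y = - y\<close>, the compact real form.\<close>

definition \<sigma> :: "'g \<Rightarrow> 'g" where "\<sigma> z = rp z - scale \<i> (ip z)"

definition \<Theta> :: "'g \<Rightarrow> 'g" where "\<Theta> z = \<theta> (rp z) + scale \<i> (\<theta> (ip z))"

definition \<tau> :: "'g \<Rightarrow> 'g" where "\<tau> z = \<sigma> (\<Theta> z)"

lemma rp_\<sigma>: "rp (\<sigma> z) = rp z" and ip_\<sigma>: "ip (\<sigma> z) = - ip z"
  using parts_eqI[of "rp z" "- ip z" "\<sigma> z"] by (auto simp: \<sigma>_def g0_intros)

lemma rp_\<Theta>: "rp (\<Theta> z) = \<theta> (rp z)" and ip_\<Theta>: "ip (\<Theta> z) = \<theta> (ip z)"
  using parts_eqI[of "\<theta> (rp z)" "\<theta> (ip z)" "\<Theta> z"] by (auto simp: \<Theta>_def \<theta>_g0)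

lemma rp_\<tau>: "rp (\<tau> z) = \<theta> (rp z)" and ip_\<tau>: "ip (\<tau> z) = - \<theta> (ip z)"
  by (auto simp: \<tau>_def rp_\<sigma> ip_\<sigma> rp_\<Theta> ip_\<Theta>)

lemmas parts_simps = rp_add ip_add rp_scale ip_scale rp_br ip_br rp_\<sigma> ip_\<sigma> rp_\<Theta> ip_\<Theta> rp_\<tau> ip_\<tau>
  \<theta>_add \<theta>_diff \<theta>_scale \<theta>_br \<theta>_\<theta> \<theta>_minus \<theta>_g0 g0_intros

lemma \<sigma>_\<sigma>: "\<sigma> (\<sigma> z) = z"
  by (rule eqI) (simp_all add: parts_simps)

lemma \<tau>_cinvolution:
  shows "\<tau> (x + y) = \<tau> x + \<tau> y" and "\<tau> (scale c x) = scale (cnj c) (\<tau> x)"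
    and "\<tau> (br x y) = br (\<tau> x) (\<tau> y)" and "\<tau> (\<tau> x) = x"
  by (rule eqI; simp add: parts_simps algebra_simps)+

lemma \<Theta>_involution:
  shows "\<Theta> (x + y) = \<Theta> x + \<Theta> y" and "\<Theta> (scale c x) = scale c (\<Theta> x)"
    and "\<Theta> (br x y) = br (\<Theta> x) (\<Theta> y)" and "\<Theta> (\<Theta> x) = x" and "\<Theta> (\<tau> x) = \<tau> (\<Theta> x)"
  by (rule eqI; simp add: parts_simps algebra_simps)+

text \<open>A real basis of \<open>g0\<close> is also a complex basis of the whole algebra, as
  coefficients can be separated into real and imaginary parts. In it the operators involved have
  real matrix entries.\<close>

lemma B_real:
  assumes "x \<in> g0" "y \<in> g0"
  shows "B x y = of_real (re.killing_form g0 x y)"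
proof -
  obtain C where C: "C \<subseteq> g0" "re.independent C" "g0 \<subseteq> re.span C"
    using re.maximal_independent_subset by blast
  have rspan: "re.span C = g0" using C re.span_minimal[OF C(1) g0_subspace] by blast
  have ind: "independent C"
    unfolding independent_explicit_finite_subsets
  proof (intro allI impI ballI)
    fix S u v assume S: "S \<subseteq> C" "finite S" "(\<Sum>v\<in>S. scale (u v) v) = 0" "v \<in> S"
    define X where "X = (\<Sum>v\<in>S. scale (of_real (Re (u v))) v)"
    define Y where "Y = (\<Sum>v\<in>S. scale (of_real (Im (u v))) v)"
    have XY: "X \<in> g0" "Y \<in> g0" unfolding X_def Y_def
      using S(1) C(1) by (auto intro!: re.subspace_sum[OF g0_subspace] re.subspace_scale[OF g0_subspace])
    have "X + scale \<i> Y = (\<Sum>v\<in>S. scale (of_real (Re (u v)) + \<i> * of_real (Im (u v))) v)"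
      unfolding X_def Y_def by (simp add: scale_sum_right sum.distrib scale_left_distrib)
    also have "\<dots> = 0" using S(3) by (simp add: complex_eq[symmetric])
    finally have "X + scale \<i> Y = 0 + scale \<i> 0" by simp
    from parts_unique[OF XY g0_intros(1) g0_intros(1) this] have "X = 0" "Y = 0" .
    note indC = C(2)[unfolded re.independent_explicit_finite_subsets, rule_format, OF S(1,2) _ S(4)]
    have "Re (u v) = 0" by (rule indC) (use \<open>X = 0\<close> in \<open>simp add: X_def\<close>)
    moreover have "Im (u v) = 0" by (rule indC) (use \<open>Y = 0\<close> in \<open>simp add: Y_def\<close>)
    ultimately
    show "u v = 0" by (simp add: complex_eq_iff)
  qed
  have fin: "finite C" by (rule finiteI_independent[OF ind])
  have span: "span C = UNIV"
  proof -
    have "z \<in> span C" for z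
    proof -
      have "rp z \<in> span C" "ip z \<in> span C" using re_span_subset[of C] rspan rp_g0 ip_g0 by blast+
      then have "rp z + scale \<i> (ip z) \<in> span C" by (intro span_add span_scale)
      then show ?thesis by (simp add: parts_sum)
    qed
    then show ?thesis by blast
  qed
  have rep: "representation C z = (\<lambda>b. of_real (re.representation C z b))" if "z \<in> g0" for z
  proof (rule representation_eqI[OF ind])
    show "z \<in> span C" using span by simp
    show "b \<in> C" if "complex_of_real (re.representation C z b) \<noteq> 0" for b
      using that re.representation_ne_zero by auto
    show "finite {b. complex_of_real (re.representation C z b) \<noteq> 0}"
      using re.finite_representation by simp
    show "(\<Sum>b | complex_of_real (re.representation C z b) \<noteq> 0. scale (of_real (re.representation C z b)) b) = z"
      using re.sum_nonzero_representation_eq[OF C(2)] rspan \<open>z \<in> g0\<close> by simp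
  qed
  have "B x y = (\<Sum>b\<in>C. representation C (br x (br y b)) b)"
    unfolding killing_form_def by (rule trace_on_eq[OF fin ind span linear_map_on_compose_br]) simp
  also have "\<dots> = (\<Sum>b\<in>C. of_real (re.representation C (br x (br y b)) b))"
    using assms C(1) by (intro sum.cong refl) (subst rep, auto intro!: g0_br)
  also have "\<dots> = of_real (re.killing_form g0 x y)"
    unfolding re.killing_form_def using assms
    by (subst re.trace_on_eq[OF fin C(2) rspan])
      (auto simp: re.linear_map_on_def br_add_right br_scale_right intro!: g0_br)
  finally show ?thesis .
qed

text \<open>As \<open>\<Theta>\<close> is an involutive automorphism, it conjugates
  \<open>ad x\<close> into \<open>ad (\<Theta> x)\<close>, and the trace is cyclic.\<close>

lemma B_\<Theta>: "B (\<Theta> x) (\<Theta> y) = B x y"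
proof -
  have lin: "linear_map_on UNIV \<Theta>" by (simp add: linear_map_on_def \<Theta>_involution)
  have "(\<lambda>z. br (\<Theta> x) (br (\<Theta> y) z)) = (\<lambda>z. \<Theta> (br x (br y (\<Theta> z))))"
    by (simp add: \<Theta>_involution)
  then have "B (\<Theta> x) (\<Theta> y) = trace_on UNIV (\<lambda>z. \<Theta> (br x (br y (\<Theta> z))))"
    by (simp only: killing_form_def)
  also have "\<dots> = trace_on UNIV (\<lambda>z. br x (br y (\<Theta> (\<Theta> z))))"
  proof (rule trace_on_UNIV_commute[OF _ lin])
    show "linear_map_on UNIV (\<lambda>z. br x (br y (\<Theta> z)))"
      by (simp add: linear_map_on_def \<Theta>_involution br_add_right br_scale_right)
  qed
  finally show ?thesis by (simp add: \<Theta>_involution killing_form_def)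
qed

lemma B_parts:
  "B z w = (B (rp z) (rp w) - B (ip z) (ip w)) + \<i> * (B (rp z) (ip w) + B (ip z) (rp w))"
proof -
  have "B z w = B (rp z + scale \<i> (ip z)) (rp w + scale \<i> (ip w))" by (simp add: parts_sum)
  also have "\<dots> = (B (rp z) (rp w) - B (ip z) (ip w)) + \<i> * (B (rp z) (ip w) + B (ip z) (rp w))"
    unfolding B_add_left B_add_right B_scale_left B_scale_right by (simp add: algebra_simps)
  finally show ?thesis .
qed

lemma B_\<sigma>: "B (\<sigma> z) (\<sigma> w) = cnj (B z w)"
  unfolding B_parts[of "\<sigma> z"] B_parts[of z]
  by (simp add: rp_\<sigma> ip_\<sigma> B_minus_left B_minus_right B_real algebra_simps)

definition H :: "'g \<Rightarrow> 'g \<Rightarrow> complex" where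
  "H x y = - B x (\<tau> y)"

lemma B_\<tau>: "B (\<tau> x) (\<tau> y) = cnj (B x y)"
  by (simp add: \<tau>_def B_\<sigma> B_\<Theta>)

sublocale hermitian_lie_algebra scale br \<tau> H
proof
  fix x y z :: 'g and c
  show "\<tau> (x + y) = \<tau> x + \<tau> y" "\<tau> (scale c x) = scale (cnj c) (\<tau> x)"
    "\<tau> (br x y) = br (\<tau> x) (\<tau> y)" "\<tau> (\<tau> x) = x"
    by (rule \<tau>_cinvolution)+
  show "H (x + y) z = H x z + H y z" "H (scale c x) z = c * H x z"
    by (simp_all add: H_def B_add_left B_scale_left)
  show "H y x = cnj (H x y)"
    using B_\<tau>[of x "\<tau> y"] by (simp add: H_def \<tau>_cinvolution B_commute[of y])
  show "H (br x y) z = - H y (br (\<tau> x) z)"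
    using B_invariant[of y x "\<tau> z"]
    by (simp add: H_def \<tau>_cinvolution br_anti[of x y] B_minus_left)
  show "H (\<tau> x) (\<tau> y) = cnj (H x y)"
    using B_\<tau>[of x "\<tau> y"] by (simp add: H_def \<tau>_cinvolution)
  \<comment> \<open>In \<open>B x (\<tau> x)\<close> the mixed terms are i times real numbers. Hence
    the real part of \<open>H x x\<close> is the sum of \<open>- B u (\<theta> u)\<close> over the
    real and the imaginary part \<open>u\<close> of \<open>x\<close>, to which positivity of the
    Cartan involution applies.\<close>
  show "Re (H x x) > 0" if "x \<noteq> 0"
  proof -
    have r: "Re (B u (\<theta> u)) \<le> 0" "u \<noteq> 0 \<Longrightarrow> Re (B u (\<theta> u)) < 0" if "u \<in> g0" for u
      using \<theta>_pos[OF that] that B_real[OF that \<theta>_g0[OF that]] B_scale_left[of 0 0 "\<theta> 0"]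
      by (cases "u = 0"; force)+
    have "Im (B (rp x) (\<theta> (ip x))) = 0" "Im (B (ip x) (\<theta> (rp x))) = 0"
      by (simp_all add: B_real \<theta>_g0)
    then have "Re (H x x) = - Re (B (rp x) (\<theta> (rp x))) - Re (B (ip x) (\<theta> (ip x)))"
      unfolding H_def B_parts[of x] by (simp add: rp_\<tau> ip_\<tau> B_minus_right)
    moreover have "rp x \<noteq> 0 \<or> ip x \<noteq> 0" using that parts_sum[of x] by auto
    ultimately show ?thesis using r[of "rp x"] r[of "ip x"] by force
  qed
qed

lemma complexify_iff:
  assumes "D \<subseteq> g0"
  shows "z \<in> complexify D \<longleftrightarrow> rp z \<in> D \<and> ip z \<in> D"
proof
  assume "z \<in> complexify D"
  then obtain x y where xy: "x \<in> D" "y \<in> D" "z = x + scale \<i> y" by (auto simp: complexify_def)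
  then have "x \<in> g0" "y \<in> g0" using assms by auto
  from parts_eqI[OF this xy(3)] show "rp z \<in> D \<and> ip z \<in> D" using xy(1,2) by simp
next
  assume "rp z \<in> D \<and> ip z \<in> D"
  then show "z \<in> complexify D" unfolding complexify_def mem_Collect_eq
    by (intro exI[of _ "rp z"] exI[of _ "ip z"] conjI parts_sum[symmetric]) auto
qed

text \<open>One formula serves all \<open>D\<close>: the conjugation relative to a subset of
  \<open>g0\<close> restricts the one relative to \<open>g0\<close>. This reconciles the
  conjugations for \<open>\<kappa>0\<close> and for \<open>g0\<close>.\<close>

lemma conjugation_eq:
  assumes "D \<subseteq> g0" "z \<in> complexify D"
  shows "conjugation D z = \<sigma> z"
  unfolding conjugation_def
proof (rule the_equality)
  show "\<exists>x\<in>D. \<exists>y\<in>D. z = x + scale \<i> y \<and> \<sigma> z = x - scale \<i> y"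
    unfolding \<sigma>_def using assms(2)
    by (intro bexI[of _ "rp z"] bexI[of _ "ip z"] conjI parts_sum[symmetric] refl)
      (auto simp: complexify_iff[OF assms(1)])
  fix w assume "\<exists>x\<in>D. \<exists>y\<in>D. z = x + scale \<i> y \<and> w = x - scale \<i> y"
  then obtain x y where xy: "x \<in> D" "y \<in> D" "z = x + scale \<i> y" "w = x - scale \<i> y" by blast
  then have "x \<in> g0" "y \<in> g0" using assms by auto
  from parts_eqI[OF this xy(3)] show "w = \<sigma> z" using xy(4) by (simp add: \<sigma>_def)
qed

lemma complexify_fixed: "complexify {x\<in>g0. \<theta> x = x} = {z. \<Theta> z = z}"
proof -
  have "\<Theta> z = z \<longleftrightarrow> \<theta> (rp z) = rp z \<and> \<theta> (ip z) = ip z" for z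
    using eqI[of "\<Theta> z" z] rp_\<Theta>[of z] ip_\<Theta>[of z] by auto
  moreover have "z \<in> complexify {x\<in>g0. \<theta> x = x} \<longleftrightarrow> \<theta> (rp z) = rp z \<and> \<theta> (ip z) = ip z" for z
    by (subst complexify_iff) auto
  ultimately show ?thesis by blast
qed

lemma fixed_subspace: "re.subspace {x\<in>g0. \<theta> x = x}"
proof (rule re.subspaceI)
  have "\<theta> (scale (complex_of_real 0) 0) = scale (complex_of_real 0) (\<theta> 0)"
    by (rule \<theta>_scale[OF g0_intros(1)])
  then show "0 \<in> {x\<in>g0. \<theta> x = x}" by (simp add: g0_intros)
qed (auto simp: g0_intros \<theta>_add \<theta>_scale)

text \<open>The lower central series of the complexified \<open>h0\<close> stays inside the
  complexified series of \<open>h0\<close>, so it reaches 0, and stability under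
  \<open>\<tau>\<close> upgrades nilpotency to commutativity. For the centraliser condition, both
  parts of an element commuting with \<open>h0\<close> normalise \<open>h0\<close> and thus belong
  to it.\<close>

lemma adapted_cartan_decomposition:
  assumes "adapted g0 f \<theta> h0"
  shows "cartan_decomposition scale br \<tau> H (complexify h0) \<Theta>"
proof -
  have h0: "re.lie_subalgebra h0" "h0 \<subseteq> g0" "re.nilpotent h0" "{x \<in> g0. \<forall>y\<in>h0. br x y \<in> h0} = h0"
    and \<theta>h0: "\<theta> ` h0 = h0"
    using assms by (auto simp: adapted_def re.cartan_subalgebra_def)
  let ?h = "complexify h0"
  have sh0: "re.subspace h0" using h0(1) by (simp add: re.lie_subalgebra_def)
  have h0_br: "x \<in> h0 \<Longrightarrow> y \<in> h0 \<Longrightarrow> br x y \<in> h0" for x y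
    using h0(1) by (simp add: re.lie_subalgebra_def)
  have h: "z \<in> ?h \<longleftrightarrow> rp z \<in> h0 \<and> ip z \<in> h0" for z by (rule complexify_iff[OF h0(2)])
  have sh: "subspace ?h" by (rule subspace_complexify[OF sh0])
  have h\<theta>: "x \<in> h0 \<Longrightarrow> \<theta> x \<in> h0" for x using \<theta>h0 by blast
  have h\<tau>: "x \<in> ?h \<Longrightarrow> \<tau> x \<in> ?h" for x
    using h\<theta> re.subspace_neg[OF sh0] by (simp add: h rp_\<tau> ip_\<tau>)
  have h_sub: "lie_subalgebra ?h"
    using sh h0_br re.subspace_add[OF sh0] re.subspace_diff[OF sh0]
    by (simp add: lie_subalgebra_def h rp_br ip_br)
  have stable: "stable ?h" using h_sub h\<tau> by (simp add: stable_def)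
  have step: "commutator ?h (complexify D) \<subseteq> complexify (re.commutator h0 D)" if D: "D \<subseteq> h0" for D
  proof (rule commutator_least[OF subspace_complexify[OF re.commutator_subspace]])
    have sub: "re.commutator h0 D \<subseteq> g0"
      by (rule re.commutator_least[OF g0_subspace]) (use D h0(2) g0_br in blast)
    fix x y assume "x \<in> ?h" "y \<in> complexify D"
    then have "rp x \<in> h0" "ip x \<in> h0" "rp y \<in> D" "ip y \<in> D"
      using h complexify_iff[of D y] D h0(2) by auto
    then show "br x y \<in> complexify (re.commutator h0 D)"
      unfolding complexify_iff[OF sub] rp_br ip_br
      by (intro conjI re.subspace_add[OF re.commutator_subspace] re.subspace_diff[OF re.commutator_subspace]
          re.br_in_commutator)
  qed
  define D where "D k = ((\<lambda>C. re.commutator h0 C) ^^ k) h0" for k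
  define E where "E k = ((\<lambda>C. commutator ?h C) ^^ k) ?h" for k
  have Dh: "D k \<subseteq> h0" for k
  proof (induction k)
    case (Suc k)
    have "re.commutator h0 (D k) \<subseteq> h0"
      by (rule re.commutator_least[OF sh0]) (use Suc h0_br in blast)
    then show ?case by (simp add: D_def)
  qed (simp add: D_def)
  have ED: "E k \<subseteq> complexify (D k)" for k
  proof (induction k)
    case (Suc k)
    have "E (Suc k) \<subseteq> commutator ?h (complexify (D k))"
      using commutator_mono[OF subset_refl Suc] by (simp add: E_def)
    then show ?case using step[OF Dh[of k]] by (simp add: D_def)
  qed (simp add: D_def E_def)
  obtain k where k: "D k = {0}" using h0(3) by (auto simp: re.nilpotent_def D_def)
  have "E k \<subseteq> {0}" using ED[of k] unfolding k by (auto simp: complexify_def)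
  moreover have "subspace (E k)" by (cases k) (auto simp: E_def sh commutator_subspace)
  ultimately have "E k = {0}" using subspace_0 by blast
  then have nil: "nilpotent ?h" unfolding nilpotent_def E_def by blast
  show ?thesis
  proof unfold_locales
    show "subspace ?h" by (rule sh)
    show "\<tau> x \<in> ?h" if "x \<in> ?h" for x by (rule h\<tau>[OF that])
    show "br x y = 0" if "x \<in> ?h" "y \<in> ?h" for x y
      by (rule stable_nilpotent_abelian[OF stable nil that])
    show "z \<in> ?h" if z: "\<And>x. x \<in> ?h \<Longrightarrow> br x z = 0" for z
    proof -
      have "br (rp z) x = 0 \<and> br (ip z) x = 0" if "x \<in> h0" for x
      proof -
        have x: "x \<in> g0" using that h0(2) by blast
        have "x \<in> ?h" using that re.subspace_0[OF sh0] by (simp add: h rp_real[OF x] ip_real[OF x])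
        then have "rp (br x z) = 0" "ip (br x z) = 0"
          using z rp_real[OF g0_intros(1)] ip_real[OF g0_intros(1)] by simp_all
        then have "br x (rp z) = 0" "br x (ip z) = 0"
          unfolding rp_br ip_br rp_real[OF x] ip_real[OF x] by simp_all
        then show ?thesis using br_anti[of "rp z" x] br_anti[of "ip z" x] by simp
      qed
      then have "rp z \<in> {x \<in> g0. \<forall>y\<in>h0. br x y \<in> h0}" "ip z \<in> {x \<in> g0. \<forall>y\<in>h0. br x y \<in> h0}"
        using re.subspace_0[OF sh0] by auto
      then show ?thesis unfolding h0(4) h by simp
    qed
    show "\<Theta> x \<in> ?h" if "x \<in> ?h" for x using that h\<theta> by (simp add: h rp_\<Theta> ip_\<Theta>)
    show "\<Theta> (x + y) = \<Theta> x + \<Theta> y" "\<Theta> (scale c x) = scale c (\<Theta> x)"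
      "\<Theta> (br x y) = br (\<Theta> x) (\<Theta> y)" "\<Theta> (\<Theta> x) = x" "\<Theta> (\<tau> x) = \<tau> (\<Theta> x)" for x y c
      by (rule \<Theta>_involution)+
    show "H (\<Theta> x) (\<Theta> y) = H x y" for x y
      by (simp add: H_def B_\<Theta> flip: \<Theta>_involution(5))
    show "H x z = 0" if "\<And>y. (br x ^^ m) y = 0" "br x (\<tau> z) = 0" for x m z
      using B_nilpotent_commuting[OF that] by (simp add: H_def)
  qed
qed

text \<open>The third conclusion, that \<open>f\<close> is its own normaliser, is the link to the
  orbit: it lets derivatives of the coordinates detect membership in \<open>f\<close>.\<close>

theorem maximal_compact_reductive_complement:
  assumes f: "lie_subalgebra f" and ad: "adapted g0 f \<theta> h0"
    and k0: "\<kappa>0 = {x\<in>g0. \<theta> x = x}" and k: "\<kappa> = complexify \<kappa>0" and v: "v = f \<inter> \<kappa>"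
  shows "reductive_complement (v \<inter> conjugation g0 ` v) (nil_ideal \<kappa> v) v"
    and "conjugation \<kappa>0 ` v = conjugation g0 ` v"
    and "(\<And>y. y \<in> f \<Longrightarrow> br z y \<in> f) \<Longrightarrow> z \<in> f"
proof -
  interpret cd: cartan_decomposition scale br \<tau> H "complexify h0" \<Theta>
    by (rule adapted_cartan_decomposition[OF ad])
  have hf: "complexify h0 \<subseteq> f"
  proof
    fix z assume "z \<in> complexify h0"
    then obtain x y where xy: "x \<in> h0" "y \<in> h0" "z = x + scale \<i> y" by (auto simp: complexify_def)
    have "h0 \<subseteq> f" using ad by (simp add: adapted_def)
    then show "z \<in> f" unfolding xy(3) using xy(1,2) lie_subalgebra_subspace[OF f]
      by (intro subspace_add subspace_scale) auto
  qed
  have k_eq: "\<kappa> = cd.\<kappa>" unfolding k k0 complexify_fixed cd.\<kappa>_def by simp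
  have UNIV_eq: "complexify g0 = UNIV" using real_form by (simp add: real_form_def)
  have conj: "conjugation g0 z = \<sigma> z" for z by (rule conjugation_eq) (auto simp: UNIV_eq)
  \<comment> \<open>On \<kappa> the extended Cartan involution is the identity, so the two
    conjugations coincide there.\<close>
  have \<sigma>\<tau>: "\<sigma> x = \<tau> x" if "x \<in> \<kappa>" for x
    using that by (simp add: k_eq cd.\<kappa>_def \<tau>_def)
  have "v \<inter> conjugation g0 ` v = {x\<in>v. \<tau> x \<in> v}"
  proof (intro set_eqI iffI)
    fix x assume "x \<in> v \<inter> conjugation g0 ` v"
    then obtain y where "x \<in> v" "y \<in> v" "x = \<sigma> y" using conj by auto
    then show "x \<in> {x\<in>v. \<tau> x \<in> v}" using \<sigma>\<tau>[of x] v by (auto simp: \<sigma>_\<sigma>)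
  next
    fix x assume x: "x \<in> {x\<in>v. \<tau> x \<in> v}"
    then have "\<sigma> x \<in> v" using \<sigma>\<tau>[of x] v by simp
    moreover have "x = conjugation g0 (\<sigma> x)" by (simp add: conj \<sigma>_\<sigma>)
    ultimately
    show "x \<in> v \<inter> conjugation g0 ` v" using x by blast
  qed
  then show "reductive_complement (v \<inter> conjugation g0 ` v) (nil_ideal \<kappa> v) v"
    using cd.reductive_complement_levi[OF f hf] v k_eq by simp
  have "conjugation \<kappa>0 z = conjugation g0 z" if "z \<in> v" for z
    unfolding conj by (rule conjugation_eq) (use that v k k0 in auto)
  then show "conjugation \<kappa>0 ` v = conjugation g0 ` v" by (rule image_cong[OF refl])
  show "z \<in> f" if "\<And>y. y \<in> f \<Longrightarrow> br z y \<in> f" by (rule cd.self_normalizing[OF f hf that])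
qed

end

section \<open>The compact orbit in the flag manifold\<close>

locale group_orbit = complex_lie_algebra scale br + flag_manifold \<iota> G f
  for scale :: "complex \<Rightarrow> 'g::ab_group_add \<Rightarrow> 'g" and br
    and \<iota> :: "'g \<Rightarrow> complex^'n^'n" and G f +
  fixes K :: "(complex^'n^'n) set" and \<kappa>0 :: "'g set"
  assumes ident: "lie_identification \<iota> G" and G: "linear_group G"
    and K: "linear_group K" "compact K" "K \<subseteq> G" and LK: "group_lie_algebra K = \<iota> ` \<kappa>0"
    and \<kappa>0: "re.subspace \<kappa>0" and f: "lie_subalgebra f"
    and self_normalizing: "(\<And>y. y \<in> f \<Longrightarrow> br z y \<in> f) \<Longrightarrow> z \<in> f"
begin

lemma \<iota>_inj: "\<iota> x = \<iota> y \<longleftrightarrow> x = y" and \<iota>_range: "range \<iota> = group_lie_algebra G"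
  and \<iota>_add: "\<iota> (x + y) = \<iota> x + \<iota> y" and \<iota>_scale: "\<iota> (scale c x) = mat c ** \<iota> x"
  and \<iota>_br: "\<iota> (br x y) = \<iota> x ** \<iota> y - \<iota> y ** \<iota> x"
  using ident by (auto simp: lie_identification_def inj_eq)

lemma \<iota>_image_iff: "\<iota> x \<in> \<iota> ` A \<longleftrightarrow> x \<in> A"
  by (auto simp: \<iota>_inj)

lemma \<iota>_0: "\<iota> 0 = 0"
  using \<iota>_scale[of 0 0] by (simp add: vec_eq_iff mat_mult_entry)

lemma f_subspace: "subspace f"
  using f by (simp add: lie_subalgebra_def)

sublocale matrix_flag "\<iota> ` f"
proof
  show "0 \<in> \<iota> ` f" using \<iota>_0 subspace_0[OF f_subspace] by (metis imageI)
  show "X + Y \<in> \<iota> ` f" if "X \<in> \<iota> ` f" "Y \<in> \<iota> ` f" for X Y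
    using that subspace_add[OF f_subspace] by (auto simp flip: \<iota>_add)
  show "mat c ** X \<in> \<iota> ` f" if "X \<in> \<iota> ` f" for c X
    using that subspace_scale[OF f_subspace] by (auto simp flip: \<iota>_scale)
qed

abbreviation act :: "complex^'n^'n \<Rightarrow> 'g set \<Rightarrow> 'g set" where
  "act a S \<equiv> Ad \<iota> a ` S"

lemma G_inv: "a \<in> G \<Longrightarrow> a ** matrix_inv a = mat 1" "a \<in> G \<Longrightarrow> matrix_inv a ** a = mat 1"
  by (simp_all add: matrix_inv_mult linear_group_invertible[OF G])

lemma G_intros: "mat 1 \<in> G" "a \<in> G \<Longrightarrow> b \<in> G \<Longrightarrow> a ** b \<in> G" "a \<in> G \<Longrightarrow> matrix_inv a \<in> G"
  using G by (auto simp: linear_group_def)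

lemma mexp_G: "mexp (t *\<^sub>R \<iota> x) \<in> G"
  using \<iota>_range by (auto simp: group_lie_algebra_def)

text \<open>\<open>Ad\<close> is defined through an inverse of \<open>\<iota>\<close>, so the
  conjugate must first be seen to lie in the Lie algebra of \<open>G\<close>: its exponentials are
  conjugates of elements of \<open>G\<close>.\<close>

lemma \<iota>_Ad:
  assumes "a \<in> G"
  shows "\<iota> (Ad \<iota> a x) = conjg a (\<iota> x)"
proof -
  have "mexp (t *\<^sub>R conjg a (\<iota> x)) = a ** mexp (t *\<^sub>R \<iota> x) ** matrix_inv a" for t
    unfolding conjg_def by (rule mexp_conjugate) (simp_all add: G_inv assms)
  then have "conjg a (\<iota> x) \<in> range \<iota>"
    unfolding \<iota>_range group_lie_algebra_def by (simp add: G_intros assms mexp_G)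
  then show ?thesis unfolding Ad_def conjg_def[symmetric] by (rule f_inv_into_f)
qed

lemma Ad_mult: "a \<in> G \<Longrightarrow> b \<in> G \<Longrightarrow> Ad \<iota> a (Ad \<iota> b x) = Ad \<iota> (a ** b) x"
proof -
  assume ab: "a \<in> G" "b \<in> G"
  have "matrix_inv (a ** b) = matrix_inv b ** matrix_inv a"
  proof (rule matrix_inv_unique)
    have "a ** b ** (matrix_inv b ** matrix_inv a) = a ** (b ** matrix_inv b) ** matrix_inv a"
      by (simp only: matrix_mul_assoc)
    then show "a ** b ** (matrix_inv b ** matrix_inv a) = mat 1" by (simp add: G_inv ab)
    have "matrix_inv b ** matrix_inv a ** (a ** b) = matrix_inv b ** (matrix_inv a ** a) ** b"
      by (simp only: matrix_mul_assoc)
    then show "matrix_inv b ** matrix_inv a ** (a ** b) = mat 1" by (simp add: G_inv ab)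
  qed
  then have "\<iota> (Ad \<iota> a (Ad \<iota> b x)) = \<iota> (Ad \<iota> (a ** b) x)"
    by (simp add: \<iota>_Ad ab G_intros conjg_def matrix_mul_assoc)
  then show ?thesis by (simp add: \<iota>_inj)
qed

lemma act_mult: "a \<in> G \<Longrightarrow> b \<in> G \<Longrightarrow> act a (act b S) = act (a ** b) S"
  by (simp add: image_image Ad_mult)

lemma act_one [simp]: "act (mat 1) S = S"
proof -
  have "\<iota> (Ad \<iota> (mat 1) x) = \<iota> x" for x by (simp add: \<iota>_Ad G_intros conjg_def)
  then show ?thesis by (simp add: \<iota>_inj)
qed

lemma act_inv: "a \<in> G \<Longrightarrow> act (matrix_inv a) (act a S) = S" "a \<in> G \<Longrightarrow> act a (act (matrix_inv a) S) = S"
  by (simp_all add: act_mult G_intros G_inv)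

lemma \<iota>_act: "a \<in> G \<Longrightarrow> \<iota> ` act a S = conjg a ` \<iota> ` S"
  by (simp add: image_image \<iota>_Ad)

lemma act_stab: "a \<in> G \<Longrightarrow> b \<in> G \<Longrightarrow> act a f = act b f \<Longrightarrow> act (matrix_inv a ** b) f = f"
  using act_mult[of "matrix_inv a" b f] act_inv(1)[of a f] by (simp add: G_intros)

text \<open>Invariance under the bracket gives one inclusion for every \<open>t\<close>; the
  inclusion for \<open>- t\<close> supplies the other.\<close>

lemma act_mexp_f:
  assumes "z \<in> f"
  shows "act (mexp (t *\<^sub>R \<iota> z)) f = f"
proof -
  have sub: "act (mexp (t *\<^sub>R \<iota> z)) f \<subseteq> f" for t
  proof
    fix y assume "y \<in> act (mexp (t *\<^sub>R \<iota> z)) f"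
    then obtain x where x: "x \<in> f" "\<iota> y = conjg (mexp (t *\<^sub>R \<iota> z)) (\<iota> x)" by (auto simp: \<iota>_Ad mexp_G)
    have "conjg (mexp (t *\<^sub>R \<iota> z)) (\<iota> x) \<in> \<iota> ` f"
    proof (rule conjg_mexp_invariant)
      show "\<iota> z ** Y - Y ** \<iota> z \<in> \<iota> ` f" if "Y \<in> \<iota> ` f" for Y
        using that f assms by (auto simp: lie_subalgebra_def simp flip: \<iota>_br)
      show "\<iota> x \<in> \<iota> ` f" using x(1) by blast
    qed
    then show "y \<in> f" unfolding x(2)[symmetric] by (auto simp: \<iota>_inj)
  qed
  have "f = act (mexp (t *\<^sub>R \<iota> z)) (act (mexp ((- t) *\<^sub>R \<iota> z)) f)"
    by (simp only: act_mult mexp_G mexp_minus_right act_one)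
  also have "\<dots> \<subseteq> act (mexp (t *\<^sub>R \<iota> z)) f" by (rule image_mono[OF sub])
  finally show ?thesis using sub by blast
qed

section \<open>Coordinates on the flag manifold and lifted curves\<close>

text \<open>The function that \<open>P\<close> induces on the flag manifold; by \<open>P_eq\<close>
  the choice of \<open>b\<close> is immaterial. It is meaningful on points that come from
  \<open>G \<inter> \<Omega>\<close> and arbitrary elsewhere.\<close>

definition coord :: "'g set \<Rightarrow> complex^('n \<times> 'n)^('n \<times> 'n)" where
  "coord S = P (SOME b. b \<in> G \<inter> \<Omega> \<and> act b f = S)"

lemma coord_act:
  assumes b: "b \<in> G \<inter> \<Omega>"
  shows "coord (act b f) = P b"
proof -
  define b' where "b' = (SOME c. c \<in> G \<inter> \<Omega> \<and> act c f = act b f)"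
  have b': "b' \<in> G \<inter> \<Omega> \<and> act b' f = act b f"
    unfolding b'_def using b by (intro someI[of "\<lambda>c. c \<in> G \<inter> \<Omega> \<and> act c f = act b f" b]) simp
  have "P b' = P b"
    using b b' \<iota>_act[of b' f] \<iota>_act[of b f] by (intro P_eq) auto
  then show ?thesis by (simp add: coord_def b'_def)
qed

lemma holomorphic_near_coord:
  assumes "b \<in> G \<inter> \<Omega>"
  shows "holomorphic_near (act b f) (\<lambda>S. coord S $ p $ q)"
  unfolding holomorphic_near_def
  using assms holomorphic_P[unfolded holomorphic_matrix_def, rule_format, of p q] coord_act
  by (intro exI[of _ b] exI[of _ \<Omega>] exI[of _ "\<lambda>b. P b $ p $ q"]) (simp add: open_\<Omega>)

text \<open>A smooth germ at a point is represented near some \<open>a\<close> in \<open>G\<close>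
  over that point, which need not be the given lift \<open>g w\<close>. The two differ by an element
  \<open>s\<close> of the stabiliser, and right translation by \<open>s\<close> moves the lift to
  \<open>a\<close> without changing the points.\<close>

lemma smooth_map_lift:
  fixes g :: "'a::real_normed_vector \<Rightarrow> complex^'n^'n"
  assumes g: "smooth_on UNIV g" "\<And>w. w \<in> S \<Longrightarrow> g w \<in> G"
  shows "smooth_map S (\<lambda>w. act (g w) f)"
  unfolding smooth_map_def
proof (intro ballI conjI allI impI)
  fix w assume w: "w \<in> S"
  show "act (g w) f \<in> Flag" using g(2)[OF w] by (auto simp: Ad_orbit_def)
  fix \<phi> assume "smooth_near (act (g w) f) \<phi>"
  then obtain a W \<Psi> where a: "a \<in> G" "act (g w) f = act a f" "open W" "a \<in> W" "smooth_on W \<Psi>"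
    "\<And>b. b \<in> W \<inter> G \<Longrightarrow> \<phi> (act b f) = \<Psi> b" unfolding smooth_near_def by blast
  define s where "s = matrix_inv (g w) ** a"
  have s: "s \<in> G" "act s f = f"
    using act_stab[OF g(2)[OF w] a(1,2)] a(1) g(2)[OF w] by (auto simp: s_def G_intros)
  define h where "h w' = g w' ** s" for w'
  have h: "smooth_on UNIV h" unfolding h_def
    by (rule smooth_on_linear_compose[OF open_UNIV matrix_mult.bounded_linear_left g(1)])
  have op: "open (h -` W)" by (rule open_vimage[OF a(3) smooth_on_continuous[OF h]])
  have "g w ** s = a" unfolding s_def matrix_mul_assoc by (simp add: G_inv g(2)[OF w])
  then have "w \<in> h -` W" using a(4) by (simp add: h_def)
  moreover have "smooth_on (h -` W) (\<lambda>w'. \<Psi> (h w'))"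
    by (rule smooth_on_compose[OF a(3) op a(5) smooth_on_subset[OF open_UNIV op _ h]]) auto
  moreover have "\<phi> (act (g w') f) = \<Psi> (h w')" if "w' \<in> h -` W \<inter> S" for w'
  proof -
    have w': "g w' \<in> G" using g(2) that by blast
    have "act (h w') f = act (g w') f" unfolding h_def using act_mult[OF w' s(1), of f] s(2) by simp
    then show ?thesis using a(6)[of "h w'"] that w' s(1) by (simp add: h_def G_intros)
  qed
  ultimately show "\<exists>W \<Psi>. open W \<and> w \<in> W \<and> smooth_on W \<Psi> \<and> (\<forall>w'\<in>W \<inter> S. \<phi> (act (g w') f) = \<Psi> w')"
    using op by blast
qed

text \<open>\<open>matrix_inv (g 0) ** a\<close> is the stabiliser element that moves the lift to
  the point \<open>a\<close> at which the function is represented; the rest is the chain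
  rule.\<close>

lemma velocity_lift:
  assumes g: "continuous_on UNIV g" "(g has_vector_derivative g') (at 0)" "\<And>t. g t \<in> G"
    and a: "a \<in> G" "act (g 0) f = act a f" "open W" "a \<in> W" "smooth_on W \<Psi>"
      "\<And>b. b \<in> W \<inter> G \<Longrightarrow> \<phi> (act b f) = \<Psi> b"
    and D: "(\<Psi> has_derivative D) (at a)"
  shows "velocity (\<lambda>t. act (g t) f) \<phi> = D (g' ** (matrix_inv (g 0) ** a))"
proof -
  define s where "s = matrix_inv (g 0) ** a"
  have s: "s \<in> G" "act s f = f"
    using act_stab[OF g(3) a(1,2)] a(1) g(3) by (auto simp: s_def G_intros)
  have g0s: "g 0 ** s = a" unfolding s_def matrix_mul_assoc by (simp add: G_inv g(3))
  have near: "smooth_near (act (g 0) f) \<phi>" unfolding smooth_near_def using a by blast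
  have h: "((\<lambda>t. g t ** s) has_vector_derivative g' ** s) (at 0)"
    by (rule bounded_linear.has_vector_derivative[OF matrix_mult.bounded_linear_left g(2)])
  have "((\<lambda>t. \<Psi> (g t ** s)) has_derivative (\<lambda>t. D (t *\<^sub>R (g' ** s)))) (at 0)"
    using has_derivative_compose[OF h[unfolded has_vector_derivative_def], of \<Psi> D] D g0s by simp
  then have d: "((\<lambda>t. \<Psi> (g t ** s)) has_vector_derivative D (g' ** s)) (at 0)"
    using linear_scale[OF has_derivative_linear[OF D]] by (simp add: has_vector_derivative_def)
  have op: "open ((\<lambda>t. g t ** s) -` W)"
    by (rule open_vimage[OF a(3) bounded_linear.continuous_on[OF matrix_mult.bounded_linear_left g(1)]])
  have eq: "\<Psi> (g t ** s) = \<phi> (act (g t) f)" if "t \<in> (\<lambda>t. g t ** s) -` W" for t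
    using a(6)[of "g t ** s"] that g(3) s act_mult[OF g(3) s(1), of t f] by (simp add: G_intros)
  have "((\<lambda>t. \<phi> (act (g t) f)) has_vector_derivative D (g' ** s)) (at 0)"
    by (rule has_vector_derivative_transform_within_open[OF d op _ eq]) (use g0s a(4) in auto)
  then show ?thesis using near unfolding velocity_def s_def by (simp add: vector_derivative_at)
qed

section \<open>Equivariance of germs, tangent vectors and \<open>T01\<close>\<close>

lemma smooth_near_act:
  assumes k: "k \<in> G" and "smooth_near x (\<lambda>S. \<phi> (act k S))"
  shows "smooth_near (act k x) \<phi>"
proof -
  obtain a W \<Psi> where a: "a \<in> G" "x = act a f" "open W" "a \<in> W" "smooth_on W \<Psi>"
    "\<And>b. b \<in> W \<inter> G \<Longrightarrow> \<phi> (act k (act b f)) = \<Psi> b"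
    using assms(2) unfolding smooth_near_def by blast
  define h where "h b = matrix_inv k ** b" for b :: "complex^'n^'n"
  have bl: "bounded_linear h" unfolding h_def by (rule matrix_mult.bounded_linear_right)
  have op: "open (h -` W)" by (rule open_vimage[OF a(3) linear_continuous_on[OF bl]])
  have "h (k ** a) = a" by (simp add: h_def matrix_mul_assoc G_inv k)
  then have "k ** a \<in> h -` W" using a(4) by simp
  moreover have "smooth_on (h -` W) (\<lambda>b. \<Psi> (h b))"
    by (rule smooth_on_compose[OF a(3) op a(5) smooth_on_linear[OF op bl]]) auto
  moreover have "\<phi> (act b f) = \<Psi> (h b)" if "b \<in> h -` W \<inter> G" for b
  proof -
    have hb: "h b \<in> G" using that k by (simp add: h_def G_intros)
    have "k ** h b = b" by (simp add: h_def matrix_mul_assoc G_inv k)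
    then show ?thesis using a(6)[of "h b"] that hb act_mult[OF k hb, of f] by simp
  qed
  moreover have "act k x = act (k ** a) f" using a(1,2) k by (simp add: act_mult)
  ultimately show ?thesis unfolding smooth_near_def using op a(1) k
    by (intro exI[of _ "k ** a"] exI[of _ "h -` W"] exI[of _ "\<lambda>b. \<Psi> (h b)"]) (auto simp: G_intros)
qed

lemma smooth_near_act_iff:
  assumes k: "k \<in> G"
  shows "smooth_near x (\<lambda>S. \<phi> (act k S)) \<longleftrightarrow> smooth_near (act k x) \<phi>"
proof
  assume "smooth_near (act k x) \<phi>"
  then have "smooth_near (act k x) (\<lambda>S. \<phi> (act k (act (matrix_inv k) S)))" by (simp add: act_inv k)
  from smooth_near_act[OF G_intros(3)[OF k], where \<phi> = "\<lambda>S. \<phi> (act k S)", OF this]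
  show "smooth_near x (\<lambda>S. \<phi> (act k S))" by (simp add: act_inv k)
qed (rule smooth_near_act[OF k])

lemma mat_mult_commute: "X ** mat c = mat c ** (X :: complex^'m^'m)"
  by (simp add: vec_eq_iff mat_mult_entry)
    (simp add: matrix_matrix_mult_def mat_def if_distrib[of "\<lambda>x. _ * x"] mult.commute cong: if_cong)

lemma holomorphic_near_act:
  assumes k: "k \<in> G" and "holomorphic_near x (\<lambda>S. \<phi> (act k S))"
  shows "holomorphic_near (act k x) \<phi>"
proof -
  obtain a W \<Psi> where a: "a \<in> G" "x = act a f" "open W" "a \<in> W" "holomorphic_on_matrices W \<Psi>"
    "\<And>b. b \<in> W \<inter> G \<Longrightarrow> \<phi> (act k (act b f)) = \<Psi> b"
    using assms(2) unfolding holomorphic_near_def by blast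
  define h where "h b = matrix_inv k ** b" for b :: "complex^'n^'n"
  have bl: "bounded_linear h" unfolding h_def by (rule matrix_mult.bounded_linear_right)
  have op: "open (h -` W)" by (rule open_vimage[OF a(3) linear_continuous_on[OF bl]])
  have "h (k ** a) = a" by (simp add: h_def matrix_mul_assoc G_inv k)
  then have "k ** a \<in> h -` W" using a(4) by simp
  moreover have "holomorphic_on_matrices (h -` W) (\<lambda>b. \<Psi> (h b))"
  proof (rule holomorphic_on_matricesI)
    show "smooth_on (h -` W) (\<lambda>b. \<Psi> (h b))"
      by (rule smooth_on_compose[OF a(3) op holomorphic_on_matrices_smooth[OF a(5)] smooth_on_linear[OF op bl]]) auto
    fix b assume "b \<in> h -` W"
    then have "h b \<in> W" by simp
    obtain D where D: "(\<Psi> has_derivative D) (at (h b))" "\<And>X. D (mat \<i> ** X) = \<i> * D X"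
      by (rule holomorphic_on_matrices_derivative[OF a(5) \<open>h b \<in> W\<close>]) blast
    have "((\<lambda>b. \<Psi> (h b)) has_derivative (\<lambda>X. D (h X))) (at b)"
      by (rule has_derivative_compose[OF bounded_linear_imp_has_derivative[OF bl] D(1)])
    moreover have "h (mat \<i> ** X) = mat \<i> ** h X" for X
      unfolding h_def matrix_mul_assoc mat_mult_commute ..
    ultimately show "\<exists>D. ((\<lambda>b. \<Psi> (h b)) has_derivative D) (at b) \<and> (\<forall>X. D (mat \<i> ** X) = \<i> * D X)"
      using D(2) by auto
  qed
  moreover have "\<phi> (act b f) = \<Psi> (h b)" if "b \<in> h -` W \<inter> G" for b
  proof -
    have hb: "h b \<in> G" using that k by (simp add: h_def G_intros)
    have "k ** h b = b" by (simp add: h_def matrix_mul_assoc G_inv k)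
    then show ?thesis using a(6)[of "h b"] that hb act_mult[OF k hb, of f] by simp
  qed
  moreover have "act k x = act (k ** a) f" using a(1,2) k by (simp add: act_mult)
  ultimately show ?thesis unfolding holomorphic_near_def using op a(1) k
    by (intro exI[of _ "k ** a"] exI[of _ "h -` W"] exI[of _ "\<lambda>b. \<Psi> (h b)"]) (auto simp: G_intros)
qed

lemma holomorphic_near_act_iff:
  assumes k: "k \<in> G"
  shows "holomorphic_near x (\<lambda>S. \<phi> (act k S)) \<longleftrightarrow> holomorphic_near (act k x) \<phi>"
proof
  assume "holomorphic_near (act k x) \<phi>"
  then have "holomorphic_near (act k x) (\<lambda>S. \<phi> (act k (act (matrix_inv k) S)))" by (simp add: act_inv k)
  from holomorphic_near_act[OF G_intros(3)[OF k], where \<phi> = "\<lambda>S. \<phi> (act k S)", OF this]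
  show "holomorphic_near x (\<lambda>S. \<phi> (act k S))" by (simp add: act_inv k)
qed (rule holomorphic_near_act[OF k])

lemma act_Flag: "k \<in> G \<Longrightarrow> x \<in> Flag \<Longrightarrow> act k x \<in> Flag"
  by (auto simp: Ad_orbit_def act_mult intro!: G_intros)
    (metis G_intros(2) act_mult)

lemma smooth_map_act:
  assumes k: "k \<in> G" and p: "smooth_map S p"
  shows "smooth_map S (\<lambda>w. act k (p w))"
  unfolding smooth_map_def
proof (intro ballI conjI allI impI)
  fix w assume w: "w \<in> S"
  show "act k (p w) \<in> Flag" using p w by (intro act_Flag k) (simp add: smooth_map_def)
  fix \<phi> assume "smooth_near (act k (p w)) \<phi>"
  then have "smooth_near (p w) (\<lambda>S. \<phi> (act k S))" by (simp add: smooth_near_act_iff k)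
  then show "\<exists>W \<Psi>. open W \<and> w \<in> W \<and> smooth_on W \<Psi> \<and> (\<forall>w'\<in>W \<inter> S. \<phi> (act k (p w')) = \<Psi> w')"
    using p w unfolding smooth_map_def by blast
qed

text \<open>The differential of the translation by \<open>k\<close>, acting on derivations.\<close>

definition push :: "complex^'n^'n \<Rightarrow> (('g set \<Rightarrow> complex) \<Rightarrow> complex) \<Rightarrow> ('g set \<Rightarrow> complex) \<Rightarrow> complex" where
  "push k D = (\<lambda>\<phi>. D (\<lambda>S. \<phi> (act k S)))"

lemma velocity_act: "k \<in> G \<Longrightarrow> velocity (\<lambda>t. act k (c t)) = push k (velocity c)"
  by (auto simp: velocity_def push_def smooth_near_act_iff fun_eq_iff)

lemma push_inv: "k \<in> G \<Longrightarrow> push k (push (matrix_inv k) D) = D" "k \<in> G \<Longrightarrow> push (matrix_inv k) (push k D) = D"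
  by (simp_all add: push_def act_inv)

lemma push_tangent_space:
  assumes k: "k \<in> G" and M: "\<And>x. x \<in> M \<Longrightarrow> act k x \<in> M" and D: "D \<in> tangent_space M x"
  shows "push k D \<in> tangent_space M (act k x)"
proof -
  obtain c e where c: "D = velocity c" "c 0 = x" "e > 0" "smooth_map {-e<..<e} c" "c ` {-e<..<e} \<subseteq> M"
    using D unfolding tangent_space_def by blast
  have "push k D = velocity (\<lambda>t. act k (c t))" using velocity_act[OF k] c(1) by simp
  moreover have "smooth_map {-e<..<e} (\<lambda>t. act k (c t))" by (rule smooth_map_act[OF k c(4)])
  moreover have "(\<lambda>t. act k (c t)) ` {-e<..<e} \<subseteq> M" using M c(5) by auto
  ultimately show ?thesis unfolding tangent_space_def using c(2,3) by blast
qed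

lemma push_T01:
  assumes k: "k \<in> G" and M: "\<And>x. x \<in> M \<Longrightarrow> act k x \<in> M" and D: "D \<in> T01 M x"
  shows "push k D \<in> T01 M (act k x)"
proof -
  obtain D1 D2 where D12: "D = (\<lambda>\<phi>. D1 \<phi> + \<i> * D2 \<phi>)" "D1 \<in> tangent_space M x" "D2 \<in> tangent_space M x"
    using D unfolding T01_def complex_tangent_space_def by blast
  have "push k D = (\<lambda>\<phi>. push k D1 \<phi> + \<i> * push k D2 \<phi>)" by (simp add: push_def D12(1))
  then have "push k D \<in> complex_tangent_space M (act k x)"
    unfolding complex_tangent_space_def
    using push_tangent_space[OF k M D12(2)] push_tangent_space[OF k M D12(3)] by blast
  moreover have "push k D \<phi> = 0" if "holomorphic_near (act k x) \<phi>" for \<phi>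
    using D that by (simp add: push_def T01_def holomorphic_near_act_iff k)
  ultimately show ?thesis by (simp add: T01_def)
qed

text \<open>The dimension is taken inside the space of all functionals, so a maximal independent
  subset is transported through the injective linear map \<open>push k\<close>.\<close>

lemma dim_push:
  assumes k: "k \<in> G"
  shows "vector_space.dim (\<lambda>(c::complex) D \<phi>. c * D \<phi>) (push k ` S)
       = vector_space.dim (\<lambda>(c::complex) D \<phi>. c * D \<phi>) S"
proof -
  interpret fs: vector_space "\<lambda>(c::complex) (D :: ('g set \<Rightarrow> complex) \<Rightarrow> complex) \<phi>. c * D \<phi>"
    by unfold_locales (auto simp: fun_eq_iff algebra_simps)
  interpret lin: Vector_Spaces.linear "\<lambda>(c::complex) (D :: ('g set \<Rightarrow> complex) \<Rightarrow> complex) \<phi>. c * D \<phi>"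
    "\<lambda>(c::complex) (D :: ('g set \<Rightarrow> complex) \<Rightarrow> complex) \<phi>. c * D \<phi>" "push k"
    by unfold_locales (auto simp: fun_eq_iff push_def)
  have inj: "inj (push k)" by (rule inj_on_inverseI[of _ "push (matrix_inv k)"]) (rule push_inv(2)[OF k])
  obtain b where b: "b \<subseteq> S" "fs.independent b" "S \<subseteq> fs.span b"
    using fs.maximal_independent_subset by blast
  have "fs.independent (push k ` b)"
    by (rule lin.independent_injective_image[OF b(2) inj_on_subset[OF inj]]) simp
  moreover have "push k ` S \<subseteq> fs.span (push k ` b)" using b(3) lin.span_image[of b] by blast
  ultimately have "card (push k ` b) = fs.dim (push k ` S)"
    using b(1) by (intro fs.basis_card_eq_dim) auto
  moreover have "card b = fs.dim S" by (rule fs.basis_card_eq_dim[OF b(1,3,2)])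
  moreover have "card (push k ` b) = card b" by (rule card_image[OF inj_on_subset[OF inj]]) simp
  ultimately show ?thesis by simp
qed

abbreviation M :: "'g set set" where
  "M \<equiv> Ad_orbit \<iota> K f"

lemma act_M: "k \<in> K \<Longrightarrow> x \<in> M \<Longrightarrow> act k x \<in> M"
proof -
  assume k: "k \<in> K" and "x \<in> M"
  then obtain a where a: "a \<in> K" "x = act a f" by (auto simp: Ad_orbit_def)
  have "act k x = act (k ** a) f" "k ** a \<in> K"
    using a k K(3) by (auto simp: act_mult subset_iff linear_group_mult[OF K(1)])
  then show ?thesis by (auto simp: Ad_orbit_def)
qed

lemma f_in_M: "f \<in> M"
  unfolding Ad_orbit_def using linear_group_one[OF K(1)] act_one[of f] by (metis (mono_tags, lifting) mem_Collect_eq)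

lemma orbit_M: "x \<in> M \<Longrightarrow> Ad_orbit \<iota> K x = M"
proof
  assume x: "x \<in> M"
  then obtain a where a: "a \<in> K" "x = act a f" by (auto simp: Ad_orbit_def)
  show "Ad_orbit \<iota> K x \<subseteq> M" using act_M[OF _ x] by (auto simp: Ad_orbit_def)
  show "M \<subseteq> Ad_orbit \<iota> K x"
  proof
    fix y assume "y \<in> M"
    then obtain b where b: "b \<in> K" "y = act b f" by (auto simp: Ad_orbit_def)
    have c: "b ** matrix_inv a \<in> K" by (intro linear_group_mult[OF K(1)] linear_group_inv[OF K(1)] a b)
    have "f = act (matrix_inv a) x" using act_inv(1)[of a f] a K(3) by (simp add: subset_iff)
    then have "y = act (b ** matrix_inv a) x"
      using b a K(3) act_mult[of b "matrix_inv a" x] by (simp add: subset_iff G_intros)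
    then show "y \<in> Ad_orbit \<iota> K x" using c by (auto simp: Ad_orbit_def)
  qed
qed

lemma M_Flag: "M \<subseteq> Flag"
  using K(3) by (auto simp: Ad_orbit_def)

lemma dim_T01:
  assumes "x \<in> M"
  shows "vector_space.dim (\<lambda>(c::complex) D \<phi>. c * D \<phi>) (T01 M x)
       = vector_space.dim (\<lambda>(c::complex) D \<phi>. c * D \<phi>) (T01 M f)"
proof -
  obtain k where k: "k \<in> K" "x = act k f" using assms by (auto simp: Ad_orbit_def)
  have kG: "k \<in> G" using k K(3) by blast
  have ik: "matrix_inv k \<in> K" by (rule linear_group_inv[OF K(1) k(1)])
  have "push k ` T01 M f = T01 M x"
  proof
    show "push k ` T01 M f \<subseteq> T01 M x" using push_T01[OF kG act_M[OF k(1)]] k(2) by blast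
    show "T01 M x \<subseteq> push k ` T01 M f"
    proof
      fix D assume D: "D \<in> T01 M x"
      have "push (matrix_inv k) D \<in> T01 M (act (matrix_inv k) x)"
        by (rule push_T01[OF G_intros(3)[OF kG] act_M[OF ik] D])
      then have "push (matrix_inv k) D \<in> T01 M f" by (simp add: k(2) act_inv kG)
      then show "D \<in> push k ` T01 M f" using push_inv(1)[OF kG, of D] by (metis imageI)
    qed
  qed
  then show ?thesis using dim_push[OF kG, of "T01 M f"] by simp
qed

section \<open>The CR algebra at the base point\<close>

lemma orbit_differential_tangent:
  assumes "\<iota> X \<in> group_lie_algebra K"
  shows "orbit_differential f X \<in> tangent_space M f"
proof -
  let ?c = "\<lambda>t. act (mexp (t *\<^sub>R \<iota> X)) f"
  have "smooth_map {-1<..<1} ?c" by (rule smooth_map_lift[OF smooth_on_mexp mexp_G])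
  moreover have "?c ` {-1<..<1} \<subseteq> M"
    using assms by (auto simp: Ad_orbit_def group_lie_algebra_def)
  ultimately show ?thesis unfolding tangent_space_def orbit_differential_def
    by (intro CollectI exI[of _ ?c] conjI exI[of _ 1]) auto
qed

lemma orbit_differential_eq:
  assumes a: "a \<in> G" "f = act a f" "open W" "a \<in> W" "smooth_on W \<Psi>"
      "\<And>b. b \<in> W \<inter> G \<Longrightarrow> \<phi> (act b f) = \<Psi> b" and D: "(\<Psi> has_derivative D) (at a)"
  shows "orbit_differential f X \<phi> = D (\<iota> X ** a)"
proof -
  have d: "((\<lambda>t. mexp (t *\<^sub>R \<iota> X)) has_vector_derivative \<iota> X) (at 0)"
    using mexp_derivative[of "\<iota> X" 0] by simp
  have "act (mexp (0 *\<^sub>R \<iota> X)) f = act a f" using a(2) by simp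
  from velocity_lift[OF continuous_mexp d mexp_G a(1) this a(3-6) D]
  show ?thesis unfolding orbit_differential_def by simp
qed

text \<open>On holomorphic germs the two real velocities combine to the derivative in the single
  direction \<open>?Z\<close>. If \<open>?Z\<close> is in \<open>f\<close>, its one-parameter group
  fixes the base point and the derivative vanishes. Conversely, testing on the holomorphic entries
  of \<open>coord\<close> makes \<open>P\<close> stationary along \<open>?Z\<close>, which therefore
  normalises \<open>f\<close>.\<close>

lemma orbit_differential_T01:
  assumes X: "\<iota> X \<in> group_lie_algebra K" and Y: "\<iota> Y \<in> group_lie_algebra K"
  shows "(\<lambda>\<phi>. orbit_differential f X \<phi> + \<i> * orbit_differential f Y \<phi>) \<in> T01 M f
    \<longleftrightarrow> X + scale \<i> Y \<in> f"
proof -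
  let ?Z = "X + scale \<i> Y"
  have \<iota>Z: "\<iota> ?Z ** a = \<iota> X ** a + mat \<i> ** (\<iota> Y ** a)" for a :: "complex^'n^'n"
    by (simp only: \<iota>_add \<iota>_scale matrix_mult.add_left matrix_mul_assoc)
  have diff: "orbit_differential f X \<phi> + \<i> * orbit_differential f Y \<phi> = D (\<iota> ?Z ** a)"
    if a: "a \<in> G" "f = act a f" "open W" "a \<in> W" "holomorphic_on_matrices W \<Psi>"
      "\<And>b. b \<in> W \<inter> G \<Longrightarrow> \<phi> (act b f) = \<Psi> b"
    and D: "(\<Psi> has_derivative D) (at a)" "\<And>X. D (mat \<i> ** X) = \<i> * D X" for a W \<Psi> \<phi> D
  proof -
    have "orbit_differential f X' \<phi> = D (\<iota> X' ** a)" for X'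
      by (rule orbit_differential_eq[OF a(1-4) holomorphic_on_matrices_smooth[OF a(5)] a(6) D(1)])
    then show ?thesis unfolding \<iota>Z by (simp add: linear_add[OF has_derivative_linear[OF D(1)]] D(2))
  qed
  have tangent: "(\<lambda>\<phi>. orbit_differential f X \<phi> + \<i> * orbit_differential f Y \<phi>) \<in> complex_tangent_space M f"
    unfolding complex_tangent_space_def
    using orbit_differential_tangent[OF X] orbit_differential_tangent[OF Y] by blast
  show ?thesis
  proof
    assume Z: "?Z \<in> f"
    have "orbit_differential f X \<phi> + \<i> * orbit_differential f Y \<phi> = 0" if hol: "holomorphic_near f \<phi>" for \<phi>
    proof -
      obtain a W \<Psi> where a: "a \<in> G" "f = act a f" "open W" "a \<in> W" "holomorphic_on_matrices W \<Psi>"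
        "\<And>b. b \<in> W \<inter> G \<Longrightarrow> \<phi> (act b f) = \<Psi> b"
        using hol unfolding holomorphic_near_def by blast
      obtain D where D: "(\<Psi> has_derivative D) (at a)" "\<And>X. D (mat \<i> ** X) = \<i> * D X"
        by (rule holomorphic_on_matrices_derivative[OF a(5,4)]) blast
      \<comment> \<open>The exponentials of \<open>?Z\<close> may leave \<open>K\<close> but remain
        in \<open>G\<close>, so their curve in the flag manifold can still be
        differentiated.\<close>
      have "orbit_differential f ?Z \<phi> = D (\<iota> ?Z ** a)"
        by (rule orbit_differential_eq[OF a(1-4) holomorphic_on_matrices_smooth[OF a(5)] a(6) D(1)])
      moreover have "orbit_differential f ?Z \<phi> = 0"
        unfolding orbit_differential_def velocity_def act_mexp_f[OF Z] by simp
      ultimately show ?thesis using diff[OF a D] by simp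
    qed
    then show "(\<lambda>\<phi>. orbit_differential f X \<phi> + \<i> * orbit_differential f Y \<phi>) \<in> T01 M f"
      unfolding T01_def using tangent by blast
  next
    assume T: "(\<lambda>\<phi>. orbit_differential f X \<phi> + \<i> * orbit_differential f Y \<phi>) \<in> T01 M f"
    obtain D where D: "(P has_derivative D) (at (mat 1))"
      by (rule smooth_on_derivative[OF smooth_P]) (use one_in_\<Omega> in blast)
    have one: "mat 1 \<in> G \<inter> \<Omega>" using one_in_\<Omega> by (simp add: G_intros)
    have "D (\<iota> ?Z) $ p $ q = 0" for p q
    proof -
      have Dpq: "((\<lambda>b. P b $ p $ q) has_derivative (\<lambda>X. D X $ p $ q)) (at (mat 1))"
        by (rule bounded_linear.has_derivative[OF bounded_linear_matrix_entry D])
      have hol: "holomorphic_on_matrices \<Omega> (\<lambda>b. P b $ p $ q)"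
        by (rule holomorphic_P[unfolded holomorphic_matrix_def, rule_format])
      have Di: "D (mat \<i> ** X) $ p $ q = \<i> * D X $ p $ q" for X
      proof -
        obtain D' where D': "((\<lambda>b. P b $ p $ q) has_derivative D') (at (mat 1))" "\<And>X. D' (mat \<i> ** X) = \<i> * D' X"
          by (rule holomorphic_on_matrices_derivative[OF hol one_in_\<Omega>]) blast
        have "D' = (\<lambda>X. D X $ p $ q)" by (rule has_derivative_unique[OF D'(1) Dpq])
        then show ?thesis using D'(2)[of X] by simp
      qed
      have "holomorphic_near f (\<lambda>S. coord S $ p $ q)" using holomorphic_near_coord[OF one] by simp
      then have "orbit_differential f X (\<lambda>S. coord S $ p $ q) + \<i> * orbit_differential f Y (\<lambda>S. coord S $ p $ q) = 0"
        using T unfolding T01_def by blast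
      moreover have "orbit_differential f X (\<lambda>S. coord S $ p $ q) + \<i> * orbit_differential f Y (\<lambda>S. coord S $ p $ q)
          = D (\<iota> ?Z ** mat 1) $ p $ q"
        by (rule diff[OF G_intros(1) _ open_\<Omega> one_in_\<Omega> hol _ Dpq Di]) (auto simp: coord_act)
      ultimately show ?thesis by simp
    qed
    then have "D (\<iota> ?Z) = 0" by (simp add: vec_eq_iff)
    then have "\<iota> ?Z ** \<iota> y - \<iota> y ** \<iota> ?Z \<in> \<iota> ` f" if "y \<in> f" for y
      using P_derivative_kernel[OF D] that by blast
    then have "br ?Z y \<in> f" if "y \<in> f" for y using that by (simp add: \<iota>_image_iff flip: \<iota>_br)
    then show "?Z \<in> f" by (rule self_normalizing)
  qed
qed

lemma CR_algebra: "CR_algebra_at \<iota> G f K M f = f \<inter> complexify \<kappa>0"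
proof -
  have k: "\<iota> X \<in> group_lie_algebra K \<longleftrightarrow> X \<in> \<kappa>0" for X unfolding LK by (auto simp: \<iota>_inj)
  show ?thesis
    unfolding CR_algebra_at_def complexify_def using orbit_differential_T01 unfolding k by auto
qed

section \<open>Topology of the flag manifold and of its compact orbit\<close>

text \<open>\<open>topology\<close> inverts \<open>openin\<close> only for predicates that satisfy
  the axioms of a topology; preimages respect intersections and unions.\<close>

lemma openin_flag_topology:
  "openin flag_topology U \<longleftrightarrow> U \<subseteq> Flag \<and> openin (top_of_set G) {a\<in>G. act a f \<in> U}"
proof -
  have "istopology (\<lambda>U. U \<subseteq> Flag \<and> openin (top_of_set G) {a\<in>G. act a f \<in> U})"
    unfolding istopology_def
  proof (intro conjI allI impI)
    fix S T assume "S \<subseteq> Flag \<and> openin (top_of_set G) {a\<in>G. act a f \<in> S}"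
      "T \<subseteq> Flag \<and> openin (top_of_set G) {a\<in>G. act a f \<in> T}"
    then have "openin (top_of_set G) ({a\<in>G. act a f \<in> S} \<inter> {a\<in>G. act a f \<in> T})"
      by (intro openin_Int) auto
    moreover have "{a\<in>G. act a f \<in> S} \<inter> {a\<in>G. act a f \<in> T} = {a\<in>G. act a f \<in> S \<inter> T}" by auto
    ultimately show "openin (top_of_set G) {a\<in>G. act a f \<in> S \<inter> T}" by simp
  next
    fix \<K> assume \<K>: "\<forall>U\<in>\<K>. U \<subseteq> Flag \<and> openin (top_of_set G) {a\<in>G. act a f \<in> U}"
    then have "openin (top_of_set G) (\<Union>U\<in>\<K>. {a\<in>G. act a f \<in> U})" by (intro openin_Union) auto
    moreover have "(\<Union>U\<in>\<K>. {a\<in>G. act a f \<in> U}) = {a\<in>G. act a f \<in> \<Union>\<K>}" by auto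
    ultimately show "openin (top_of_set G) {a\<in>G. act a f \<in> \<Union>\<K>}" by simp
    show "\<Union>\<K> \<subseteq> Flag" using \<K> by blast
  qed auto
  then show ?thesis unfolding flag_topology_def by simp
qed

lemma topspace_flag_topology: "topspace flag_topology = Flag"
proof
  show "topspace flag_topology \<subseteq> Flag"
    using openin_topspace[of flag_topology] openin_flag_topology by blast
  have "{a\<in>G. act a f \<in> Flag} = G" by (auto simp: Ad_orbit_def)
  then have "openin flag_topology Flag" unfolding openin_flag_topology by simp
  then show "Flag \<subseteq> topspace flag_topology" by (rule openin_subset)
qed

lemma matrix_inv_tendsto:
  assumes "a \<in> G" "x \<longlonglongrightarrow> a"
  shows "(\<lambda>j. matrix_inv (x j)) \<longlonglongrightarrow> matrix_inv a"
proof -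
  have "holomorphic_matrix {b :: complex^'n^'n. det b \<noteq> 0} (\<lambda>A. matrix_inv A)"
    by (rule holomorphic_matrix_inv[OF open_det_nonzero holomorphic_matrix_id[OF open_det_nonzero]]) simp
  then have "continuous_on {b :: complex^'n^'n. det b \<noteq> 0} matrix_inv"
    by (intro smooth_on_continuous holomorphic_matrix_smooth open_det_nonzero)
  moreover have "a \<in> {b. det b \<noteq> 0}"
    using linear_group_invertible[OF G assms(1)] by (simp add: invertible_det_nz)
  ultimately have "isCont matrix_inv a" using open_det_nonzero continuous_on_eq_continuous_at by blast
  then show ?thesis by (rule isCont_tendsto_compose[OF _ assms(2)])
qed

lemma matrix_mult_tendsto:
  fixes x y :: "nat \<Rightarrow> complex^'n^'n"
  shows "x \<longlonglongrightarrow> a \<Longrightarrow> y \<longlonglongrightarrow> b \<Longrightarrow> (\<lambda>j. x j ** y j) \<longlonglongrightarrow> a ** b"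
  by (rule matrix_mult.tendsto)

text \<open>The limit of the conjugates stays in the closed subspace that represents
  \<open>f\<close>, which gives one inclusion; the same argument for the inverses gives the
  other.\<close>

lemma stabiliser_closed:
  assumes a: "a \<in> G" "x \<longlonglongrightarrow> a" "\<And>j. x j \<in> G" "\<And>j. act (x j) f = f"
  shows "act a f = f"
proof -
  have sub: "act a f \<subseteq> f" if a: "a \<in> G" "x \<longlonglongrightarrow> a" "\<And>j. x j \<in> G" "\<And>j. act (x j) f = f" for a x
  proof
    fix y assume "y \<in> act a f"
    then obtain z where z: "z \<in> f" "\<iota> y = conjg a (\<iota> z)" by (auto simp: \<iota>_Ad a(1))
    have mem: "conjg (x j) (\<iota> z) \<in> \<iota> ` f" for j
    proof -
      have "Ad \<iota> (x j) z \<in> f" using a(4)[of j] z(1) by blast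
      then show ?thesis using \<iota>_Ad[OF a(3), of j z] by (metis imageI)
    qed
    have lim: "(\<lambda>j. conjg (x j) (\<iota> z)) \<longlonglongrightarrow> conjg a (\<iota> z)"
      unfolding conjg_def by (intro matrix_mult_tendsto a(2) tendsto_const matrix_inv_tendsto[OF a(1,2)])
    have "conjg a (\<iota> z) \<in> \<iota> ` f"
      by (rule closed_sequentially[OF closed_subspace[OF F_subspace] mem lim])
    then show "y \<in> f" unfolding z(2)[symmetric] by (auto simp: \<iota>_inj)
  qed
  have "act (matrix_inv a) f \<subseteq> f"
  proof (rule sub[OF _ matrix_inv_tendsto[OF a(1,2)]])
    show "act (matrix_inv (x j)) f = f" for j using act_inv(1)[OF a(3), of j f] a(4)[of j] by simp
  qed (use a G_intros in auto)
  then have "act a (act (matrix_inv a) f) \<subseteq> act a f" by (rule image_mono)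
  then show ?thesis using sub[OF a] by (simp add: act_inv a(1))
qed

text \<open>The preimage of the image of \<open>K'\<close> is closed in \<open>G\<close>: if
  \<open>x j\<close> tends to \<open>a\<close> and gives the same points as \<open>k j\<close> in
  \<open>K'\<close>, a subsequence of \<open>k j\<close> tends to some \<open>l\<close>, and
  \<open>matrix_inv l ** a\<close> is a limit of elements of the stabiliser.\<close>

lemma openin_complement_of_compact:
  assumes K': "compact K'" "K' \<subseteq> G"
  shows "openin flag_topology (Flag - (\<lambda>k. act k f) ` K')"
  unfolding openin_flag_topology
proof
  define T where "T = {a\<in>G. \<exists>k\<in>K'. act a f = act k f}"
  have "closedin (top_of_set G) T"
    unfolding closedin_limpt
  proof (intro conjI allI impI)
    show "T \<subseteq> G" by (auto simp: T_def)
    fix a assume a: "a islimpt T \<and> a \<in> G"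
    then obtain x where x: "\<And>j. x j \<in> T" "x \<longlonglongrightarrow> a" unfolding islimpt_sequential by blast
    have "\<forall>j. \<exists>k. k \<in> K' \<and> act (x j) f = act k f"
    proof
      show "\<exists>k. k \<in> K' \<and> act (x j) f = act k f" for j using x(1)[of j] unfolding T_def by blast
    qed
    from choice[OF this] obtain k where k: "\<And>j. k j \<in> K' \<and> act (x j) f = act (k j) f" by blast
    have "\<exists>l\<in>K'. \<exists>r :: nat \<Rightarrow> nat. strict_mono r \<and> (k \<circ> r) \<longlonglongrightarrow> l"
      using K'(1)[unfolded compact_def, rule_format, of k] k by simp
    then obtain l r where l: "l \<in> K'" "strict_mono (r :: nat \<Rightarrow> nat)" "(k \<circ> r) \<longlonglongrightarrow> l"
      by blast
    have lG: "l \<in> G" using l(1) K'(2) by blast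
    have kG: "k j \<in> G" and xG: "x j \<in> G" for j using k[of j] K'(2) x(1)[of j] by (auto simp: T_def)
    have "act (matrix_inv l ** a) f = f"
    proof (rule stabiliser_closed)
      show "matrix_inv l ** a \<in> G" using lG a by (simp add: G_intros)
      show "(\<lambda>j. matrix_inv (k (r j)) ** x (r j)) \<longlonglongrightarrow> matrix_inv l ** a"
        using matrix_mult_tendsto[OF matrix_inv_tendsto[OF lG l(3)] LIMSEQ_subseq_LIMSEQ[OF x(2) l(2)]]
        by (simp add: o_def)
      show "matrix_inv (k (r j)) ** x (r j) \<in> G" for j by (simp add: G_intros kG xG)
      show "act (matrix_inv (k (r j)) ** x (r j)) f = f" for j
        by (rule act_stab[OF kG xG]) (simp add: k)
    qed
    then have "act l (act (matrix_inv l ** a) f) = act l f" by simp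
    then have "act a f = act l f"
      using lG a by (simp add: act_mult G_intros matrix_mul_assoc G_inv)
    then show "a \<in> T" using a l(1) by (auto simp: T_def)
  qed
  then have "openin (top_of_set G) (G - T)" by (metis openin_diff openin_subtopology_self)
  moreover have "{a\<in>G. act a f \<in> Flag - (\<lambda>k. act k f) ` K'} = G - T"
    by (auto simp: T_def Ad_orbit_def)
  ultimately show "openin (top_of_set G) {a\<in>G. act a f \<in> Flag - (\<lambda>k. act k f) ` K'}" by simp
qed auto

lemma act_eprod:
  assumes "set xs \<subseteq> \<iota> ` f"
  shows "eprod xs u \<in> G \<and> act (eprod xs u) f = f"
  using assms
proof (induction xs)
  case Nil
  then show ?case by (simp add: G_intros)
next
  case (Cons X xs)
  then obtain z where z: "z \<in> f" "X = \<iota> z" by auto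
  have m: "mexp ((u \<bullet> X) *\<^sub>R X) \<in> G" unfolding z(2) by (rule mexp_G)
  have "act (mexp ((u \<bullet> X) *\<^sub>R X)) f = f" unfolding z(2) by (rule act_mexp_f[OF z(1)])
  then show ?case using Cons act_mult[OF m, of "eprod xs u" f] by (simp add: eprod_Cons G_intros m)
qed

section \<open>Charts of the orbit\<close>

text \<open>Applies \<open>group_chart\<close> with \<open>s\<close> the Lie algebra of the
  stabiliser of \<open>f\<close> in \<open>K\<close>. Exponentials from \<open>s\<close> fix
  \<open>f\<close>, so they disappear from the factorisation, and the radius is shrunk until the
  coordinates \<open>P\<close> separate points and directions.\<close>

lemma orbit_chart:
  obtains e :: "complex^'n^'n \<Rightarrow> complex^'n^'n" and V :: "(complex^'n^'n) set" and \<rho> where "\<rho> > 0" "Real_Vector_Spaces.subspace V" "smooth_on UNIV e" "\<And>u. e u \<in> K" "e 0 = mat 1"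
    "\<And>u u'. u \<in> V \<inter> ball 0 \<rho> \<Longrightarrow> u' \<in> V \<inter> ball 0 \<rho> \<Longrightarrow> act (e u) f = act (e u') f \<Longrightarrow> u = u'"
    "\<And>w u. w \<in> V \<inter> ball 0 \<rho> \<Longrightarrow> u \<in> V \<Longrightarrow> velocity (\<lambda>t. act (e (w + t *\<^sub>R u)) f) = 0 \<Longrightarrow> u = 0"
    "\<And>U w. open U \<Longrightarrow> w \<in> V \<inter> U \<inter> ball 0 \<rho> \<Longrightarrow>
       \<exists>N. open N \<and> e w \<in> N \<and> (\<forall>g\<in>N \<inter> K. \<exists>u\<in>V \<inter> U \<inter> ball 0 \<rho>. act g f = act (e u) f)"
proof -
  define k where "k = group_lie_algebra K"
  define s where "s = \<iota> ` (\<kappa>0 \<inter> f)"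
  define V where "V = {x\<in>k. \<forall>y\<in>s. x \<bullet> y = 0}"
  have real_sub: "Real_Vector_Spaces.subspace (\<iota> ` A)" if A: "re.subspace A" for A
  proof (rule real_vector.subspaceI)
    show "0 \<in> \<iota> ` A" using re.subspace_0[OF A] \<iota>_0 by (metis imageI)
    show "X + Y \<in> \<iota> ` A" if "X \<in> \<iota> ` A" "Y \<in> \<iota> ` A" for X Y
      using that re.subspace_add[OF A] by (auto simp flip: \<iota>_add)
    show "c *\<^sub>R X \<in> \<iota> ` A" if "X \<in> \<iota> ` A" for c X
      using that re.subspace_scale[OF A] unfolding scaleR_eq_mat_mult by (auto simp flip: \<iota>_scale)
  qed
  have sk: "Real_Vector_Spaces.subspace k" unfolding k_def LK by (rule real_sub[OF \<kappa>0])
  have "re.subspace (\<kappa>0 \<inter> f)"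
    using \<kappa>0 f_subspace by (intro re.subspaceI)
      (auto simp: re.subspace_0 re.subspace_add re.subspace_scale subspace_0 subspace_add subspace_scale)
  then have ss: "Real_Vector_Spaces.subspace s" unfolding s_def by (rule real_sub)
  have "s \<subseteq> k" unfolding s_def k_def LK by auto
  obtain e \<pi> \<rho> where chart: "\<rho> > 0" "smooth_on UNIV e" "\<And>u. e u \<in> K" "(e has_derivative \<pi>) (at 0)"
    "e 0 = mat 1" "bounded_linear \<pi>" "\<And>u. \<pi> u \<in> V" "\<And>u. u \<in> V \<Longrightarrow> \<pi> u = u"
    and open_chart: "\<And>U w. open U \<Longrightarrow> w \<in> V \<inter> U \<inter> ball 0 \<rho> \<Longrightarrow>
       \<exists>N. open N \<and> e w \<in> N \<and> (\<forall>g\<in>N \<inter> K. \<exists>u\<in>V \<inter> U \<inter> ball 0 \<rho>. \<exists>ys z. set ys \<subseteq> s \<and> g = e u ** eprod ys z)"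
    by (rule group_chart[OF K(1) compact_imp_closed[OF K(2)] k_def sk ss \<open>s \<subseteq> k\<close> V_def]) blast
  have sV: "Real_Vector_Spaces.subspace V" unfolding V_def
    by (rule real_vector.subspaceI)
      (auto simp: real_vector.subspace_0[OF sk] real_vector.subspace_add[OF sk]
        real_vector.subspace_scale[OF sk] inner_add_left)
  define S where "S = e -` \<Omega>"
  have opS: "open S" unfolding S_def by (rule open_vimage[OF open_\<Omega> smooth_on_continuous[OF chart(2)]])
  have S0: "0 \<in> S" by (simp add: S_def chart(5) one_in_\<Omega>)
  have bl_res: "bounded_linear (\<lambda>u. u - \<pi> u)" by (rule bounded_linear_sub[OF bounded_linear_ident chart(6)])
  \<comment> \<open>The second component accounts for the directions outside \<open>V\<close>, so
    that the immersion result applies on the full matrix space. It vanishes on \<open>V\<close>,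
    where \<open>\<psi>\<close> carries the same information as \<open>P (e u)\<close>.\<close>
  define \<psi> where "\<psi> u = (P (e u), 0) + (0 :: complex^('n \<times> 'n)^('n \<times> 'n), u - \<pi> u)" for u
  have bl1: "bounded_linear (\<lambda>x :: complex^('n \<times> 'n)^('n \<times> 'n). (x, 0 :: complex^'n^'n))"
    by (rule bounded_linear_Pair[OF bounded_linear_ident bounded_linear_zero])
  have bl2: "bounded_linear (\<lambda>x :: complex^'n^'n. (0 :: complex^('n \<times> 'n)^('n \<times> 'n), x - \<pi> x))"
    by (rule bounded_linear_Pair[OF bounded_linear_zero bl_res])
  have eS: "smooth_on S e" by (rule smooth_on_subset[OF open_UNIV opS _ chart(2)]) simp
  have PeS: "smooth_on S (\<lambda>u. P (e u))"
    by (rule smooth_on_compose[OF open_\<Omega> opS smooth_P eS]) (auto simp: S_def)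
  have smooth: "smooth_on S \<psi>" unfolding \<psi>_def
    by (rule smooth_on_add[OF opS smooth_on_linear_compose[OF opS bl1 PeS] smooth_on_linear[OF opS bl2]])
  have der: "(\<psi> has_derivative (\<lambda>v. (DP (E v), v - \<pi> v))) (at w)"
    if E: "(e has_derivative E) (at w)" and DP: "(P has_derivative DP) (at (e w))" for w E DP
  proof -
    have "((\<lambda>u. (P (e u), 0 :: complex^'n^'n)) has_derivative (\<lambda>v. (DP (E v), 0))) (at w)"
      by (rule bounded_linear.has_derivative[OF bl1 has_derivative_compose[OF E DP]])
    from has_derivative_add[OF this bounded_linear_imp_has_derivative[OF bl2]]
    show ?thesis unfolding \<psi>_def by simp
  qed
  obtain DP where DP: "\<And>b. b \<in> \<Omega> \<Longrightarrow> (P has_derivative DP b) (at b)"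
    by (rule smooth_on_derivative[OF smooth_P]) blast
  obtain E where E: "\<And>w. w \<in> UNIV \<Longrightarrow> (e has_derivative E w) (at w)"
    by (rule smooth_on_derivative[OF chart(2)]) blast
  have D0: "(\<psi> has_derivative (\<lambda>v. (DP (mat 1) (\<pi> v), v - \<pi> v))) (at 0)"
    by (rule der[OF chart(4)]) (simp add: chart(5) DP one_in_\<Omega>)
  \<comment> \<open>A kernel vector lies in \<open>V\<close> and comes from an element of
    \<open>\<kappa>0\<close> that normalises \<open>f\<close>. So it belongs to \<open>s\<close>, to
    which \<open>V\<close> is orthogonal.\<close>
  have inj0: "v = 0" if v: "(DP (mat 1) (\<pi> v), v - \<pi> v) = 0" for v
  proof -
    have v\<pi>: "v = \<pi> v" and DPv: "DP (mat 1) (\<pi> v) = 0" using v by (auto simp: zero_prod_def)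
    have vV: "v \<in> V" using v\<pi> chart(7)[of v] by simp
    then obtain z where z: "z \<in> \<kappa>0" "v = \<iota> z" unfolding V_def k_def LK by auto
    have "br z y \<in> f" if "y \<in> f" for y
    proof -
      have "v ** \<iota> y - \<iota> y ** v \<in> \<iota> ` f"
        by (rule P_derivative_kernel[OF DP[OF one_in_\<Omega>] _ imageI[OF that]]) (use DPv v\<pi> in simp)
      then show ?thesis by (simp add: z(2) \<iota>_image_iff flip: \<iota>_br)
    qed
    then have "z \<in> f" by (rule self_normalizing)
    then have "v \<in> s" using z by (auto simp: s_def)
    then have "v \<bullet> v = 0" using vV by (auto simp: V_def)
    then show "v = 0" by simp
  qed
  obtain r where r: "r > 0" "ball 0 r \<subseteq> S" "inj_on \<psi> (ball 0 r)"
    "\<forall>x D v. x \<in> ball 0 r \<longrightarrow> (\<psi> has_derivative D) (at x) \<longrightarrow> D v = 0 \<longrightarrow> v = 0"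
    by (rule locally_immersive[OF opS S0 smooth D0 inj0]) blast
  define \<rho>' where "\<rho>' = min \<rho> r"
  have e\<Omega>: "e u \<in> G \<inter> \<Omega>" if "u \<in> ball 0 \<rho>'" for u
    using that r(2) chart(3)[of u] K(3) by (auto simp: \<rho>'_def S_def subset_iff)
  show thesis
  proof (rule that[of \<rho>' V e])
    show "\<rho>' > 0" using chart(1) r(1) by (simp add: \<rho>'_def)
    show "Real_Vector_Spaces.subspace V" by (rule sV)
    show "smooth_on UNIV e" "\<And>u. e u \<in> K" "e 0 = mat 1" by (rule chart)+
    show "u = u'" if u: "u \<in> V \<inter> ball 0 \<rho>'" "u' \<in> V \<inter> ball 0 \<rho>'" and eq: "act (e u) f = act (e u') f" for u u'
    proof -
      have "P (e u) = P (e u')" using coord_act[OF e\<Omega>, of u] coord_act[OF e\<Omega>, of u'] u eq by simp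
      then have "\<psi> u = \<psi> u'" using u chart(8) by (simp add: \<psi>_def)
      then show ?thesis using u by (intro inj_onD[OF r(3)]) (auto simp: \<rho>'_def)
    qed
    show "u = 0" if w: "w \<in> V \<inter> ball 0 \<rho>'" and u: "u \<in> V" and vel: "velocity (\<lambda>t. act (e (w + t *\<^sub>R u)) f) = 0"
      for w u
    proof -
      define g where "g t = e (w + t *\<^sub>R u)" for t
      have ew: "e w \<in> G \<inter> \<Omega>" using w by (intro e\<Omega>) auto
      have line: "((\<lambda>t. w + t *\<^sub>R u) has_derivative (\<lambda>t. t *\<^sub>R u)) (at 0)"
        by (auto intro!: derivative_eq_intros)
      have "(g has_derivative (\<lambda>t. E w (t *\<^sub>R u))) (at 0)"
        unfolding g_def using has_derivative_compose[OF line, of e "E w"] E[of w] by simp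
      then have g': "(g has_vector_derivative E w u) (at 0)"
        using linear_scale[OF has_derivative_linear[OF E[OF UNIV_I]]] by (simp add: has_vector_derivative_def)
      have gc: "continuous_on UNIV g" unfolding g_def
        by (rule continuous_on_compose2[OF smooth_on_continuous[OF chart(2)]]) (auto intro!: continuous_intros)
      have gG: "g t \<in> G" for t using chart(3) K(3) by (auto simp: g_def)
      \<comment> \<open>The vanishing velocity is tested on the entries of \<open>coord\<close>. The
        correction by a stabiliser element is trivial here, since the lift starts at
        \<open>e w\<close>, where \<open>P\<close> is differentiated.\<close>
      have "DP (e w) (E w u) $ p $ q = 0" for p q
      proof -
        have hol: "holomorphic_on_matrices \<Omega> (\<lambda>b. P b $ p $ q)"
          by (rule holomorphic_P[unfolded holomorphic_matrix_def, rule_format])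
        have Dpq: "((\<lambda>b. P b $ p $ q) has_derivative (\<lambda>X. DP (e w) X $ p $ q)) (at (e w))"
          using ew by (intro bounded_linear.has_derivative[OF bounded_linear_matrix_entry DP]) auto
        have "velocity (\<lambda>t. act (g t) f) (\<lambda>S. coord S $ p $ q)
            = DP (e w) (E w u ** (matrix_inv (g 0) ** e w)) $ p $ q"
          by (rule velocity_lift[OF gc g' gG _ _ open_\<Omega> _ holomorphic_on_matrices_smooth[OF hol] _ Dpq])
            (use ew in \<open>auto simp: g_def coord_act\<close>)
        moreover have "velocity (\<lambda>t. act (g t) f) (\<lambda>S. coord S $ p $ q) = 0" using vel by (simp add: g_def)
        ultimately show ?thesis using ew by (simp add: g_def G_inv)
      qed
      then have "DP (e w) (E w u) = 0" by (simp add: vec_eq_iff)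
      moreover have "(\<psi> has_derivative (\<lambda>v. (DP (e w) (E w v), v - \<pi> v))) (at w)"
        by (rule der[OF E[OF UNIV_I] DP]) (use ew in blast)
      ultimately show "u = 0" using r(4)[rule_format, of w _ u] w chart(8)[OF u] by (auto simp: \<rho>'_def zero_prod_def)
    qed
    show "\<exists>N. open N \<and> e w \<in> N \<and> (\<forall>g\<in>N \<inter> K. \<exists>u\<in>V \<inter> U \<inter> ball 0 \<rho>'. act g f = act (e u) f)"
      if U: "open U" and w: "w \<in> V \<inter> U \<inter> ball 0 \<rho>'" for U w
    proof -
      have "open (U \<inter> ball 0 \<rho>')" "w \<in> V \<inter> (U \<inter> ball 0 \<rho>') \<inter> ball 0 \<rho>"
        using U w by (auto simp: \<rho>'_def)
      from open_chart[OF this] obtain N where N: "open N" "e w \<in> N"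
        "\<And>g. g \<in> N \<inter> K \<Longrightarrow> \<exists>u\<in>V \<inter> (U \<inter> ball 0 \<rho>') \<inter> ball 0 \<rho>. \<exists>ys z. set ys \<subseteq> s \<and> g = e u ** eprod ys z"
        by blast
      have "\<exists>u\<in>V \<inter> U \<inter> ball 0 \<rho>'. act g f = act (e u) f" if gN: "g \<in> N \<inter> K" for g
      proof -
        obtain u ys z where u: "u \<in> V \<inter> U \<inter> ball 0 \<rho>'" "set ys \<subseteq> s" "g = e u ** eprod ys z"
          using N(3)[OF gN] by blast
        have "set ys \<subseteq> \<iota> ` f" using u(2) by (auto simp: s_def)
        from act_eprod[OF this, of z] have "act g f = act (e u) f"
          using act_mult[of "e u" "eprod ys z" f] chart(3)[of u] K(3) u(3) by auto
        then show ?thesis using u(1) by blast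
      qed
      then show ?thesis using N(1,2) by blast
    qed
  qed
qed

text \<open>
  A chart is open onto its image in the orbit: the points of \<open>M\<close> outside the image come from a
  compact subset of \<open>K\<close>.
\<close>

lemma chart_image_open:
  assumes e: "\<And>u. e u \<in> K" and k: "k \<in> K" and U: "open U"
    and chart: "\<And>w. w \<in> V \<inter> U \<inter> W \<Longrightarrow>
       \<exists>N. open N \<and> e w \<in> N \<and> (\<forall>g\<in>N \<inter> K. \<exists>u\<in>V \<inter> U \<inter> W. act g f = act (e u) f)"
  shows "\<exists>T. openin flag_topology T \<and> M \<inter> T = (\<lambda>w. act k (act (e w) f)) ` (V \<inter> U \<inter> W)"
proof -
  let ?p = "\<lambda>w. act k (act (e w) f)"
  have kG: "k \<in> G" and eG: "e w \<in> G" for w using k e K(3) by auto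
  \<comment> \<open>\<open>good\<close> is saturated in \<open>K\<close>, and \<open>A\<close> is
    the largest open set of matrices that meets \<open>K\<close> only in it. Once \<open>A\<close>
    covers \<open>good\<close>, the remaining elements form the compact set
    \<open>K - A\<close>.\<close>
  define good where "good = {g\<in>K. act g f \<in> ?p ` (V \<inter> U \<inter> W)}"
  define A where "A = \<Union>{N. open N \<and> N \<inter> K \<subseteq> good}"
  have "open A" unfolding A_def by (rule open_Union) blast
  have "good \<subseteq> A"
  proof
    fix g assume g: "g \<in> good"
    then obtain w where w: "w \<in> V \<inter> U \<inter> W" "act g f = act k (act (e w) f)" and gK: "g \<in> K"
      unfolding good_def by blast
    have gG: "g \<in> G" using gK K(3) by blast
    have ke: "k ** e w \<in> K" by (rule linear_group_mult[OF K(1) k e])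
    have keG: "k ** e w \<in> G" using ke K(3) by blast
    \<comment> \<open>\<open>g\<close> and \<open>k ** e w\<close> give the same point and differ by
      \<open>s\<close> in the stabiliser. Undoing \<open>k\<close> on the left and \<open>s\<close>
      on the right moves a neighbourhood of \<open>g\<close> to one of \<open>e w\<close>, where the
      chart hypothesis applies.\<close>
    define s where "s = matrix_inv (k ** e w) ** g"
    have sK: "s \<in> K" unfolding s_def by (intro linear_group_mult[OF K(1)] linear_group_inv[OF K(1)] ke gK)
    then have sG: "s \<in> G" using K(3) by blast
    have sf: "act s f = f"
      unfolding s_def by (rule act_stab[OF keG gG]) (simp add: w(2) act_mult kG eG)
    have gs: "g = k ** e w ** s" unfolding s_def matrix_mul_assoc by (simp add: G_inv keG)
    obtain N where N: "open N" "e w \<in> N"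
      "\<And>g. g \<in> N \<inter> K \<Longrightarrow> \<exists>u\<in>V \<inter> U \<inter> W. act g f = act (e u) f"
      using chart[OF w(1)] by blast
    define h where "h g = matrix_inv k ** (g ** matrix_inv s)" for g :: "complex^'n^'n"
    have ch: "continuous_on UNIV h" unfolding h_def
      by (intro bounded_linear.continuous_on[OF matrix_mult.bounded_linear_right]
          bounded_linear.continuous_on[OF matrix_mult.bounded_linear_left] continuous_on_id)
    have "open (h -` N)" by (rule open_vimage[OF N(1) ch])
    moreover have "g \<in> h -` N"
    proof -
      have "h g = (matrix_inv k ** k) ** e w ** (s ** matrix_inv s)"
        unfolding h_def gs by (simp only: matrix_mul_assoc)
      then show ?thesis using N(2) by (simp add: G_inv kG sG)
    qed
    moreover have "h -` N \<inter> K \<subseteq> good"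
    proof
      fix g' assume g': "g' \<in> h -` N \<inter> K"
      have hK: "h g' \<in> K" unfolding h_def using g'
        by (intro linear_group_mult[OF K(1)] linear_group_inv[OF K(1)] k sK) auto
      then have hG: "h g' \<in> G" using K(3) by blast
      obtain u where u: "u \<in> V \<inter> U \<inter> W" "act (h g') f = act (e u) f" using N(3)[of "h g'"] g' hK by blast
      have "k ** (h g' ** s) = (k ** matrix_inv k) ** g' ** (matrix_inv s ** s)"
        unfolding h_def by (simp only: matrix_mul_assoc)
      then have "g' = k ** (h g' ** s)" by (simp add: G_inv kG sG)
      then have "act g' f = act k (act (h g') (act s f))"
        by (simp add: act_mult kG hG sG G_intros)
      then have "act g' f = ?p u" by (simp add: sf u(2))
      then show "g' \<in> good" using u(1) g' unfolding good_def by blast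
    qed
    ultimately show "g \<in> A" unfolding A_def by blast
  qed
  moreover have "A \<inter> K \<subseteq> good" unfolding A_def by blast
  ultimately have bad: "K - A = K - good" by (auto simp: good_def)
  have "compact (K - A)" by (rule compact_diff[OF K(2) \<open>open A\<close>])
  then have T: "openin flag_topology (Flag - (\<lambda>k. act k f) ` (K - A))"
    by (rule openin_complement_of_compact) (use K(3) in blast)
  have "M \<inter> (Flag - (\<lambda>k. act k f) ` (K - A)) = ?p ` (V \<inter> U \<inter> W)"
  proof
    show "M \<inter> (Flag - (\<lambda>k. act k f) ` (K - A)) \<subseteq> ?p ` (V \<inter> U \<inter> W)"
    proof
      fix y assume y: "y \<in> M \<inter> (Flag - (\<lambda>k. act k f) ` (K - A))"
      then obtain g where g: "g \<in> K" "y = act g f" by (auto simp: Ad_orbit_def)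
      then have "g \<in> good" using y bad by blast
      then show "y \<in> ?p ` (V \<inter> U \<inter> W)" using g(2) by (simp add: good_def)
    qed
    show "?p ` (V \<inter> U \<inter> W) \<subseteq> M \<inter> (Flag - (\<lambda>k. act k f) ` (K - A))"
    proof
      fix y assume y: "y \<in> ?p ` (V \<inter> U \<inter> W)"
      then obtain w where w: "y = ?p w" by blast
      have "act (e w) f \<in> M" unfolding Ad_orbit_def using e by blast
      then have "y \<in> M" unfolding w by (rule act_M[OF k])
      moreover have "y \<notin> (\<lambda>k. act k f) ` (K - A)" unfolding bad good_def using y by blast
      ultimately show "y \<in> M \<inter> (Flag - (\<lambda>k. act k f) ` (K - A))" using M_Flag by blast
    qed
  qed
  then show ?thesis using T by blast
qed

text \<open>Charts at other points are translates of the one at \<open>f\<close> by elements of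
  \<open>K\<close>, so a single model space \<open>V\<close> gives one dimension throughout. That
  the chart is open, which is the delicate half of the homeomorphism, comes from
  \<open>chart_image_open\<close> for every open subset of the ball.\<close>

lemma embedded_orbit: "\<exists>d. embedded_submanifold d M"
proof (rule orbit_chart)
  fix e :: "complex^'n^'n \<Rightarrow> complex^'n^'n" and V :: "(complex^'n^'n) set" and \<rho> :: real
  assume \<rho>: "\<rho> > 0" and sV: "Real_Vector_Spaces.subspace V"
    and e: "smooth_on UNIV e" "\<And>u. e u \<in> K" "e 0 = mat 1"
    and inj: "\<And>u u'. u \<in> V \<inter> ball 0 \<rho> \<Longrightarrow> u' \<in> V \<inter> ball 0 \<rho> \<Longrightarrow> act (e u) f = act (e u') f \<Longrightarrow> u = u'"
    and imm: "\<And>w u. w \<in> V \<inter> ball 0 \<rho> \<Longrightarrow> u \<in> V \<Longrightarrow> velocity (\<lambda>t. act (e (w + t *\<^sub>R u)) f) = 0 \<Longrightarrow> u = 0"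
    and op: "\<And>U w. open U \<Longrightarrow> w \<in> V \<inter> U \<inter> ball 0 \<rho> \<Longrightarrow>
       \<exists>N. open N \<and> e w \<in> N \<and> (\<forall>g\<in>N \<inter> K. \<exists>u\<in>V \<inter> U \<inter> ball 0 \<rho>. act g f = act (e u) f)"
  have "embedded_submanifold (Real_Vector_Spaces.dim V) M"
    unfolding embedded_submanifold_def
  proof (intro conjI ballI)
    show "M \<subseteq> Flag" by (rule M_Flag)
    fix x assume "x \<in> M"
    then obtain k where k: "k \<in> K" "x = act k f" by (auto simp: Ad_orbit_def)
    have kG: "k \<in> G" and eG: "e w \<in> G" for w using k e(2) K(3) by auto
    define p where "p w = act k (act (e w) f)" for w
    have p_eq: "p w = act (k ** e w) f" for w by (simp add: p_def act_mult kG eG)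
    let ?W = "ball 0 \<rho>"
    have img: "\<exists>T. openin flag_topology T \<and> M \<inter> T = p ` (V \<inter> U \<inter> ?W)" if "open U" for U
      unfolding p_def by (rule chart_image_open[OF e(2) k(1) that op[OF that]])
    obtain U where U: "openin flag_topology U" "M \<inter> U = p ` (V \<inter> ?W)" using img[of UNIV] by auto
    have g: "smooth_on UNIV (\<lambda>w. k ** e w)"
      by (rule smooth_on_linear_compose[OF open_UNIV matrix_mult.bounded_linear_right e(1)])
    have gG: "k ** e w \<in> G" for w by (rule G_intros(2)[OF kG eG])
    have smooth: "smooth_map (?W \<inter> V) p"
      unfolding p_eq[abs_def] by (rule smooth_map_lift[OF g gG])
    have hom: "homeomorphic_map (top_of_set (?W \<inter> V)) (subtopology flag_topology (M \<inter> U)) p"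
    proof (rule bijective_open_imp_homeomorphic_map)
      have "continuous_map (top_of_set (?W \<inter> V)) flag_topology p"
        unfolding continuous_map_def
      proof (intro conjI allI impI)
        show "p \<in> topspace (top_of_set (?W \<inter> V)) \<rightarrow> topspace flag_topology"
          unfolding topspace_flag_topology Ad_orbit_def using gG p_eq by blast
        fix T assume "openin flag_topology T"
        then have "openin (top_of_set G) {a\<in>G. act a f \<in> T}" by (simp add: openin_flag_topology)
        then obtain A where A: "open A" "{a\<in>G. act a f \<in> T} = G \<inter> A" unfolding openin_open by blast
        have "open ((\<lambda>w. k ** e w) -` A)" by (rule open_vimage[OF A(1) smooth_on_continuous[OF g]])
        then have "openin (top_of_set (?W \<inter> V)) ((?W \<inter> V) \<inter> (\<lambda>w. k ** e w) -` A)"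
          by (rule openin_open_Int)
        moreover have "p w \<in> T \<longleftrightarrow> k ** e w \<in> A" for w
          using A(2) gG[of w] unfolding p_eq by blast
        then have "{w \<in> topspace (top_of_set (?W \<inter> V)). p w \<in> T} = (?W \<inter> V) \<inter> (\<lambda>w. k ** e w) -` A"
          by auto
        ultimately show "openin (top_of_set (?W \<inter> V)) {w \<in> topspace (top_of_set (?W \<inter> V)). p w \<in> T}"
          by simp
      qed
      then show "continuous_map (top_of_set (?W \<inter> V)) (subtopology flag_topology (M \<inter> U)) p"
        by (rule continuous_map_into_subtopology) (use U(2) in auto)
      show "open_map (top_of_set (?W \<inter> V)) (subtopology flag_topology (M \<inter> U)) p"
        unfolding open_map_def
      proof (intro allI impI)
        fix O' assume "openin (top_of_set (?W \<inter> V)) O'"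
        then obtain Q where Q: "open Q" "O' = (?W \<inter> V) \<inter> Q" unfolding openin_open by blast
        obtain T where T: "openin flag_topology T" "M \<inter> T = p ` (V \<inter> Q \<inter> ?W)" using img[OF Q(1)] by blast
        have eq: "O' = V \<inter> Q \<inter> ?W" using Q(2) by blast
        have "p ` O' \<subseteq> M \<inter> U" unfolding U(2) eq by blast
        then have "p ` O' = T \<inter> (M \<inter> U)" using T(2) unfolding eq by blast
        then show "openin (subtopology flag_topology (M \<inter> U)) (p ` O')"
          unfolding openin_subtopology using T(1) by blast
      qed
      show "p ` topspace (top_of_set (?W \<inter> V)) = topspace (subtopology flag_topology (M \<inter> U))"
        unfolding topspace_subtopology topspace_flag_topology
        using U(2) M_Flag by (auto simp: Int_commute)
      show "inj_on p (topspace (top_of_set (?W \<inter> V)))"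
      proof (rule inj_onI)
        fix u u' assume u: "u \<in> topspace (top_of_set (?W \<inter> V))" "u' \<in> topspace (top_of_set (?W \<inter> V))" and "p u = p u'"
        then have "act (matrix_inv k) (p u) = act (matrix_inv k) (p u')" by simp
        then have "act (e u) f = act (e u') f" unfolding p_def act_inv(1)[OF kG] .
        then show "u = u'" using u by (intro inj) auto
      qed
    qed
    have imm': "u = 0" if w: "w \<in> ?W \<inter> V" and u: "u \<in> V" and v: "velocity (\<lambda>t. p (w + t *\<^sub>R u)) = 0" for w u
    proof (rule imm[OF _ u])
      show "w \<in> V \<inter> ?W" using w by blast
      have "push k (velocity (\<lambda>t. act (e (w + t *\<^sub>R u)) f)) = 0"
        using v velocity_act[OF kG, of "\<lambda>t. act (e (w + t *\<^sub>R u)) f"] by (simp add: p_def)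
      then have "push (matrix_inv k) (push k (velocity (\<lambda>t. act (e (w + t *\<^sub>R u)) f))) = 0"
        by (simp add: push_def fun_eq_iff)
      then show "velocity (\<lambda>t. act (e (w + t *\<^sub>R u)) f) = 0" by (simp add: push_inv kG)
    qed
    have "p 0 = x" by (simp add: p_def e(3) k(2))
    moreover have "0 \<in> V \<inter> ?W" using \<rho> real_vector.subspace_0[OF sV] by simp
    ultimately have "x \<in> p ` (V \<inter> ?W)" by (metis imageI)
    then have "x \<in> U" using U(2) by blast
    then show "\<exists>U (V' :: (complex^'n^'n) set) W p. openin flag_topology U \<and> x \<in> U \<and> Real_Vector_Spaces.subspace V' \<and> Real_Vector_Spaces.dim V' = Real_Vector_Spaces.dim V \<and>
        open W \<and> smooth_map (W \<inter> V') p \<and>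
        homeomorphic_map (top_of_set (W \<inter> V')) (subtopology flag_topology (M \<inter> U)) p \<and>
        (\<forall>w\<in>W \<inter> V'. \<forall>u\<in>V'. velocity (\<lambda>t. p (w + t *\<^sub>R u)) = 0 \<longrightarrow> u = 0)"
      using U(1) sV smooth hom imm'
      by (intro exI[of _ U] exI[of _ V] exI[of _ ?W] exI[of _ p]) auto
  qed
  then show ?thesis by blast
qed

lemma homogeneous_orbit: "homogeneous_CR_submanifold K M"
  unfolding homogeneous_CR_submanifold_def CR_submanifold_def
  using embedded_orbit dim_T01 f_in_M orbit_M by blast

theorem n_reductive_orbit:
  assumes "reductive_complement (f \<inter> complexify \<kappa>0 \<inter> conjugation \<kappa>0 ` (f \<inter> complexify \<kappa>0))
     (nil_ideal (complexify \<kappa>0) (f \<inter> complexify \<kappa>0)) (f \<inter> complexify \<kappa>0)"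
  shows "n_reductive_CR_manifold \<iota> G f K M f"
proof -
  have "{X. \<iota> X \<in> group_lie_algebra K} = \<kappa>0" unfolding LK by (auto simp: \<iota>_inj)
  then show ?thesis
    unfolding n_reductive_CR_manifold_def Let_def CR_algebra
    using assms homogeneous_orbit f_in_M by simp
qed

end

theorem theorem5p5:
  fixes scale :: "complex \<Rightarrow> 'g::ab_group_add \<Rightarrow> 'g" and br :: "'g \<Rightarrow> 'g \<Rightarrow> 'g"
    and g0 f h0 \<kappa>0 \<kappa> v :: "'g set" and \<theta> :: "'g \<Rightarrow> 'g"
  assumes "complex_lie_algebra scale br"
    and "complex_lie_algebra.real_form scale br g0"
    and "lie_algebra.semisimple (\<lambda>r::real. scale (complex_of_real r)) br g0"
    and "lie_algebra.parabolic_subalgebra scale br f UNIV"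
    and "complex_lie_algebra.adapted scale br g0 f \<theta> h0"
    and "\<kappa>0 = {X \<in> g0. \<theta> X = X}"
    and "\<kappa> = complex_lie_algebra.complexify scale \<kappa>0"
    and "v = f \<inter> \<kappa>"
  shows
    "lie_algebra.reductive_complement scale br
       (v \<inter> complex_lie_algebra.conjugation scale g0 ` v)
       (lie_algebra.nil_ideal scale br \<kappa> v) v \<and>
     (\<forall>(\<iota> :: 'g \<Rightarrow> complex^'n^'n) G G0 K0 M.
        algebraic_group G \<and> connected G \<and>
        complex_lie_algebra.lie_identification scale br \<iota> G \<and>
        linear_group G0 \<and> G0 \<subseteq> G \<and> closedin (top_of_set G) G0 \<and>
        group_lie_algebra G0 = \<iota> ` g0 \<and>
        maximal_compact_subgroup K0 G0 \<and> group_lie_algebra K0 = \<iota> ` \<kappa>0 \<and>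
        M = Ad_orbit \<iota> K0 f
        \<longrightarrow> complex_lie_algebra.n_reductive_CR_manifold scale br \<iota> G f K0 M f)"
proof -
  interpret complex_lie_algebra scale br by fact
  interpret cartan: cartan_involution_pair scale br g0 \<theta>
    by unfold_locales (use assms(2,5) in \<open>auto simp: adapted_def\<close>)
  have f: "lie_subalgebra f" using assms(4) by (simp add: parabolic_subalgebra_def)
  note complement = cartan.maximal_compact_reductive_complement[OF f assms(5-8)]
  show ?thesis
  proof (intro conjI allI impI)
    show "reductive_complement (v \<inter> conjugation g0 ` v) (nil_ideal \<kappa> v) v"
      by (rule complement(1))
    fix \<iota> :: "'g \<Rightarrow> complex^'n^'n" and G G0 K0 M
    assume grp: "algebraic_group G \<and> connected G \<and> lie_identification \<iota> G \<and>
        linear_group G0 \<and> G0 \<subseteq> G \<and> closedin (top_of_set G) G0 \<and>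
        group_lie_algebra G0 = \<iota> ` g0 \<and>
        maximal_compact_subgroup K0 G0 \<and> group_lie_algebra K0 = \<iota> ` \<kappa>0 \<and>
        M = Ad_orbit \<iota> K0 f"
    interpret orbit: group_orbit scale br \<iota> G f K0 \<kappa>0
    proof unfold_locales
      show "re.subspace \<kappa>0" unfolding assms(6) by (rule cartan.fixed_subspace)
      show "z \<in> f" if "\<And>y. y \<in> f \<Longrightarrow> br z y \<in> f" for z by (rule complement(3)[OF that])
    qed (use grp f in \<open>auto simp: algebraic_group_def maximal_compact_subgroup_def\<close>)
    \<comment> \<open>The definition conjugates with respect to the Lie algebra of
      \<open>K0\<close>, the complement is stated with respect to \<open>g0\<close>; on
      \<open>v\<close> the two conjugations have the same image.\<close>
    have "n_reductive_CR_manifold \<iota> G f K0 (Ad_orbit \<iota> K0 f) f"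
      by (rule orbit.n_reductive_orbit)
        (use complement(1,2) assms(7,8) in simp)
    then show "n_reductive_CR_manifold \<iota> G f K0 M f" using grp by simp
  qed
qed

end
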